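(* Let $d\in\mathbb{N}$, $d\ge2$, $\beta\ge1$, $\ell$ the largest integer strictly smaller than $\beta$, $L_0,\dots,L_\ell,L_\beta>0$, $C_{\mathsf{noise}},C_{\mathsf{cvrtm}}>0$. There is a constant $C>0$ large enough, depending only on $\beta,d,L_0,\dots,L_\ell,L_\beta,C_{\mathsf{noise}},C_{\mathsf{cvrtm}}$, with the following property. Consider the snake model described in the context with parameters $n\in\mathbb{N}$, $\delta>0$, $T_{\mathsf{sum}}>0$, satisfying (Noise) and (CoverTime). Assume $$C\max\Big(\Big(\frac{T_{\mathsf{sum}}}{n}\Big)^{2\beta+d+1},\,T_{\mathsf{sum}}^{-1}\Big)\le\delta^{d-1}\le C^{-1}\min\Big(1,\frac{n}{T_{\mathsf{sum}}}\Big).$$ Then $$\forall x_0\in[0,1]^d:\ C\inf_{\hat f}\sup_{\theta^\star\in\Theta^{\mathsf{snake}}_{d,\beta}}\mathbf{E}_{\theta^\star}\big[\|\hat f(x_0)-f_{\theta^\star}(x_0)\|_2^2\big]\ge\delta^{2\beta}+\big(\delta^{-(d-1)}nT_{\mathsf{sum}}^{-1}\big)^{-\frac{2\beta}{2(\beta+1)+d}},$$ $$C\inf_{\hat f}\sup_{\theta^\star\in\Theta^{\mathsf{snake}}_{d,\beta}}\mathbf{E}_{\theta^\star}\Big[\sup_{x\in[0,1]^d}\|\hat f(x)-f_{\theta^\star}(x)\|_2^2\Big]\ge\delta^{2\beta}+\Big(\frac{\delta^{-(d-1)}nT_{\mathsf{sum}}^{-1}}{\log(\delta^{-(d-1)}nT_{\mathsf{sum}}^{-1})}\Big)^{-\frac{2\beta}{2(\beta+1)+d}},$$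 $$C\inf_{\hat f}\sup_{\theta^\star\in\Theta^{\mathsf{snake}}_{d,\beta}}\mathbf{E}_{\theta^\star}\Big[\big\|\,\|\hat f-f_{\theta^\star}\|_2\,\big\|_{L^2([0,1]^d)}^2\Big]\ge\delta^{2\beta}+\big(\delta^{-(d-1)}nT_{\mathsf{sum}}^{-1}\big)^{-\frac{2\beta}{2(\beta+1)+d}},$$ where the infima range over all estimators $\hat f$ of $f_{\theta^\star}$ based on the observations $(Y_{j,i})$.
   Context: Smoothness class: $\mathcal{F}_{d,\beta}$ is the set of functions $f=(f_1,\dots,f_d):\mathbb{R}^d\to\mathbb{R}^d$ such that each component $f_j$ is $\ell$ times differentiable, $\sup_x\|D^kf_j(x)\|_{\mathsf{op}}\le L_k$ for $k=0,\dots,\ell$, and $\|D^\ell f_j(x)-D^\ell f_j(\tilde x)\|_{\mathsf{op}}\le L_\beta\|x-\tilde x\|_2^{\beta-\ell}$ for all $x,\tilde x\in\mathbb{R}^d$. Here $D^k f_j(x)$ is the $k$-th derivative as a symmetric $k$-linear form and $\|A\|_{\mathsf{op}}=\sup\{|A(v_1,\dots,v_k)|:\|v_i\|_2=1\}$; $\|\cdot\|_2$ is the Euclidean norm. Flow: for Lipschitz $f:\mathbb{R}^d\to\mathbb{R}^d$ and $x\in\mathbb{R}^d$, $t\mapsto U(f,x,t)$ is the solution of $\dot u(t)=f(u(t))$, $u(0)=x$. Tube: for continuously differentiable $u:[0,T]\to\mathbb{R}^d$ and $\delta>0$, $$\mathcal{T}(u,\delta)=\bigcup_{t\in[0,T]}\{u(t)+v:\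 \dot u(t)\ne0,\ v^\top\dot u(t)=0,\ \|v\|_2\le\delta\}.$$ Tube distance: for $\theta=(f,(x_j)_{j=1}^m,(T_j)_{j=1}^m)$ with $f$ Lipschitz, $x_j\in\mathbb{R}^d$, $T_j>0$, let $u_j=U(f,x_j,\cdot):[0,T_j]\to\mathbb{R}^d$; for $A\subseteq\mathbb{R}^d$, $d_{\mathcal{T}}(A,\theta)=\inf\{\delta>0:\ A\subseteq\bigcup_{j=1}^m\mathcal{T}(u_j,\delta)\}$. Snake parameter class: $\Theta^{\mathsf{snake}}_{d,\beta}$ (depending on $L_0,\dots,L_\ell,L_\beta,\delta,T_{\mathsf{sum}}$) is the set of all $\theta=(f,(x_j)_{j=1}^m,(T_j)_{j=1}^m)\in\mathcal{F}_{d,\beta}\times(\mathbb{R}^d)^m\times(0,\infty)^m$ with $m\in\mathbb{N}$, $\sum_{j=1}^mT_j=T_{\mathsf{sum}}$, and $d_{\mathcal{T}}([0,1]^d,\theta)\le\delta$. Write $f_\theta=f$. Observation model: for $\theta^\star=(f^\star,(x_j)_{j=1}^m,(T_j)_{j=1}^m)\in\Theta^{\mathsf{snake}}_{d,\beta}$ one observes $$Y_{j,i}=U(f^\star,x_j,t_{j,i})+\varepsilon_{j,i},\qquad j\in\{1,\dots,m\},\ i\in\{1,\dots,n_j\},$$ where $n_1,\dots,n_m\in\mathbb{N}$ with $\sum_jn_j=n$ (so $m\le n$), the observation times satisfy $0\le t_{j,1}\le\dots\le t_{j,n_j}=T_j$, and $\varepsilon_{j,i}$ are i.i.d. centered $\mathbb{R}^d$-valued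 with distribution $P^\varepsilon$. The design $(n_j),(t_{j,i})$ is fixed for each $(m,(T_j)_{j=1}^m)$. The initial conditions $x_j$ and times $t_{j,i}$ are known; only $f^\star$ is unknown. $\mathbf{E}_{\theta^\star}$ is the corresponding expectation. (Noise): for all $v_1,v_2\in\mathbb{R}^d$, $\mathrm{KL}(v_1+P^\varepsilon,v_2+P^\varepsilon)\le C_{\mathsf{noise}}\|v_1-v_2\|_2^2$, with $\mathrm{KL}$ the Kullback–Leibler divergence and $v+P$ the distribution $P$ shifted by $v$. (CoverTime): for all $j$ and all $a,b\in[0,T_j]$ with $a<b$, $\#\{i\in\{1,\dots,n_j\}:t_{j,i}\in[a,b]\}\le\max\big(1,\,C_{\mathsf{cvrtm}}(b-a)\frac{n}{T_{\mathsf{sum}}}\big)$; this holds for every design in the model with the same constant. *)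

theory Defs
  imports "HOL-Probability.Probability"
begin

text \<open>Euclidean space of dimension d is \<^typ>\<open>real^'n\<close> with \<open>d = CARD('n)\<close>.\<close>

text \<open>\<open>iter_deriv g [v\<^sub>1, \<dots>, v\<^sub>k] x\<close> is the k-linear form \<open>D\<^sup>k g(x)\<close> evaluated at
  \<open>(v\<^sub>1, \<dots>, v\<^sub>k)\<close>.\<close>

primrec iter_deriv :: "(real^'n \<Rightarrow> real) \<Rightarrow> (real^'n) list \<Rightarrow> real^'n \<Rightarrow> real" where
  "iter_deriv g [] = g"
| "iter_deriv g (v # vs) = (\<lambda>x. frechet_derivative (iter_deriv g vs) (at x) v)"

text \<open>The space of k-linear forms is finite-dimensional, so total differentiability of
  \<open>x \<mapsto> D\<^sup>k g(x)\<close> amounts to total differentiability of \<open>x \<mapsto> D\<^sup>k g(x)(v\<^sub>1, \<dots>, v\<^sub>k)\<close> for all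
  fixed \<open>v\<^sub>1, \<dots>, v\<^sub>k\<close>.\<close>

definition times_differentiable :: "nat \<Rightarrow> (real^'n \<Rightarrow> real) \<Rightarrow> bool" where
  "times_differentiable l g \<longleftrightarrow>
     (\<forall>vs. length vs < l \<longrightarrow> (\<forall>x. iter_deriv g vs differentiable (at x)))"

definition form_op_norm :: "nat \<Rightarrow> ((real^'n) list \<Rightarrow> real) \<Rightarrow> ereal" where
  "form_op_norm k A =
     (SUP vs\<in>{vs. length vs = k \<and> (\<forall>v\<in>set vs. norm v = 1)}. ereal \<bar>A vs\<bar>)"

definition smoothness_order :: "real \<Rightarrow> nat" where
  "smoothness_order \<beta> = (GREATEST l. real l < \<beta>)"

text \<open>Only the bounds \<open>L k\<close> with \<open>k \<le> smoothness_order \<beta>\<close> are used.\<close>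

definition smooth_component :: "real \<Rightarrow> (nat \<Rightarrow> real) \<Rightarrow> real \<Rightarrow> (real^'n \<Rightarrow> real) \<Rightarrow> bool" where
  "smooth_component \<beta> L L\<beta> g \<longleftrightarrow>
     (let l = smoothness_order \<beta> in
       times_differentiable l g \<and>
       (\<forall>k\<le>l. (SUP x. form_op_norm k (\<lambda>vs. iter_deriv g vs x)) \<le> ereal (L k)) \<and>
       (\<forall>x y. form_op_norm l (\<lambda>vs. iter_deriv g vs x - iter_deriv g vs y)
                \<le> ereal (L\<beta> * norm (x - y) powr (\<beta> - real l))))"

definition smooth_class :: "real \<Rightarrow> (nat \<Rightarrow> real) \<Rightarrow> real \<Rightarrow> (real^'n \<Rightarrow> real^'n) set" where
  "smooth_class \<beta> L L\<beta> = {f. \<forall>j. smooth_component \<beta> L L\<beta> (\<lambda>x. f x $ j)}"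

text \<open>For Lipschitz \<open>f\<close> the solution exists on the whole real line and is unique; every member of
  \<^const>\<open>smooth_class\<close> with \<open>\<beta> \<ge> 1\<close> is Lipschitz.\<close>

definition flow :: "(real^'n \<Rightarrow> real^'n) \<Rightarrow> real^'n \<Rightarrow> real \<Rightarrow> real^'n" where
  "flow f x = (THE u. u 0 = x \<and> (\<forall>t. (u has_vector_derivative f (u t)) (at t)))"

definition tube :: "(real \<Rightarrow> real^'n) \<Rightarrow> real \<Rightarrow> real \<Rightarrow> (real^'n) set" where
  "tube u T \<delta> = (\<Union>t\<in>{0..T}. {u t + v | v.
      vector_derivative u (at t within {0..T}) \<noteq> 0 \<and>
      v \<bullet> vector_derivative u (at t within {0..T}) = 0 \<and> norm v \<le> \<delta>})"

text \<open>\<open>(f, xs, Ts)\<close> stands for \<open>(f, (x\<^sub>j), (T\<^sub>j))\<close>; m is the common length of the two lists,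
  whose indices start from 0.\<close>

type_synonym 'n snake = "(real^'n \<Rightarrow> real^'n) \<times> (real^'n) list \<times> real list"

text \<open>Extended-real valued, so that the infimum of the empty set is \<open>\<infinity>\<close>.\<close>

definition tube_dist :: "(real^'n) set \<Rightarrow> 'n snake \<Rightarrow> ereal" where
  "tube_dist A = (\<lambda>(f, xs, Ts).
     (INF \<delta>\<in>{\<delta>. \<delta> > 0 \<and> A \<subseteq> (\<Union>j<length Ts. tube (flow f (xs ! j)) (Ts ! j) \<delta>)}. ereal \<delta>))"

definition unit_cube :: "(real^'n) set" where
  "unit_cube = {x. \<forall>i. 0 \<le> x $ i \<and> x $ i \<le> 1}"

definition snake_class ::
  "real \<Rightarrow> (nat \<Rightarrow> real) \<Rightarrow> real \<Rightarrow> real \<Rightarrow> real \<Rightarrow> 'n::finite snake set" where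
  "snake_class \<beta> L L\<beta> \<delta> Tsum = {(f, xs, Ts).
     f \<in> smooth_class \<beta> L L\<beta> \<and> length xs = length Ts \<and> (\<forall>T\<in>set Ts. T > 0) \<and>
     sum_list Ts = Tsum \<and> tube_dist unit_cube (f, xs, Ts) \<le> ereal \<delta>}"

text \<open>Each of the m trajectories is observed at least once (at its final time), so with n
  observations in total the observation model is defined only for \<open>m \<le> n\<close>.\<close>

definition snake_model ::
  "real \<Rightarrow> (nat \<Rightarrow> real) \<Rightarrow> real \<Rightarrow> real \<Rightarrow> real \<Rightarrow> nat \<Rightarrow> 'n::finite snake set" where
  "snake_model \<beta> L L\<beta> \<delta> Tsum n =
     {(f, xs, Ts). (f, xs, Ts) \<in> snake_class \<beta> L L\<beta> \<delta> Tsum \<and> length Ts \<le> n}"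

text \<open>A design assigns to each list \<open>Ts\<close> (which determines m) the list of the m lists of observation
  times \<open>t\<^sub>j\<^sub>,\<^sub>1, \<dots>, t\<^sub>j\<^sub>,\<^sub>n\<^sub>j\<close>.\<close>

type_synonym design = "real list \<Rightarrow> real list list"

definition valid_times :: "nat \<Rightarrow> real list \<Rightarrow> real list list \<Rightarrow> bool" where
  "valid_times n Ts tss \<longleftrightarrow>
     length tss = length Ts \<and> sum_list (map length tss) = n \<and>
     (\<forall>j<length Ts. tss ! j \<noteq> [] \<and> sorted (tss ! j) \<and> 0 \<le> hd (tss ! j) \<and> last (tss ! j) = Ts ! j)"

definition cover_time :: "real \<Rightarrow> nat \<Rightarrow> real \<Rightarrow> real list \<Rightarrow> real list list \<Rightarrow> bool" where
  "cover_time Ccvrtm n Tsum Ts tss \<longleftrightarrow>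
     (\<forall>j<length Ts. \<forall>a\<in>{0..Ts ! j}. \<forall>b\<in>{0..Ts ! j}. a < b \<longrightarrow>
        real (card {i. i < length (tss ! j) \<and> tss ! j ! i \<in> {a..b}})
          \<le> max 1 (Ccvrtm * (b - a) * (real n / Tsum)))"

text \<open>\<open>kl M N\<close> is KL(M, N), the integral of the logarithm of dM/dN with respect to M. The library's
  \<^const>\<open>KL_divergence\<close> takes the reference measure first and is meaningful only for an absolutely
  continuous pair with integrable log-density; for probability measures the negative part of the
  log-density is always integrable, so the remaining value is \<open>\<infinity>\<close>.\<close>

definition kl :: "'a measure \<Rightarrow> 'a measure \<Rightarrow> ereal" where
  "kl M N = (if absolutely_continuous N M \<and> integrable M (entropy_density (exp 1) N M)
             then ereal (KL_divergence (exp 1) N M) else \<infinity>)"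

definition shift_measure :: "real^'n \<Rightarrow> (real^'n) measure \<Rightarrow> (real^'n) measure" where
  "shift_measure v P = distr P borel (\<lambda>e. v + e)"

definition centered_noise :: "(real^'n) measure \<Rightarrow> bool" where
  "centered_noise P \<longleftrightarrow>
     prob_space P \<and> sets P = sets borel \<and> integrable P (\<lambda>e. e) \<and> integral\<^sup>L P (\<lambda>e. e) = 0"

definition noise_condition :: "real \<Rightarrow> (real^'n) measure \<Rightarrow> bool" where
  "noise_condition Cnoise P \<longleftrightarrow>
     (\<forall>v1 v2. kl (shift_measure v1 P) (shift_measure v2 P) \<le> ereal (Cnoise * (norm (v1 - v2))\<^sup>2))"

definition obs_index :: "real list list \<Rightarrow> (nat \<times> nat) set" where
  "obs_index tss = (SIGMA j:{..<length tss}. {..<length (tss ! j)})"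

definition observe ::
  "(real^'n \<Rightarrow> real^'n) \<Rightarrow> (real^'n) list \<Rightarrow> real list list \<Rightarrow> (nat \<times> nat \<Rightarrow> real^'n) \<Rightarrow>
   (nat \<times> nat \<Rightarrow> real^'n)" where
  "observe f xs tss \<epsilon> = (\<lambda>(j, i)\<in>obs_index tss. flow f (xs ! j) (tss ! j ! i) + \<epsilon> (j, i))"

text \<open>An estimator may use the known initial conditions and times besides the observations. It is
  jointly measurable in the observations and the point of evaluation.\<close>

type_synonym 'n estimator =
  "(real^'n) list \<Rightarrow> real list \<Rightarrow> (nat \<times> nat \<Rightarrow> real^'n) \<Rightarrow> real^'n \<Rightarrow> real^'n"

definition estimators :: "design \<Rightarrow> 'n::finite estimator set" where
  "estimators D = {fhat. \<forall>xs Ts.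
     (\<lambda>(Y, x). fhat xs Ts Y x) \<in>
       (\<Pi>\<^sub>M p\<in>obs_index (D Ts). borel) \<Otimes>\<^sub>M borel \<rightarrow>\<^sub>M borel}"

definition risk ::
  "(real^'n) measure \<Rightarrow> design \<Rightarrow> ((real^'n \<Rightarrow> real^'n) \<Rightarrow> (real^'n \<Rightarrow> real^'n) \<Rightarrow> ennreal) \<Rightarrow>
   'n::finite estimator \<Rightarrow> 'n snake \<Rightarrow> ennreal" where
  "risk P D loss fhat = (\<lambda>(f, xs, Ts).
     \<integral>\<^sup>+ \<epsilon>. loss (fhat xs Ts (observe f xs (D Ts) \<epsilon>)) f \<partial>(\<Pi>\<^sub>M p\<in>obs_index (D Ts). P))"

definition minimax_risk ::
  "'n snake set \<Rightarrow> (real^'n) measure \<Rightarrow> design \<Rightarrow>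
   ((real^'n \<Rightarrow> real^'n) \<Rightarrow> (real^'n \<Rightarrow> real^'n) \<Rightarrow> ennreal) \<Rightarrow> ennreal" where
  "minimax_risk \<Theta> P D loss = (INF fhat\<in>estimators D. SUP \<theta>\<in>\<Theta>. risk P D loss fhat \<theta>)"

definition point_loss :: "real^'n \<Rightarrow> (real^'n \<Rightarrow> real^'n) \<Rightarrow> (real^'n \<Rightarrow> real^'n) \<Rightarrow> ennreal" where
  "point_loss x0 g f = ennreal ((norm (g x0 - f x0))\<^sup>2)"

text \<open>With a jointly measurable estimator this loss is a universally measurable function of the
  observations, and \<open>nn_integral\<close> agrees with the integral for the completed measure.\<close>

definition sup_loss :: "(real^'n \<Rightarrow> real^'n) \<Rightarrow> (real^'n \<Rightarrow> real^'n) \<Rightarrow> ennreal" where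
  "sup_loss g f = (SUP x\<in>unit_cube. ennreal ((norm (g x - f x))\<^sup>2))"

definition L2_loss :: "(real^'n \<Rightarrow> real^'n) \<Rightarrow> (real^'n \<Rightarrow> real^'n) \<Rightarrow> ennreal" where
  "L2_loss g f = (\<integral>\<^sup>+ x\<in>unit_cube. ennreal ((norm (g x - f x))\<^sup>2) \<partial>lborel)"

end

theory Submission
  imports Defs
begin

text \<open>All hypotheses have drifts that point in one fixed coordinate direction, with a scalar speed
  equal to a constant plus small bumps, so every trajectory stays on a straight line and the cover of
  the unit cube by tubes is not affected by the bumps. Two mechanisms make a bump hard to detect.
  First, a bump of width of order \<open>\<delta>\<close> fits between neighbouring trajectories and is not seen at all;
  this gives \<open>\<delta>\<^bsup>2\<beta>\<^esup>\<close>. Second, a bump of width \<open>\<rho> \<ge> \<delta>\<close> and height of order \<open>\<rho>\<^sup>\<beta>\<close> displaces a trajectory by order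
  \<open>\<rho>\<^bsup>\<beta>+1\<^esup>\<close>. The trajectories are cut into pieces of length \<open>\<rho>\<close> with known starting points, so that the
  displacement is not carried along, and only about \<open>(\<rho> / \<delta>)\<^bsup>d-1\<^esup> \<rho> n / T\<close> observations are affected. The
  information about the bump is thus of order \<open>N \<rho>\<^bsup>2\<beta>+2+d\<^esup>\<close>, where \<open>N = \<delta>\<^bsup>-(d-1)\<^esup> n / T\<close>, and \<open>\<rho>\<close> is chosen such
  that this is of order \<open>1\<close>, or of order \<open>ln N\<close> when about \<open>1 / \<rho>\<close> disjoint bumps compete in the
  supremum loss. The \<open>L\<^sup>2\<close> loss is treated by switching the bumps of a lattice on and off independently.\<close>

text \<open>The estimator knows the initial points and durations, so these have to be common to all
  hypotheses. Bumps therefore only add to the base speed \<open>v\<close>: a trajectory of duration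
  \<open>h / v\<close> then covers its segment of length \<open>h\<close> under every hypothesis.
  The assumption on \<delta>^(d-1) enters in three ways. With \<gamma> = 2(\<beta> + 1) + d, the
  power 2\<beta> + d + 1 = \<gamma> - 1 is the one that yields T / n \<le> N^(-1/\<gamma>); hence
  \<rho> n / T \<ge> 1 at the critical width, and the \<open>1\<close> in the maximum of
  \<open>cover_time\<close> costs only a constant factor. The term 1 / T makes \<delta>^(d-1) T
  large, which leaves enough time and enough observations for all the trajectories of a cover of
  mesh \<delta>. The upper bound makes N exceed any prescribed constant, as the logarithms require.
  A sum of two rates is at most twice the larger one, so one mechanism at a time suffices: wide
  bumps if \<delta> is at most the critical width, invisible ones otherwise.\<close>

section \<open>Likelihood ratios of product measures\<close>

lemma density_PiM_finite:
  assumes "finite I" "\<And>i. sigma_finite_measure (N i)" "\<And>i. sigma_finite_measure (M i)"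
    and "\<And>i. f i \<in> borel_measurable (N i)"
    and M: "\<And>i. M i = density (N i) (f i)"
  shows "PiM I M = density (PiM I N) (\<lambda>x. \<Prod>i\<in>I. f i (x i))"
proof -
  interpret N: product_sigma_finite N by (rule product_sigma_finite.intro) fact
  interpret M: product_sigma_finite M by (rule product_sigma_finite.intro) fact
  have sets_eq: "sets (PiM I M) = sets (PiM I N)"
    by (rule sets_PiM_cong) (simp_all add: M)
  note [measurable] = assms(4)
  have meas: "(\<lambda>x. \<Prod>i\<in>I. f i (x i)) \<in> borel_measurable (PiM I N)"
    using assms(1) by measurable
  show ?thesis
  proof (rule M.PiM_eqI[symmetric])
    fix A assume A: "\<And>i. i \<in> I \<Longrightarrow> A i \<in> sets (M i)"
    then have AN[measurable]: "\<And>i. i \<in> I \<Longrightarrow> A i \<in> sets (N i)" by (simp add: M)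
    have "emeasure (density (PiM I N) (\<lambda>x. \<Prod>i\<in>I. f i (x i))) (Pi\<^sub>E I A)
        = (\<integral>\<^sup>+ x. (\<Prod>i\<in>I. f i (x i)) * indicator (Pi\<^sub>E I A) x \<partial>PiM I N)"
      using meas AN assms(1) by (intro emeasure_density) (auto intro!: sets_PiM_I_finite)
    also have "\<dots> = (\<integral>\<^sup>+ x. (\<Prod>i\<in>I. f i (x i) * indicator (A i) (x i)) \<partial>PiM I N)"
    proof (rule nn_integral_cong)
      fix x assume "x \<in> space (PiM I N)"
      \<comment> \<open>Points of the product space are undefined outside \<open>I\<close>, so the
        coordinates in \<open>I\<close> alone decide membership in the box.\<close>
      then have "x \<in> extensional I" by (simp add: space_PiM PiE_def)
      then have "indicator (Pi\<^sub>E I A) x = (\<Prod>i\<in>I. indicator (A i) (x i) :: ennreal)"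
        using assms(1) by (auto simp: indicator_def PiE_def Pi_def prod_zero_iff)
      then show "(\<Prod>i\<in>I. f i (x i)) * indicator (Pi\<^sub>E I A) x = (\<Prod>i\<in>I. f i (x i) * indicator (A i) (x i))"
        by (simp add: prod.distrib)
    qed
    also have "\<dots> = (\<Prod>i\<in>I. \<integral>\<^sup>+ x. f i x * indicator (A i) x \<partial>N i)"
      using assms(1) by (intro N.product_nn_integral_prod) auto
    also have "\<dots> = (\<Prod>i\<in>I. emeasure (M i) (A i))"
      by (intro prod.cong refl) (simp add: M emeasure_density AN)
    finally show "emeasure (density (PiM I N) (\<lambda>x. \<Prod>i\<in>I. f i (x i))) (Pi\<^sub>E I A) = (\<Prod>i\<in>I. emeasure (M i) (A i))" .
  qed (simp_all add: assms(1) sets_eq)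
qed

text \<open>With the log-likelihood ratio \<open>S\<close>, Markov's inequality is applied to \<open>S + exp (- S) \<ge> 0\<close>. Its
  expectation is at most the divergence plus \<open>1\<close>, so the negative part of \<open>S\<close> needs no treatment.\<close>

lemma emeasure_PiM_kl_bound:
  fixes M N :: "'i \<Rightarrow> 'a measure"
  assumes I: "finite I" and pM: "\<And>i. prob_space (M i)" and pN: "\<And>i. prob_space (N i)"
    and sets_eq: "\<And>i. sets (M i) = sets (N i)"
    and kl: "\<And>i. kl (M i) (N i) \<le> ereal (\<kappa> i)"
    and B: "B \<in> sets (PiM I M)" and "1 < \<tau>"
  shows "emeasure (PiM I M) B
    \<le> ennreal \<tau> * emeasure (PiM I N) B + ennreal ((sum \<kappa> I + 1) / ln \<tau>)"
proof -
  interpret PM: prob_space "PiM I M" by (intro prob_space_PiM pM)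
  interpret M: product_prob_space M I by (intro product_prob_spaceI pM)
  interpret N: product_prob_space N I by (intro product_prob_spaceI pN)
  define s where "s = ln \<tau>"
  have s: "0 < s" using \<open>1 < \<tau>\<close> by (simp add: s_def)
  define f where "f i = RN_deriv (N i) (M i)" for i
  define X where "X i = entropy_density (exp 1) (N i) (M i)" for i
  have ac: "absolutely_continuous (N i) (M i)" and Xint: "integrable (M i) (X i)"
    and Xle: "integral\<^sup>L (M i) (X i) \<le> \<kappa> i" for i
    using kl[of i] by (auto simp: kl_def X_def KL_divergence_def split: if_splits)
  have fm[measurable]: "f i \<in> borel_measurable (N i)" for i by (simp add: f_def)
  have fm'[measurable]: "f i \<in> borel_measurable (M i)" for i
    unfolding measurable_cong_sets[OF sets_eq[of i] refl] by (rule fm)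
  have Md: "M i = density (N i) (f i)" for i
    using sigma_finite_measure.density_RN_deriv[OF N.sigma_finite_measures ac[of i] sets_eq]
    by (simp add: f_def)
  have X_eq: "X i x = ln (enn2real (f i x))" for i x
    by (simp add: X_def entropy_density_def f_def log_def)
  have fin: "AE x in N i. f i x \<noteq> \<infinity>" for i
    unfolding f_def using ac sets_eq
    by (intro sigma_finite_measure.RN_deriv_finite N.sigma_finite_measures M.sigma_finite_measures) auto
  have Xm[measurable]: "X i \<in> borel_measurable (M i)" "X i \<in> borel_measurable (N i)" for i
    unfolding X_eq by measurable
  \<comment> \<open>The reciprocal density integrates to the \<open>N i\<close>-mass of the set
    where \<open>f i\<close> is positive, hence only an inequality. Where \<open>f i\<close>
    vanishes, \<open>ln 0 = 0\<close> makes the exponential 1, but the density factor removes that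
    part.\<close>
  have expX: "(\<integral>\<^sup>+ x. ennreal (exp (- X i x)) \<partial>M i) \<le> 1" for i
  proof -
    have "(\<integral>\<^sup>+ x. ennreal (exp (- X i x)) \<partial>M i) = (\<integral>\<^sup>+ x. f i x * ennreal (exp (- X i x)) \<partial>N i)"
      by (subst Md) (simp add: nn_integral_density)
    also have "\<dots> \<le> (\<integral>\<^sup>+ x. 1 \<partial>N i)"
    proof (rule nn_integral_mono_AE)
      show "AE x in N i. f i x * ennreal (exp (- X i x)) \<le> 1"
        using fin[of i]
      proof eventually_elim
        case (elim x)
        then obtain r where r: "f i x = ennreal r" "0 \<le> r" by (cases "f i x") auto
        then show ?case
          by (cases "r = 0") (auto simp: X_eq exp_minus ennreal_mult[symmetric])
      qed
    qed
    finally show ?thesis using N.M.emeasure_space_1 by simp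
  qed
  have expX_int: "integrable (M i) (\<lambda>x. exp (- X i x))" for i
    using expX[of i] by (intro integrableI_bounded) (auto intro: le_less_trans)
  have expX_le: "(\<integral>x. exp (- X i x) \<partial>M i) \<le> 1" for i
    using expX[of i] by (subst integral_eq_nn_integral) (auto intro: enn2real_leI)
  define S where "S x = (\<Sum>i\<in>I. X i (x i))" for x
  have comp_int: "integrable (PiM I M) (\<lambda>x. X i (x i))"
    and comp_eq: "(\<integral>x. X i (x i) \<partial>PiM I M) = integral\<^sup>L (M i) (X i)" if "i \<in> I" for i
  proof -
    have "integrable (distr (PiM I M) (M i) (\<lambda>x. x i)) (X i)"
      using Xint M.PiM_component[OF that] by simp
    then show "integrable (PiM I M) (\<lambda>x. X i (x i))"
      using that by (subst (asm) integrable_distr_eq) auto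
    have "integral\<^sup>L (distr (PiM I M) (M i) (\<lambda>x. x i)) (X i) = (\<integral>x. X i (x i) \<partial>PiM I M)"
      using that by (intro integral_distr) auto
    then show "(\<integral>x. X i (x i) \<partial>PiM I M) = integral\<^sup>L (M i) (X i)"
      using M.PiM_component[OF that] by simp
  qed
  have S_int: "integrable (PiM I M) S" and ES: "integral\<^sup>L (PiM I M) S \<le> sum \<kappa> I"
    unfolding S_def using comp_int comp_eq Xle by (auto intro!: sum_mono)
  have exp_S: "exp (- S x) = (\<Prod>i\<in>I. exp (- X i (x i)))" for x
    using I by (simp add: S_def exp_sum flip: sum_negf)
  have eS_int: "integrable (PiM I M) (\<lambda>x. exp (- S x))"
    unfolding exp_S by (intro M.product_integrable_prod I expX_int)
  have eS: "(\<integral>x. exp (- S x) \<partial>PiM I M) \<le> 1"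
    unfolding exp_S using I expX_int expX_le
    by (subst M.product_integral_prod) (auto intro!: prod_le_1)
  have Sm[measurable]: "S \<in> borel_measurable (PiM I M)" "S \<in> borel_measurable (PiM I N)"
    unfolding S_def by measurable
  define H where "H = {x\<in>space (PiM I M). s < S x}"
  have H[measurable]: "H \<in> sets (PiM I M)" unfolding H_def by measurable
  have "measure (PiM I M) H \<le> (sum \<kappa> I + 1) / s"
  proof -
    have pos: "0 \<le> S x + exp (- S x)" for x
      using exp_ge_add_one_self[of "- S x"] by linarith
    have "measure (PiM I M) H \<le> measure (PiM I M) {x\<in>space (PiM I M). s \<le> S x + exp (- S x)}"
      by (intro PM.finite_measure_mono) (auto simp: H_def intro: less_imp_le add_strict_increasing2 order_trans[of _ "S _"])
    also have "\<dots> \<le> (\<integral>x. S x + exp (- S x) \<partial>PiM I M) / s"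
      using pos s S_int eS_int by (intro integral_Markov_inequality_measure[where A="{}"]) auto
    also have "\<dots> \<le> (sum \<kappa> I + 1) / s"
      using S_int eS_int ES eS s by (intro divide_right_mono) (auto intro!: add_mono)
    finally show ?thesis .
  qed
  then have tail: "emeasure (PiM I M) H \<le> ennreal ((sum \<kappa> I + 1) / s)"
    by (simp add: PM.emeasure_eq_measure ennreal_leI)
  have sets_PiM_eq: "sets (PiM I M) = sets (PiM I N)"
    using sets_eq by (intro sets_PiM_cong) auto
  have BN[measurable]: "B \<in> sets (PiM I N)" using B sets_PiM_eq by simp
  have HN: "B - H \<in> sets (PiM I N)" using B H sets_PiM_eq by (metis sets.Diff)
  have dens: "PiM I M = density (PiM I N) (\<lambda>x. \<Prod>i\<in>I. f i (x i))"
    by (intro density_PiM_finite I N.sigma_finite_measures M.sigma_finite_measures Md) simp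
  have "emeasure (PiM I M) (B - H) = (\<integral>\<^sup>+ x. (\<Prod>i\<in>I. f i (x i)) * indicator (B - H) x \<partial>PiM I N)"
    unfolding dens using HN by (intro emeasure_density) auto
  also have "\<dots> \<le> (\<integral>\<^sup>+ x. ennreal \<tau> * indicator B x \<partial>PiM I N)"
  proof (rule nn_integral_mono_AE)
    have "AE x in PiM I N. \<forall>i\<in>I. f i (x i) \<noteq> \<infinity>"
      using I fin pN by (intro AE_finite_allI AE_PiM_component) auto
    then have "AE x in PiM I N. x \<in> space (PiM I N) \<and> (\<forall>i\<in>I. f i (x i) \<noteq> \<infinity>)"
      by auto
    then show "AE x in PiM I N. (\<Prod>i\<in>I. f i (x i)) * indicator (B - H) x \<le> ennreal \<tau> * indicator B x"
    proof eventually_elim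
      case (elim x)
      show ?case
      \<comment> \<open>\<open>S\<close> is the logarithm of the product density only where no
        factor vanishes; off \<open>H\<close> it is then at most \<open>ln \<tau>\<close>. If some
        factor vanishes, so does the whole density.\<close>
      proof (cases "x \<in> B - H \<and> (\<forall>i\<in>I. f i (x i) \<noteq> 0)")
        case True
        have "x \<in> space (PiM I M)" using elim sets_eq_imp_space_eq[OF sets_PiM_eq] by simp
        with True have Sx: "S x \<le> s" by (auto simp: H_def)
        have "f i (x i) = ennreal (exp (X i (x i)))" if "i \<in> I" for i
        proof -
          have "f i (x i) \<noteq> 0" "f i (x i) \<noteq> \<infinity>"
            using True elim that by auto
          then obtain r where "f i (x i) = ennreal r" "0 < r"
            by (cases "f i (x i)") (auto simp: order_less_le)
          then show ?thesis by (simp add: X_eq)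
        qed
        then have "(\<Prod>i\<in>I. f i (x i)) = (\<Prod>i\<in>I. ennreal (exp (X i (x i))))"
          by (intro prod.cong) auto
        also have "\<dots> = ennreal (exp (S x))"
          using I by (simp add: S_def exp_sum prod_ennreal)
        also have "\<dots> \<le> ennreal \<tau>"
          using Sx \<open>1 < \<tau>\<close> by (intro ennreal_leI) (simp add: s_def ln_ge_iff)
        finally show ?thesis using True by simp
      next
        case False
        then consider "x \<notin> B - H" | i where "i \<in> I" "f i (x i) = 0" by auto
        then show ?thesis
        proof cases
          case 2
          then have "(\<Prod>i\<in>I. f i (x i)) = 0" using I by (intro prod_zero) auto
          then show ?thesis by (simp only: mult_zero_left zero_le)
        next
          case 1
          then have "indicator (B - H) x = (0 :: ennreal)" by (auto simp: indicator_def)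
          then show ?thesis by (simp only: mult_zero_right zero_le)
        qed
      qed
    qed
  qed
  also have "\<dots> = ennreal \<tau> * emeasure (PiM I N) B"
    by (simp add: nn_integral_cmult_indicator)
  finally have main: "emeasure (PiM I M) (B - H) \<le> ennreal \<tau> * emeasure (PiM I N) B" .
  have "emeasure (PiM I M) B \<le> emeasure (PiM I M) ((B - H) \<union> H)"
    using B H by (intro emeasure_mono) auto
  also have "\<dots> \<le> emeasure (PiM I M) (B - H) + emeasure (PiM I M) H"
    using B H by (intro emeasure_subadditive) auto
  also have "\<dots> \<le> ennreal \<tau> * emeasure (PiM I N) B + ennreal ((sum \<kappa> I + 1) / s)"
    by (intro add_mono main tail)
  finally show ?thesis by (simp add: s_def)
qed

section \<open>Testing bounds for shifted noise\<close>

definition obs_law :: "'i set \<Rightarrow> (real^'n) measure \<Rightarrow> ('i \<Rightarrow> real^'n) \<Rightarrow> ('i \<Rightarrow> real^'n) measure" where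
  "obs_law I P a = (\<Pi>\<^sub>M p\<in>I. shift_measure (a p) P)"

lemma sets_shift_measure [simp, measurable_cong]: "sets (shift_measure v P) = sets borel"
  by (simp add: shift_measure_def)

lemma prob_space_shift_measure:
  assumes "centered_noise P"
  shows "prob_space (shift_measure v P)"
  unfolding shift_measure_def
proof (rule prob_space.prob_space_distr)
  have [measurable_cong]: "sets P = sets borel" using assms by (simp add: centered_noise_def)
  show "(\<lambda>e. v + e) \<in> measurable P borel" by measurable
qed (use assms in \<open>simp add: centered_noise_def\<close>)

lemma prob_space_obs_law: "centered_noise P \<Longrightarrow> prob_space (obs_law I P a)"
  unfolding obs_law_def by (intro prob_space_PiM prob_space_shift_measure)

lemma sets_obs_law [simp, measurable_cong]: "sets (obs_law I P a) = sets (\<Pi>\<^sub>M p\<in>I. borel)"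
  unfolding obs_law_def by (rule sets_PiM_cong) auto

lemma space_obs_law [simp]: "space (obs_law I P a) = space (\<Pi>\<^sub>M p\<in>I. borel)"
  by (intro sets_eq_imp_space_eq) simp

lemma measurable_shift_PiM:
  assumes "sets P = sets (borel :: (real^'n) measure)"
  shows "(\<lambda>\<epsilon>. \<lambda>p\<in>I. a p + \<epsilon> p) \<in> measurable (\<Pi>\<^sub>M p\<in>I. P) (\<Pi>\<^sub>M p\<in>I. (borel :: (real^'n) measure))"
proof -
  note [measurable_cong] = assms
  show ?thesis by measurable
qed

lemma obs_law_eq_distr:
  fixes P :: "(real^'n) measure"
  assumes I: "finite I" and P: "centered_noise P"
  shows "obs_law I P a = distr (\<Pi>\<^sub>M p\<in>I. P) (\<Pi>\<^sub>M p\<in>I. borel) (\<lambda>\<epsilon>. \<lambda>p\<in>I. a p + \<epsilon> p)"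
proof -
  have P_borel[measurable_cong]: "sets P = sets borel" and pP: "prob_space P"
    using P by (auto simp: centered_noise_def)
  interpret S: product_prob_space "\<lambda>p. shift_measure (a p) P" I
    by (intro product_prob_spaceI prob_space_shift_measure P)
  interpret P: product_prob_space "\<lambda>_. P" I
    by (intro product_prob_spaceI pP)
  let ?h = "\<lambda>\<epsilon>. \<lambda>p\<in>I. a p + \<epsilon> p"
  have h: "?h \<in> measurable (\<Pi>\<^sub>M p\<in>I. P) (\<Pi>\<^sub>M p\<in>I. borel)"
    by (rule measurable_shift_PiM) fact
  have spP: "space P = UNIV" using sets_eq_imp_space_eq[OF P_borel] by simp
  show ?thesis
    unfolding obs_law_def
  proof (rule S.PiM_eqI[symmetric])
    fix A assume "\<And>p. p \<in> I \<Longrightarrow> A p \<in> sets (shift_measure (a p) P)"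
    then have A: "\<And>p. p \<in> I \<Longrightarrow> A p \<in> sets borel" by simp
    have m: "{e. a p + e \<in> A p} \<in> sets P" if "p \<in> I" for p
    proof -
      have "(\<lambda>e. a p + e) \<in> measurable P borel" by measurable
      then have "(\<lambda>e. a p + e) -` A p \<inter> space P \<in> sets P"
        using A[OF that] by (rule measurable_sets)
      then show ?thesis by (simp add: spP vimage_def)
    qed
    have "emeasure (distr (\<Pi>\<^sub>M p\<in>I. P) (\<Pi>\<^sub>M p\<in>I. borel) ?h) (Pi\<^sub>E I A)
        = emeasure (\<Pi>\<^sub>M p\<in>I. P) (?h -` Pi\<^sub>E I A \<inter> space (\<Pi>\<^sub>M p\<in>I. P))"
      using A I by (intro emeasure_distr h) (auto intro!: sets_PiM_I_finite)
    also have "?h -` Pi\<^sub>E I A \<inter> space (\<Pi>\<^sub>M p\<in>I. P) = Pi\<^sub>E I (\<lambda>p. {e. a p + e \<in> A p})"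
      by (auto simp: space_PiM spP PiE_def Pi_def)
    also have "emeasure (\<Pi>\<^sub>M p\<in>I. P) (Pi\<^sub>E I (\<lambda>p. {e. a p + e \<in> A p})) = (\<Prod>p\<in>I. emeasure P {e. a p + e \<in> A p})"
      using m I by (intro P.emeasure_PiM) auto
    also have "\<dots> = (\<Prod>p\<in>I. emeasure (shift_measure (a p) P) (A p))"
    proof (intro prod.cong refl)
      fix p assume "p \<in> I"
      then show "emeasure P {e. a p + e \<in> A p} = emeasure (shift_measure (a p) P) (A p)"
        using A unfolding shift_measure_def by (subst emeasure_distr) (auto simp: spP vimage_def)
    qed
    finally show "emeasure (distr (\<Pi>\<^sub>M p\<in>I. P) (\<Pi>\<^sub>M p\<in>I. borel) ?h) (Pi\<^sub>E I A)
      = (\<Prod>p\<in>I. emeasure (shift_measure (a p) P) (A p))" .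
  qed (use I in \<open>auto intro!: sets_PiM_cong\<close>)
qed

lemma nn_integral_obs_law:
  fixes P :: "(real^'n) measure"
  assumes "finite I" "centered_noise P" "\<phi> \<in> borel_measurable (\<Pi>\<^sub>M p\<in>I. (borel :: (real^'n) measure))"
  shows "(\<integral>\<^sup>+ \<epsilon>. \<phi> (\<lambda>p\<in>I. a p + \<epsilon> p) \<partial>(\<Pi>\<^sub>M p\<in>I. P)) = (\<integral>\<^sup>+ y. \<phi> y \<partial>obs_law I P a)"
  using assms measurable_shift_PiM[where P=P and I=I and a=a]
  by (simp add: obs_law_eq_distr nn_integral_distr centered_noise_def)

text \<open>The change of measure in real numbers: the factor \<open>\<tau>\<close> is free, and
  each testing bound below picks its own to trade it against the additive error.\<close>

lemma measure_obs_law_le: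
  fixes P :: "(real^'n) measure"
  assumes I: "finite I" and P: "centered_noise P" "noise_condition C P"
    and \<kappa>: "(\<Sum>p\<in>I. C * (norm (a p - b p))\<^sup>2) \<le> \<kappa>"
    and B: "B \<in> sets (\<Pi>\<^sub>M p\<in>I. (borel :: (real^'n) measure))" and \<tau>: "1 < \<tau>" and "0 \<le> C"
  shows "measure (obs_law I P a) B \<le> \<tau> * measure (obs_law I P b) B + (\<kappa> + 1) / ln \<tau>"
proof -
  interpret A: prob_space "obs_law I P a" by (intro prob_space_obs_law P)
  interpret B: prob_space "obs_law I P b" by (intro prob_space_obs_law P)
  have "emeasure (obs_law I P a) B \<le> ennreal \<tau> * emeasure (obs_law I P b) B
      + ennreal (((\<Sum>p\<in>I. C * (norm (a p - b p))\<^sup>2) + 1) / ln \<tau>)"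
    unfolding obs_law_def
    using P(2) B \<tau> I P(1) prob_space_shift_measure[OF P(1)]
      sets_obs_law[of I P a, unfolded obs_law_def]
    by (intro emeasure_PiM_kl_bound) (auto simp: noise_condition_def)
  also have "\<dots> \<le> ennreal \<tau> * emeasure (obs_law I P b) B + ennreal ((\<kappa> + 1) / ln \<tau>)"
    using \<kappa> \<tau> by (intro add_mono order_refl ennreal_leI divide_right_mono) auto
  finally have *: "ennreal (measure (obs_law I P a) B) \<le> ennreal \<tau> * ennreal (measure (obs_law I P b) B)
      + ennreal ((\<kappa> + 1) / ln \<tau>)"
    by (simp add: A.emeasure_eq_measure B.emeasure_eq_measure)
  have "0 \<le> (\<Sum>p\<in>I. C * (norm (a p - b p))\<^sup>2)" using \<open>0 \<le> C\<close> by (intro sum_nonneg) simp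
  also note \<kappa>
  finally have "0 \<le> \<kappa>" .
  then have "0 \<le> (\<kappa> + 1) / ln \<tau>" using \<tau> by simp
  with * \<tau> show ?thesis
    by (simp add: ennreal_mult[symmetric] ennreal_plus[symmetric] ennreal_le_iff del: ennreal_plus)
qed

text \<open>Le Cam's two-point method. Where \<open>\<phi>\<close> is below \<open>c\<close>, the
  separation forces \<open>\<psi>\<close> to be at least \<open>c\<close>; so the two risks dominate
  \<open>c\<close> times the two error probabilities of the test that looks at the size of
  \<open>\<phi>\<close>.\<close>

lemma two_point_bound:
  fixes P :: "(real^'n) measure"
  assumes I: "finite I" and P: "centered_noise P" "noise_condition C P" and "0 \<le> C"
    and \<kappa>: "(\<Sum>p\<in>I. C * (norm (a p - b p))\<^sup>2) \<le> 1"
    and m[measurable]: "\<phi> \<in> borel_measurable (\<Pi>\<^sub>M p\<in>I. (borel :: (real^'n) measure))"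
      "\<psi> \<in> borel_measurable (\<Pi>\<^sub>M p\<in>I. (borel :: (real^'n) measure))"
    and "0 \<le> c" and sep: "\<And>y. y \<in> space (\<Pi>\<^sub>M p\<in>I. borel) \<Longrightarrow> ennreal (2 * c) \<le> \<phi> y + \<psi> y"
  shows "ennreal (c / (2 * exp 4)) \<le> (\<integral>\<^sup>+ y. \<phi> y \<partial>obs_law I P a) + (\<integral>\<^sup>+ y. \<psi> y \<partial>obs_law I P b)"
proof -
  interpret A: prob_space "obs_law I P a" by (intro prob_space_obs_law P)
  interpret B: prob_space "obs_law I P b" by (intro prob_space_obs_law P)
  let ?E = "\<Pi>\<^sub>M p\<in>I. borel :: (real^'n) measure"
  define G where "G = {y\<in>space ?E. ennreal c \<le> \<phi> y}"
  define H where "H = {y\<in>space ?E. \<phi> y < ennreal c}"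
  have [measurable]: "G \<in> sets ?E" "H \<in> sets ?E" unfolding G_def H_def by measurable
  have H: "H = space ?E - G" by (auto simp: G_def H_def not_le)
  have 1: "ennreal c * measure (obs_law I P a) G \<le> (\<integral>\<^sup>+ y. \<phi> y \<partial>obs_law I P a)"
  proof -
    have "ennreal c * emeasure (obs_law I P a) G = (\<integral>\<^sup>+ y. ennreal c * indicator G y \<partial>obs_law I P a)"
      by (simp add: nn_integral_cmult_indicator)
    also have "\<dots> \<le> (\<integral>\<^sup>+ y. \<phi> y \<partial>obs_law I P a)"
      by (intro nn_integral_mono) (auto simp: G_def indicator_def)
    finally show ?thesis by (simp add: A.emeasure_eq_measure)
  qed
  have 2: "ennreal c * measure (obs_law I P b) H \<le> (\<integral>\<^sup>+ y. \<psi> y \<partial>obs_law I P b)"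
  proof -
    have "ennreal c * emeasure (obs_law I P b) H = (\<integral>\<^sup>+ y. ennreal c * indicator H y \<partial>obs_law I P b)"
      by (simp add: nn_integral_cmult_indicator)
    also have "\<dots> \<le> (\<integral>\<^sup>+ y. \<psi> y \<partial>obs_law I P b)"
    proof (intro nn_integral_mono)
      fix y
      show "ennreal c * indicator H y \<le> \<psi> y"
      proof (cases "y \<in> H")
        case True
        then have y: "\<phi> y < ennreal c" "y \<in> space ?E" by (auto simp: H_def)
        have "ennreal c \<le> \<psi> y"
        proof (rule ccontr)
          assume "\<not> ?thesis"
          then have "\<phi> y + \<psi> y < ennreal c + ennreal c"
            using y by (intro add_strict_mono) auto
          also have "\<dots> = ennreal (2 * c)" using \<open>0 \<le> c\<close> by (simp flip: ennreal_plus)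
          finally show False using sep[OF y(2)] by simp
        qed
        then show ?thesis using True by simp
      qed simp
    qed
    finally show ?thesis by (simp add: B.emeasure_eq_measure)
  qed
  \<comment> \<open>The choice \<open>\<tau> = exp 4\<close> makes the additive error (1 + 1) / 4 =
    1 / 2, which leaves 1 / 2 for the two error probabilities.\<close>
  have "measure (obs_law I P b) G \<le> exp 4 * measure (obs_law I P a) G + (1 + 1) / ln (exp 4)"
    using I P \<kappa> \<open>0 \<le> C\<close> by (intro measure_obs_law_le) (auto simp: norm_minus_commute)
  moreover have "measure (obs_law I P b) H = 1 - measure (obs_law I P b) G"
    using B.prob_compl[of G] by (simp add: H)
  ultimately have "1 / 2 \<le> measure (obs_law I P b) H + exp 4 * measure (obs_law I P a) G"
    by simp
  also have "\<dots> \<le> exp 4 * measure (obs_law I P b) H + exp 4 * measure (obs_law I P a) G"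
    by (intro add_right_mono mult_right_mono[of 1 "exp 4", simplified]) auto
  finally have "1 / (2 * exp 4) \<le> measure (obs_law I P a) G + measure (obs_law I P b) H"
    by (simp add: field_simps)
  then have "c * (1 / (2 * exp 4)) \<le> c * (measure (obs_law I P a) G + measure (obs_law I P b) H)"
    using \<open>0 \<le> c\<close> by (rule mult_left_mono)
  then have "ennreal (c / (2 * exp 4))
      \<le> ennreal (c * measure (obs_law I P a) G + c * measure (obs_law I P b) H)"
    by (intro ennreal_leI) (simp add: algebra_simps)
  also have "\<dots> = ennreal c * measure (obs_law I P a) G + ennreal c * measure (obs_law I P b) H"
    using \<open>0 \<le> c\<close> by (simp add: ennreal_mult)
  also have "\<dots> \<le> (\<integral>\<^sup>+ y. \<phi> y \<partial>obs_law I P a) + (\<integral>\<^sup>+ y. \<psi> y \<partial>obs_law I P b)"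
    by (intro add_mono 1 2)
  finally show ?thesis .
qed

text \<open>A substitute for Fano's inequality: under the reference law the disjoint events have
  total mass at most 1, so on average they are small there, and the change of measure carries this
  over to the individual laws. Divergences up to a fraction of \<open>ln (card K)\<close> are
  affordable, which is the source of the logarithm in the uniform rate.\<close>

lemma many_hypotheses_bound:
  fixes P :: "(real^'n) measure"
  assumes I: "finite I" and P: "centered_noise P" "noise_condition C P" and "0 \<le> C"
    and K: "finite K" "8 \<le> ln (real (card K))"
    and \<kappa>: "\<And>k. k \<in> K \<Longrightarrow> (\<Sum>p\<in>I. C * (norm (a k p - b p))\<^sup>2) \<le> ln (real (card K)) / 8"
    and B: "\<And>k. k \<in> K \<Longrightarrow> B k \<in> sets (\<Pi>\<^sub>M p\<in>I. (borel :: (real^'n) measure))"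
    and disj: "disjoint_family_on B K"
  shows "\<exists>k\<in>K. measure (obs_law I P (a k)) (B k) \<le> 3 / 4"
proof (rule ccontr)
  assume "\<not> ?thesis"
  then have gt: "3 / 4 < measure (obs_law I P (a k)) (B k)" if "k \<in> K" for k
    using that by force
  interpret B: prob_space "obs_law I P b" by (intro prob_space_obs_law P)
  define M where "M = real (card K)"
  have M0: "0 < M"
    using K by (cases "card K = 0") (auto simp: M_def)
  have "K \<noteq> {}" using M0 by (auto simp: M_def)
  have lnM: "8 \<le> ln M" using K by (simp add: M_def)
  have "exp 8 \<le> M" using lnM M0 by (simp add: ln_ge_iff)
  moreover have "(16::real) \<le> exp 8"
  proof -
    have "(2::real) \<le> exp 1" using exp_ge_add_one_self[of 1] by simp
    then have "(2::real) ^ 8 \<le> exp 1 ^ 8" by (intro power_mono) auto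
    also have "exp 1 ^ 8 = exp (8::real)" by (simp flip: exp_of_nat_mult)
    finally show ?thesis by simp
  qed
  ultimately have M16: "16 \<le> M" by simp
  have sq: "4 \<le> sqrt M" using M16 by (intro real_le_rsqrt) auto
  have sq1: "1 < sqrt M" using sq by linarith
  \<comment> \<open>With \<open>\<tau> = sqrt M\<close> the additive error is (ln M / 8 + 1) / (ln M
    / 2), and this is at most 1 / 2 exactly when 8 \<le> ln M. Summed over \<open>K\<close>, the
    first terms contribute at most \<open>sqrt M\<close>, a quarter of \<open>M\<close>.\<close>
  have each: "measure (obs_law I P (a k)) (B k) \<le> sqrt M * measure (obs_law I P b) (B k) + 1 / 2"
    if "k \<in> K" for k
  proof -
    have "measure (obs_law I P (a k)) (B k)
        \<le> sqrt M * measure (obs_law I P b) (B k) + (ln M / 8 + 1) / ln (sqrt M)"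
      using \<kappa>[OF that] \<open>0 \<le> C\<close> by (intro measure_obs_law_le[where C=C] I P B that sq1) (simp_all add: M_def)
    also have "(ln M / 8 + 1) / ln (sqrt M) \<le> 1 / 2"
    proof -
      have "0 < ln M" using lnM by linarith
      then show ?thesis using lnM M0 by (simp add: ln_sqrt divide_le_eq)
    qed
    finally show ?thesis by simp
  qed
  have "3 / 4 * M = (\<Sum>k\<in>K. 3 / 4)" by (simp add: M_def)
  also have "\<dots> < (\<Sum>k\<in>K. measure (obs_law I P (a k)) (B k))"
    using gt K \<open>K \<noteq> {}\<close> by (intro sum_strict_mono) auto
  also have "\<dots> \<le> (\<Sum>k\<in>K. sqrt M * measure (obs_law I P b) (B k) + 1 / 2)"
    by (intro sum_mono each)
  also have "\<dots> = sqrt M * (\<Sum>k\<in>K. measure (obs_law I P b) (B k)) + M / 2"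
    by (simp add: sum.distrib sum_distrib_left M_def)
  also have "(\<Sum>k\<in>K. measure (obs_law I P b) (B k)) = measure (obs_law I P b) (\<Union>k\<in>K. B k)"
    using K B disj by (intro B.finite_measure_finite_Union[symmetric]) auto
  also have "sqrt M * measure (obs_law I P b) (\<Union>k\<in>K. B k) \<le> sqrt M * 1"
    using M0 by (intro mult_left_mono) auto
  also have "sqrt M * 1 \<le> M / 4"
  proof -
    have "4 * sqrt M \<le> sqrt M * sqrt M" using sq M0 by (intro mult_right_mono) auto
    then show ?thesis using M0 by simp
  qed
  finally show False by simp
qed

section \<open>Finitely smooth bumps and their iterated derivatives\<close>

text \<open>Away from 0 this is the power rule or a constant; at the kink the exponent is at least
  2, so the difference quotient is dominated by \<bar>h\<bar> and tends to 0.\<close>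

lemma has_real_derivative_pos_part_power:
  "((\<lambda>s. (max 0 s) ^ Suc (Suc j)) has_real_derivative real (Suc (Suc j)) * (max 0 s) ^ Suc j) (at (s::real))"
proof -
  consider "s < 0" | "s = 0" | "s > 0" by linarith
  then show ?thesis
  proof cases
    case 1
    have "eventually (\<lambda>t. t < 0) (nhds s)" using 1 by (rule eventually_nhds_in_open[of "{..<0}", simplified, rotated -1]) simp
    then have "eventually (\<lambda>t. (max 0 t) ^ Suc (Suc j) = (0::real)) (nhds s)"
      by eventually_elim simp
    then show ?thesis
      by (subst DERIV_cong_ev[OF refl _ refl, of _ "\<lambda>_. 0"]) (use 1 in auto)
  next
    case 2
    have "((\<lambda>h::real. \<bar>h\<bar>) \<longlongrightarrow> 0) (at 0)" by (auto intro!: tendsto_eq_intros)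
    moreover have "eventually (\<lambda>h::real. h \<noteq> 0 \<and> \<bar>h\<bar> < 1) (at 0)"
      unfolding eventually_at by (intro exI[of _ 1]) auto
    then have "eventually (\<lambda>h::real. norm ((max 0 h) ^ Suc (Suc j) / h) \<le> norm \<bar>h\<bar> * 1) (at 0)"
    proof eventually_elim
      case (elim h)
      have "(max 0 h) ^ Suc (Suc j) / h = (max 0 h) ^ Suc j"
        using elim by (auto simp: max_def)
      moreover have "max 0 h * max 0 h ^ j \<le> \<bar>h\<bar> * 1"
        using elim by (intro mult_mono) (auto intro!: power_le_one)
      ultimately show ?case by (simp add: abs_mult)
    qed
    ultimately have "((\<lambda>h::real. (max 0 h) ^ Suc (Suc j) / h) \<longlongrightarrow> 0) (at 0)"
      by (rule tendsto_0_le)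
    then show ?thesis using 2 by (simp add: DERIV_def)
  next
    case 3
    have "eventually (\<lambda>t. t > 0) (nhds s)" using 3 by (rule eventually_nhds_in_open[of "{0<..}", simplified, rotated -1]) simp
    then have "eventually (\<lambda>t. (max 0 t) ^ Suc (Suc j) = t ^ Suc (Suc j)) (nhds s)"
      by eventually_elim simp
    then show ?thesis
      by (subst DERIV_cong_ev[OF refl _ refl, of _ "\<lambda>t. t ^ Suc (Suc j)"])
        (use 3 DERIV_pow[of "Suc (Suc j)" s] in \<open>auto simp del: power_Suc of_nat_Suc\<close>)
  qed
qed

text \<open>\<open>bump m k\<close> is the \<open>k\<close>-th derivative of \<open>max 0 (1 - t\<^sup>2) ^ m\<close> for \<open>k < m\<close>.\<close>

primrec bump_poly :: "nat \<Rightarrow> nat \<Rightarrow> real poly" where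
  "bump_poly m 0 = 1"
| "bump_poly m (Suc k) = [:1, 0, -1:] * pderiv (bump_poly m k)
      - smult (2 * real (m - k)) ([:0, 1:] * bump_poly m k)"

definition bump :: "nat \<Rightarrow> nat \<Rightarrow> real \<Rightarrow> real" where
  "bump m k t = max 0 (1 - t\<^sup>2) ^ (m - k) * poly (bump_poly m k) t"

text \<open>The product rule, with one power of w = max 0 (1 - t^2) rewritten as 1 - t^2. This is
  legitimate also where w = 0, since m - k \<ge> 2 leaves a further factor w. The recursion of
  \<open>bump_poly\<close> is what remains after w^(m - k - 1) is taken out.\<close>

lemma bump_deriv:
  assumes "Suc k < m"
  shows "(bump m k has_real_derivative bump m (Suc k) t) (at t)"
proof -
  obtain j where j: "m - k = Suc (Suc j)" "m - Suc k = Suc j" "m = k + Suc (Suc j)"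
    using assms by (metis Suc_diff_Suc Suc_lessD add_diff_inverse_nat less_imp_not_less)
  let ?p = "bump_poly m k"
  let ?w = "max 0 (1 - t\<^sup>2)"
  have "((\<lambda>t. 1 - t\<^sup>2) has_real_derivative - 2 * t) (at t)"
    by (auto intro!: derivative_eq_intros)
  from DERIV_chain2[OF has_real_derivative_pos_part_power this]
  have "((\<lambda>t. max 0 (1 - t\<^sup>2) ^ Suc (Suc j)) has_real_derivative
      real (Suc (Suc j)) * ?w ^ Suc j * (- 2 * t)) (at t)" .
  from DERIV_mult[OF this poly_DERIV[of ?p t]]
  have "(bump m k has_real_derivative
      (real (Suc (Suc j)) * ?w ^ Suc j * (- 2 * t)) * poly ?p t + poly (pderiv ?p) t * ?w ^ Suc (Suc j)) (at t)"
    unfolding bump_def j(1) .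
  moreover
  have "?w * ?w ^ Suc j = (1 - t\<^sup>2) * ?w ^ Suc j"
    by (cases "0 \<le> 1 - t\<^sup>2") auto
  then have w: "?w ^ Suc (Suc j) = (1 - t\<^sup>2) * ?w ^ Suc j"
    by simp
  have "(real (Suc (Suc j)) * ?w ^ Suc j * (- 2 * t)) * poly ?p t + poly (pderiv ?p) t * ?w ^ Suc (Suc j)
      = bump m (Suc k) t"
    unfolding w bump_def j(2) bump_poly.simps j(1)
    by (simp add: algebra_simps power2_eq_square del: power_Suc of_nat_Suc)
  ultimately show ?thesis by simp
qed

lemma bump_outside: "k < m \<Longrightarrow> 1 \<le> \<bar>t\<bar> \<Longrightarrow> bump m k t = 0"
  by (simp add: bump_def max_def abs_square_le_1 one_le_power flip: abs_le_square_iff)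
    (metis abs_1 abs_le_square_iff one_power2 eq_iff)

lemma bump_0_bounds: "0 \<le> bump m 0 t" "bump m 0 t \<le> 1"
  by (auto simp: bump_def intro!: power_le_one)

lemma bump_0_center: "bump m 0 0 = 1"
  by (simp add: bump_def)

lemma bump_0_lower:
  assumes "\<bar>t\<bar> \<le> 1 / 2"
  shows "(3 / 4) ^ m \<le> bump m 0 t"
proof -
  have "\<bar>t\<bar>\<^sup>2 \<le> (1 / 2)\<^sup>2" using assms by (intro power_mono) auto
  then have "3 / 4 \<le> max 0 (1 - t\<^sup>2)" by (simp add: power2_eq_square)
  then have "(3 / 4) ^ m \<le> max 0 (1 - t\<^sup>2) ^ m" by (rule power_mono) simp
  then show ?thesis by (simp add: bump_def)
qed

lemma bump_bounded:
  obtains B where "1 \<le> B" "\<And>k t. k < m \<Longrightarrow> \<bar>bump m k t\<bar> \<le> B"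
proof -
  have "\<exists>B. \<forall>t. k < m \<longrightarrow> \<bar>bump m k t\<bar> \<le> B" for k
  proof -
    have "continuous_on {-1..1} (bump m k)"
      unfolding bump_def by (intro continuous_intros)
    then have "bounded (bump m k ` {-1..1})"
      by (intro compact_imp_bounded compact_continuous_image) auto
    then obtain B where "\<forall>t\<in>{-1..1}. \<bar>bump m k t\<bar> \<le> B"
      unfolding bounded_iff by auto
    then have B: "\<bar>bump m k t\<bar> \<le> B" if "t \<in> {-1..1}" for t using that by blast
    have "\<bar>bump m k t\<bar> \<le> B" if "k < m" for t
    proof (cases "t \<in> {-1..1}")
      case False
      then have "1 \<le> \<bar>t\<bar>" by auto
      then show ?thesis using B[of 0] bump_outside[OF that] by force
    qed (rule B)
    then show ?thesis by blast
  qed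
  then obtain B where B: "\<And>k t. k < m \<Longrightarrow> \<bar>bump m k t\<bar> \<le> B k" by metis
  define b where "b = Max (insert 1 (B ` {..<m}))"
  show ?thesis
  proof
    show "1 \<le> b" by (simp add: b_def)
    show "\<bar>bump m k t\<bar> \<le> b" if "k < m" for k t
      using B[OF that, of t] that by (auto simp: b_def intro!: Max.coboundedI elim!: order_trans)
  qed
qed

section \<open>Iterated directional derivatives of products of one-variable functions\<close>

text \<open>\<open>prod_deriv \<phi> vs c\<close> is the iterated derivative in the directions \<open>vs\<close> of the product over
  \<open>i\<close> of the \<open>c i\<close>-th derivatives \<open>\<phi> i (c i)\<close> in the \<open>i\<close>-th coordinate.\<close>

primrec prod_deriv ::
  "('n::finite \<Rightarrow> nat \<Rightarrow> real \<Rightarrow> real) \<Rightarrow> (real^'n) list \<Rightarrow> ('n \<Rightarrow> nat) \<Rightarrow> real^'n \<Rightarrow> real" where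
  "prod_deriv \<phi> [] c = (\<lambda>x. \<Prod>i\<in>UNIV. \<phi> i (c i) (x $ i))"
| "prod_deriv \<phi> (v # vs) c = (\<lambda>x. \<Sum>i\<in>UNIV. v $ i * prod_deriv \<phi> vs (c(i := Suc (c i))) x)"

lemma sum_fun_upd_Suc: "(\<Sum>i\<in>UNIV. (c(j := Suc (c j))) i) = Suc (\<Sum>i\<in>UNIV. c i)"
  for c :: "'n::finite \<Rightarrow> nat"
  by (subst (1 2) sum.remove[of UNIV j]) (auto intro!: sum.cong)

lemma prod_deriv_has_derivative:
  fixes \<phi> :: "'n::finite \<Rightarrow> nat \<Rightarrow> real \<Rightarrow> real"
  assumes \<phi>: "\<And>i k t. k \<le> l \<Longrightarrow> (\<phi> i k has_real_derivative \<phi> i (Suc k) t) (at t)"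
    and "(\<Sum>i\<in>UNIV. c i) + length vs \<le> l"
  shows "(prod_deriv \<phi> vs c has_derivative (\<lambda>v. prod_deriv \<phi> (v # vs) c x)) (at x)"
  using assms(2)
proof (induction vs arbitrary: c)
  case Nil
  have cl: "c i \<le> l" for i
    using Nil member_le_sum[of i UNIV c] by simp
  have d: "((\<lambda>x. \<phi> i (c i) (x $ i)) has_derivative (\<lambda>v. v $ i * \<phi> i (Suc (c i)) (x $ i))) (at x)" for i
    using has_derivative_compose[OF bounded_linear_imp_has_derivative[OF bounded_linear_vec_nth, of i "at x"]
      \<phi>[OF cl, unfolded has_field_derivative_def]]
    by (simp add: mult.commute)
  have eq: "(\<Prod>j\<in>UNIV. \<phi> j ((c(i := Suc (c i))) j) (x $ j))
      = \<phi> i (Suc (c i)) (x $ i) * (\<Prod>j\<in>UNIV - {i}. \<phi> j (c j) (x $ j))" for i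
    by (subst prod.remove[of _ i]) (auto intro!: prod.cong)
  show ?case
    using has_derivative_prod[of UNIV "\<lambda>i x. \<phi> i (c i) (x $ i)" _ x UNIV, OF d]
    by (simp add: eq mult.assoc del: fun_upd_apply)
next
  case (Cons u vs)
  have IH: "(prod_deriv \<phi> vs (c(i := Suc (c i))) has_derivative
      (\<lambda>v. \<Sum>j\<in>UNIV. v $ j * prod_deriv \<phi> vs ((c(i := Suc (c i)))(j := Suc ((c(i := Suc (c i))) j))) x)) (at x)" for i
    using Cons.IH[of "c(i := Suc (c i))"] Cons.prems by (simp add: sum_fun_upd_Suc del: fun_upd_apply)
  \<comment> \<open>The new direction \<open>v\<close> raises the multi-index after \<open>u\<close>
    has done so, whereas \<open>prod_deriv\<close> processes the head of the list first. The two
    increments commute, which is the symmetry of mixed partial derivatives here.\<close>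
  have swap: "(c(i := Suc (c i)))(j := Suc ((c(i := Suc (c i))) j))
      = (c(j := Suc (c j)))(i := Suc ((c(j := Suc (c j))) i))" for i j
    by auto
  have "((\<lambda>x. \<Sum>i\<in>UNIV. u $ i * prod_deriv \<phi> vs (c(i := Suc (c i))) x) has_derivative
     (\<lambda>v. \<Sum>i\<in>UNIV. u $ i * (\<Sum>j\<in>UNIV. v $ j * prod_deriv \<phi> vs ((c(i := Suc (c i)))(j := Suc ((c(i := Suc (c i))) j))) x))) (at x)"
    by (intro has_derivative_sum has_derivative_mult_right IH)
  also have "(\<lambda>v. \<Sum>i\<in>UNIV. u $ i * (\<Sum>j\<in>UNIV. v $ j * prod_deriv \<phi> vs ((c(i := Suc (c i)))(j := Suc ((c(i := Suc (c i))) j))) x))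
     = (\<lambda>v. \<Sum>j\<in>UNIV. v $ j * (\<Sum>i\<in>UNIV. u $ i * prod_deriv \<phi> vs ((c(j := Suc (c j)))(i := Suc ((c(j := Suc (c j))) i))) x))"
    by (subst swap, simp only: sum_distrib_left, subst sum.swap) (simp only: mult.left_commute)
  finally show ?case unfolding prod_deriv.simps .
qed

lemma iter_deriv_prod_deriv:
  fixes \<phi> :: "'n::finite \<Rightarrow> nat \<Rightarrow> real \<Rightarrow> real"
  assumes \<phi>: "\<And>i k t. k \<le> l \<Longrightarrow> (\<phi> i k has_real_derivative \<phi> i (Suc k) t) (at t)"
    and "(\<Sum>i\<in>UNIV. c i) + length vs \<le> Suc l"
  shows "iter_deriv (prod_deriv \<phi> [] c) vs = prod_deriv \<phi> vs c"
  using assms(2)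
proof (induction vs)
  case (Cons v vs)
  have "iter_deriv (prod_deriv \<phi> [] c) (v # vs) = (\<lambda>x. frechet_derivative (prod_deriv \<phi> vs c) (at x) v)"
    using Cons by simp
  also have "\<dots> = prod_deriv \<phi> (v # vs) c"
    using prod_deriv_has_derivative[of l \<phi> c vs, OF \<phi>, THEN frechet_derivative_at] Cons.prems
    by (simp add: fun_eq_iff)
  finally show ?case .
qed simp

text \<open>Every summand of the expansion keeps a factor in the coordinate \<open>i\<close>,
  differentiated at most as often as the total order, and that factor vanishes.\<close>

lemma prod_deriv_zero:
  fixes \<phi> :: "'n::finite \<Rightarrow> nat \<Rightarrow> real \<Rightarrow> real"
  assumes "\<And>k. k \<le> (\<Sum>i\<in>UNIV. c i) + length vs \<Longrightarrow> \<phi> i k (x $ i) = 0"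
  shows "prod_deriv \<phi> vs c x = 0"
  using assms
proof (induction vs arbitrary: c)
  case Nil
  have "\<phi> i (c i) (x $ i) = 0" using Nil member_le_sum[of i UNIV c] by simp
  then show ?case by auto
next
  case (Cons v vs)
  show ?case
    using Cons.prems by (auto intro!: sum.neutral Cons.IH simp: sum_fun_upd_Suc simp del: fun_upd_apply)
qed

text \<open>Each direction expands into \<open>CARD('n)\<close> partial derivatives with
  coefficients at most 1 in absolute value, and each derivative costs one factor
  \<open>q\<close>.\<close>

lemma abs_prod_deriv_le:
  fixes \<phi> :: "'n::finite \<Rightarrow> nat \<Rightarrow> real \<Rightarrow> real"
  assumes \<phi>: "\<And>i k t. k \<le> l \<Longrightarrow> \<bar>\<phi> i k t\<bar> \<le> B * q ^ k" and "0 \<le> B" "0 \<le> q"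
    and "(\<Sum>i\<in>UNIV. c i) + length vs \<le> l" "\<And>v. v \<in> set vs \<Longrightarrow> norm v \<le> 1"
  shows "\<bar>prod_deriv \<phi> vs c x\<bar>
    \<le> real CARD('n) ^ length vs * B ^ CARD('n) * q ^ ((\<Sum>i\<in>UNIV. c i) + length vs)"
  using assms(4,5)
proof (induction vs arbitrary: c)
  case Nil
  have cl: "c i \<le> l" for i
    using Nil member_le_sum[of i UNIV c] by simp
  have "\<bar>prod_deriv \<phi> [] c x\<bar> \<le> (\<Prod>i\<in>UNIV. B * q ^ c i)"
    using \<phi>[OF cl] by (auto simp: abs_prod intro!: prod_mono)
  also have "\<dots> = B ^ CARD('n) * q ^ (\<Sum>i\<in>UNIV. c i)"
    by (simp add: prod.distrib power_sum)
  finally show ?case by simp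
next
  case (Cons v vs)
  have "\<bar>prod_deriv \<phi> (v # vs) c x\<bar> \<le> (\<Sum>i\<in>UNIV. \<bar>v $ i * prod_deriv \<phi> vs (c(i := Suc (c i))) x\<bar>)"
    by (simp add: sum_abs)
  also have "\<dots> \<le> (\<Sum>i\<in>(UNIV::'n set). 1 * (real CARD('n) ^ length vs * B ^ CARD('n) * q ^ ((\<Sum>i\<in>UNIV. c i) + length (v # vs))))"
  proof (rule sum_mono)
    fix i
    have "\<bar>prod_deriv \<phi> vs (c(i := Suc (c i))) x\<bar>
       \<le> real CARD('n) ^ length vs * B ^ CARD('n) * q ^ ((\<Sum>i\<in>UNIV. c i) + length (v # vs))"
      using Cons.IH[of "c(i := Suc (c i))"] Cons.prems by (simp add: sum_fun_upd_Suc del: fun_upd_apply)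
    moreover have "\<bar>v $ i\<bar> \<le> 1"
      using Cons.prems(2)[of v] component_le_norm_cart[of v i] by simp
    ultimately show "\<bar>v $ i * prod_deriv \<phi> vs (c(i := Suc (c i))) x\<bar>
       \<le> 1 * (real CARD('n) ^ length vs * B ^ CARD('n) * q ^ ((\<Sum>i\<in>UNIV. c i) + length (v # vs)))"
      unfolding abs_mult by (intro mult_mono) auto
  qed
  finally show ?case by (simp add: mult.assoc)
qed

section \<open>Bumps in the smoothness class\<close>

lemma smoothness_order_bounds:
  assumes "1 \<le> \<beta>"
  shows "real (smoothness_order \<beta>) < \<beta>" "\<beta> \<le> real (smoothness_order \<beta>) + 1"
proof -
  have bd: "y \<le> nat \<lceil>\<beta>\<rceil>" if "real y < \<beta>" for y
    using that by linarith
  show "real (smoothness_order \<beta>) < \<beta>"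
    unfolding smoothness_order_def using assms bd by (intro GreatestI_nat[where P="\<lambda>l. real l < \<beta>" and k=0 and b="nat \<lceil>\<beta>\<rceil>"]) auto
  have "y \<le> smoothness_order \<beta>" if "real y < \<beta>" for y
    unfolding smoothness_order_def using that bd by (intro Greatest_le_nat[where P="\<lambda>l. real l < \<beta>" and b="nat \<lceil>\<beta>\<rceil>"]) auto
  from this[of "Suc (smoothness_order \<beta>)"] show "\<beta> \<le> real (smoothness_order \<beta>) + 1"
    by (cases "real (Suc (smoothness_order \<beta>)) < \<beta>") auto
qed

lemma iter_deriv_const_zero: "iter_deriv (\<lambda>_. 0) vs = (\<lambda>_. 0)"
  by (induction vs) auto

lemma smooth_component_zero:
  assumes "\<And>k. k \<le> smoothness_order \<beta> \<Longrightarrow> 0 < L k" "0 < L\<beta>"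
  shows "smooth_component \<beta> L L\<beta> (\<lambda>_. 0)"
  using assms unfolding smooth_component_def times_differentiable_def form_op_norm_def
  by (auto simp: Let_def iter_deriv_const_zero less_imp_le intro!: SUP_least)

lemma iter_deriv_affine_sum:
  assumes "finite S"
    and "\<And>z vs x. z \<in> S \<Longrightarrow> length vs < n \<Longrightarrow> iter_deriv (g z) vs differentiable (at x)"
    and "length vs \<le> n"
  shows "iter_deriv (\<lambda>x. a + A * (\<Sum>z\<in>S. g z x)) vs
    = (\<lambda>x. (if vs = [] then a else 0) + A * (\<Sum>z\<in>S. iter_deriv (g z) vs x))"
  using assms(3)
proof (induction vs)
  case (Cons v vs)
  have "((\<lambda>x. (if vs = [] then a else 0) + A * (\<Sum>z\<in>S. iter_deriv (g z) vs x)) has_derivative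
      (\<lambda>v. 0 + A * (\<Sum>z\<in>S. frechet_derivative (iter_deriv (g z) vs) (at x) v))) (at x)" for x
    using assms(2) Cons.prems
    by (intro has_derivative_add has_derivative_const has_derivative_mult_right has_derivative_sum)
      (auto simp: frechet_derivative_works[symmetric])
  then have "frechet_derivative (\<lambda>x. (if vs = [] then a else 0) + A * (\<Sum>z\<in>S. iter_deriv (g z) vs x)) (at x) v
      = A * (\<Sum>z\<in>S. frechet_derivative (iter_deriv (g z) vs) (at x) v)" for x
    by (subst frechet_derivative_at[symmetric]) auto
  then show ?case using Cons by simp
qed simp

text \<open>The \<open>k\<close>-th derivative of the one-dimensional bump of half-width \<rho>
  about \<open>z $ i\<close>. All orders form one family because \<open>prod_deriv\<close> takes the
  derivatives as data.\<close>

definition scaled_bump :: "nat \<Rightarrow> real \<Rightarrow> real^'n \<Rightarrow> 'n \<Rightarrow> nat \<Rightarrow> real \<Rightarrow> real" where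
  "scaled_bump m \<rho> z i k t = (1 / \<rho>) ^ k * bump m k ((t - z $ i) / \<rho>)"

definition bump_at :: "nat \<Rightarrow> real \<Rightarrow> real^'n::finite \<Rightarrow> real^'n \<Rightarrow> real" where
  "bump_at m \<rho> z = prod_deriv (scaled_bump m \<rho> z) [] (\<lambda>_. 0)"

lemma bump_at_eq: "bump_at m \<rho> z x = (\<Prod>i\<in>UNIV. bump m 0 ((x $ i - z $ i) / \<rho>))"
  by (simp add: bump_at_def scaled_bump_def)

lemma bump_at_bounds: "0 \<le> bump_at m \<rho> z x" "bump_at m \<rho> z x \<le> 1"
  by (auto simp: bump_at_eq bump_0_bounds intro!: prod_nonneg prod_le_1)

lemma bump_at_center: "bump_at m \<rho> z z = 1"
  by (simp add: bump_at_eq bump_0_center)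

lemma bump_at_lower:
  fixes z :: "real^'n::finite"
  assumes "0 < \<rho>" "\<And>i. \<bar>x $ i - z $ i\<bar> \<le> \<rho> / 2"
  shows "((3 / 4) ^ m) ^ CARD('n) \<le> bump_at m \<rho> z x"
proof -
  have "(\<Prod>i\<in>(UNIV :: 'n set). (3 / 4) ^ m) \<le> bump_at m \<rho> z x"
    unfolding bump_at_eq using assms
    by (intro prod_mono conjI bump_0_lower) (auto simp: field_simps)
  then show ?thesis by simp
qed

lemma bump_at_outside:
  assumes "0 < \<rho>" "\<rho> \<le> \<bar>x $ i - z $ i\<bar>" "0 < m"
  shows "bump_at m \<rho> z x = 0"
proof -
  have "bump m 0 ((x $ i - z $ i) / \<rho>) = 0"
    using assms by (intro bump_outside) auto
  then show ?thesis unfolding bump_at_eq by (intro prod_zero) auto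
qed

lemma scaled_bump_deriv:
  assumes "Suc k < m" "0 < \<rho>"
  shows "(scaled_bump m \<rho> z i k has_real_derivative scaled_bump m \<rho> z i (Suc k) t) (at t)"
proof -
  have "((\<lambda>t. (t - z $ i) / \<rho>) has_real_derivative 1 / \<rho>) (at t)"
    using assms by (auto intro!: derivative_eq_intros)
  from DERIV_cmult[OF DERIV_chain2[OF bump_deriv[OF assms(1)] this], of "(1 / \<rho>) ^ k"]
  show ?thesis unfolding scaled_bump_def[abs_def] by (simp add: mult_ac)
qed

text \<open>Bounds \<rho>^k times any k-th derivative of a bump. As a function of dimension and
  order alone it can be used when the final constant is fixed, before n, \<delta> and \<rho> are
  known.\<close>

definition bump_bound :: "nat \<Rightarrow> nat \<Rightarrow> real" where
  "bump_bound d m = real d ^ m * (SOME B. 1 \<le> B \<and> (\<forall>k t. k < m \<longrightarrow> \<bar>bump m k t\<bar> \<le> B)) ^ d"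

lemma bump_bound_ge_1: "1 \<le> d \<Longrightarrow> 1 \<le> bump_bound d m"
  and abs_bump_at_deriv_le:
  "\<lbrakk>0 < \<rho>; length vs < m; \<And>v. v \<in> set vs \<Longrightarrow> norm v \<le> 1\<rbrakk> \<Longrightarrow>
    \<bar>prod_deriv (scaled_bump m \<rho> z) vs (\<lambda>_. 0) (x::real^'n::finite)\<bar>
      \<le> bump_bound CARD('n) m * (1 / \<rho>) ^ length vs"
proof -
  define B where "B = (SOME B. 1 \<le> B \<and> (\<forall>k t. k < m \<longrightarrow> \<bar>bump m k t\<bar> \<le> B))"
  have "\<exists>B. 1 \<le> B \<and> (\<forall>k t. k < m \<longrightarrow> \<bar>bump m k t\<bar> \<le> B)"
    by (rule bump_bounded[of m]) blast
  from someI_ex[OF this] have B: "1 \<le> B" "\<And>k t. k < m \<Longrightarrow> \<bar>bump m k t\<bar> \<le> B"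
    by (simp_all add: B_def)
  have eq: "bump_bound d m = real d ^ m * B ^ d" for d
    by (simp add: bump_bound_def B_def)
  show "1 \<le> d \<Longrightarrow> 1 \<le> bump_bound d m"
    unfolding eq using B by (intro mult_ge1_I one_le_power) auto
  assume *: "0 < \<rho>" "length vs < m" "\<And>v. v \<in> set vs \<Longrightarrow> norm v \<le> 1"
  have "\<bar>prod_deriv (scaled_bump m \<rho> z) vs (\<lambda>_. 0) x\<bar>
      \<le> real CARD('n) ^ length vs * B ^ CARD('n) * (1 / \<rho>) ^ ((\<Sum>i\<in>(UNIV::'n set). 0) + length vs)"
    using B * by (intro abs_prod_deriv_le[where l="length vs"])
      (auto simp: scaled_bump_def abs_mult power_abs mult.commute intro!: mult_right_mono)
  also have "\<dots> \<le> real CARD('n) ^ m * B ^ CARD('n) * (1 / \<rho>) ^ length vs"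
    using B * by (auto intro!: mult_right_mono power_increasing divide_right_mono)
  finally show "\<bar>prod_deriv (scaled_bump m \<rho> z) vs (\<lambda>_. 0) x\<bar>
      \<le> bump_bound CARD('n) m * (1 / \<rho>) ^ length vs" by (simp add: eq)
qed

lemma prod_deriv_Cons_scaleR:
  "prod_deriv \<phi> ((r *\<^sub>R v) # vs) c x = r * prod_deriv \<phi> (v # vs) c x"
  by (simp add: sum_distrib_left mult_ac)

text \<open>The mean value inequality, with the derivative of the next order. Its operator norm
  comes from \<open>abs_bump_at_deriv_le\<close> at the normalised direction \<open>sgn u\<close>,
  since one more derivative is linear in that direction.\<close>

lemma bump_at_deriv_lipschitz:
  fixes z :: "real^'n::finite"
  assumes "0 < \<rho>" "Suc (length vs) < m" "\<And>v. v \<in> set vs \<Longrightarrow> norm v \<le> 1"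
  shows "\<bar>prod_deriv (scaled_bump m \<rho> z) vs (\<lambda>_. 0) x - prod_deriv (scaled_bump m \<rho> z) vs (\<lambda>_. 0) y\<bar>
    \<le> bump_bound CARD('n) m * (1 / \<rho>) ^ Suc (length vs) * norm (x - y)"
proof -
  let ?D = "prod_deriv (scaled_bump m \<rho> z)"
  have "norm (?D vs (\<lambda>_. 0) x - ?D vs (\<lambda>_. 0) y)
      \<le> (bump_bound CARD('n) m * (1 / \<rho>) ^ Suc (length vs)) * norm (x - y)"
  proof (rule differentiable_bound[OF convex_UNIV])
    fix w :: "real^'n"
    show "(?D vs (\<lambda>_. 0) has_derivative (\<lambda>v. ?D (v # vs) (\<lambda>_. 0) w)) (at w within UNIV)"
      using assms by (intro prod_deriv_has_derivative[where l="length vs"] scaled_bump_deriv) auto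
    show "onorm (\<lambda>v. ?D (v # vs) (\<lambda>_. 0) w) \<le> bump_bound CARD('n) m * (1 / \<rho>) ^ Suc (length vs)"
    proof (rule onorm_bound)
      show "0 \<le> bump_bound CARD('n) m * (1 / \<rho>) ^ Suc (length vs)"
        using bump_bound_ge_1[of "CARD('n)" m] assms by (simp add: Suc_le_eq)
      fix u :: "real^'n"
      have e: "?D (u # vs) (\<lambda>_. 0) w = norm u * ?D (sgn u # vs) (\<lambda>_. 0) w"
      proof -
        have "norm u *\<^sub>R sgn u = u" by (cases "u = 0") (simp_all add: sgn_div_norm)
        then show ?thesis
          using prod_deriv_Cons_scaleR[of "scaled_bump m \<rho> z" "norm u" "sgn u" vs "\<lambda>_. 0" w]
          by (simp del: prod_deriv.simps)
      qed
      have b: "\<bar>?D (sgn u # vs) (\<lambda>_. 0) w\<bar> \<le> bump_bound CARD('n) m * (1 / \<rho>) ^ length (sgn u # vs)"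
        using assms by (intro abs_bump_at_deriv_le) (auto simp: norm_sgn)
      have "norm (?D (u # vs) (\<lambda>_. 0) w) = \<bar>?D (sgn u # vs) (\<lambda>_. 0) w\<bar> * norm u"
        by (simp only: e real_norm_def abs_mult abs_norm_cancel mult.commute)
      also have "\<dots> \<le> bump_bound CARD('n) m * (1 / \<rho>) ^ length (sgn u # vs) * norm u"
        by (rule mult_right_mono[OF b norm_ge_zero])
      finally show "norm (?D (u # vs) (\<lambda>_. 0) w) \<le> bump_bound CARD('n) m * (1 / \<rho>) ^ Suc (length vs) * norm u"
        by (simp only: list.size add_0_right add_Suc_right length_Cons)
    qed
  qed auto
  then show ?thesis by simp
qed

section \<open>Sums of bumps with disjoint supports\<close>

definition separated :: "real \<Rightarrow> (real^'n) set \<Rightarrow> bool" where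
  "separated \<rho> S \<longleftrightarrow> (\<forall>z\<in>S. \<forall>z'\<in>S. z \<noteq> z' \<longrightarrow> (\<exists>i. 2 * \<rho> \<le> \<bar>z $ i - z' $ i\<bar>))"

lemma separated_unique:
  assumes "separated \<rho> S" "z \<in> S" "z' \<in> S"
    and "\<And>i. \<bar>x $ i - z $ i\<bar> < \<rho>" "\<And>i. \<bar>x $ i - z' $ i\<bar> < \<rho>"
  shows "z = z'"
proof (rule ccontr)
  assume "z \<noteq> z'"
  then obtain i where "2 * \<rho> \<le> \<bar>z $ i - z' $ i\<bar>"
    using assms(1-3) by (auto simp: separated_def)
  then show False using assms(4,5)[of i] by linarith
qed

text \<open>Open cubes of half-width \<rho> about separated centres are disjoint, so at most one
  term survives at \<open>x\<close>. Bounds for a single bump thus pass to the sum without a factor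
  \<open>card S\<close>.\<close>

lemma separated_sum_eq:
  assumes "finite S" "separated \<rho> S"
    and "\<And>z i. z \<in> S \<Longrightarrow> \<rho> \<le> \<bar>x $ i - z $ i\<bar> \<Longrightarrow> g z = (0::real)"
  shows "(\<exists>z\<in>S. (\<Sum>z\<in>S. g z) = g z) \<or> (\<Sum>z\<in>S. g z) = 0"
proof (cases "\<exists>z\<in>S. \<forall>i. \<bar>x $ i - z $ i\<bar> < \<rho>")
  case True
  then obtain z where z: "z \<in> S" "\<And>i. \<bar>x $ i - z $ i\<bar> < \<rho>" by auto
  have "g z' = 0" if "z' \<in> S - {z}" for z'
  proof -
    have "\<not> (\<forall>i. \<bar>x $ i - z' $ i\<bar> < \<rho>)"
      using separated_unique[OF assms(2) z(1), of z' x] z that by blast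
    then show ?thesis using assms(3)[of z'] that by (auto simp: not_less)
  qed
  then have "(\<Sum>z\<in>S. g z) = g z"
    using assms(1) z(1) by (simp add: sum.remove)
  then show ?thesis using z by blast
next
  case False
  then have "(\<Sum>z\<in>S. g z) = 0" using assms(3) by (intro sum.neutral) (force simp: not_less)
  then show ?thesis by blast
qed

definition speed :: "nat \<Rightarrow> real \<Rightarrow> real \<Rightarrow> real \<Rightarrow> (real^'n::finite) set \<Rightarrow> real^'n \<Rightarrow> real" where
  "speed m \<rho> A v S x = v + A * (\<Sum>z\<in>S. bump_at m \<rho> z x)"

lemma separated_speed_bounds:
  assumes "finite S" "separated \<rho> S" "0 \<le> A" "0 < \<rho>" "0 < m"
  shows "v \<le> speed m \<rho> A v S x" "speed m \<rho> A v S x \<le> v + A"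
proof -
  have "(\<exists>z\<in>S. (\<Sum>z\<in>S. bump_at m \<rho> z x) = bump_at m \<rho> z x) \<or> (\<Sum>z\<in>S. bump_at m \<rho> z x) = 0"
    using assms by (intro separated_sum_eq bump_at_outside)
  then have "0 \<le> (\<Sum>z\<in>S. bump_at m \<rho> z x)" "(\<Sum>z\<in>S. bump_at m \<rho> z x) \<le> 1"
    using bump_at_bounds by auto
  then show "v \<le> speed m \<rho> A v S x" "speed m \<rho> A v S x \<le> v + A"
    unfolding speed_def using assms mult_left_le[of _ A] by auto
qed

text \<open>Interpolation between a bound on the size and a Lipschitz bound gives a Hoelder bound:
  for s \<le> 1 use s \<le> s^e, for larger s the constant bound suffices.\<close>

lemma min_le_powr:
  assumes "0 < (e::real)" "e \<le> 1" "0 \<le> s" "t \<le> 2" "t \<le> s"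
  shows "t \<le> 2 * s powr e"
proof (cases "s \<le> 1")
  case True
  have "s \<le> s powr e"
    using powr_mono'[of e 1 s] assms True by (cases "s = 0") auto
  moreover have "0 \<le> s powr e" by simp
  ultimately show ?thesis using assms by linarith
next
  case False
  then have "1 \<le> s powr e" using assms by (intro ge_one_powr_ge_zero) auto
  then show ?thesis using assms by linarith
qed

text \<open>The height a \<rho>^\<beta> is the largest power of \<rho> that the class admits:
  derivatives of order k \<le> l are of size a \<rho>^(\<beta>-k) \<le> a, and in the Hoelder
  quotient all powers of \<rho> cancel. The value m = l + 2 provides the derivative of order l + 1
  used for the Lipschitz bound. Of the factor 4, one 2 comes from interpolation, the other from two
  points that lie in two different bumps.\<close>

lemma smooth_component_speed:
  fixes S :: "(real^'n::finite) set"
  assumes \<beta>: "1 \<le> \<beta>" and m: "m = smoothness_order \<beta> + 2"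
    and S: "finite S" "separated \<rho> S" and \<rho>: "0 < \<rho>" "\<rho> \<le> 1"
    and a: "0 \<le> a" and v: "0 \<le> v" "v + a * bump_bound CARD('n) m \<le> L 0"
    and L: "\<And>k. 0 < k \<Longrightarrow> k \<le> smoothness_order \<beta> \<Longrightarrow> a * bump_bound CARD('n) m \<le> L k"
    and L\<beta>: "4 * a * bump_bound CARD('n) m \<le> L\<beta>"
  shows "smooth_component \<beta> L L\<beta> (speed m \<rho> (a * \<rho> powr \<beta>) v S)"
proof -
  define l where "l = smoothness_order \<beta>"
  define Bd where "Bd = bump_bound CARD('n) m"
  define A where "A = a * \<rho> powr \<beta>"
  define D where "D z vs = prod_deriv (scaled_bump m \<rho> z) vs (\<lambda>_. 0)" for z :: "real^'n" and vs
  have l: "real l < \<beta>" "\<beta> \<le> real l + 1" and ml: "m = Suc (Suc l)"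
    using smoothness_order_bounds[OF \<beta>] m by (simp_all add: l_def)
  have Bd: "1 \<le> Bd" unfolding Bd_def by (intro bump_bound_ge_1) (simp add: Suc_le_eq)
  have A0: "0 \<le> A" using a by (simp add: A_def)
  have D: "iter_deriv (bump_at m \<rho> z) vs = D z vs" if "length vs \<le> Suc l" for z vs
    unfolding bump_at_def D_def using that \<rho> ml
    by (intro iter_deriv_prod_deriv[where l=l] scaled_bump_deriv) auto
  have diffD: "D z vs differentiable (at x)" if "length vs \<le> l" for z vs x
  proof -
    have "(prod_deriv (scaled_bump m \<rho> z) vs (\<lambda>_. 0) has_derivative
        (\<lambda>v. prod_deriv (scaled_bump m \<rho> z) (v # vs) (\<lambda>_. 0) x)) (at x)"
      using that \<rho> ml by (intro prod_deriv_has_derivative[where l=l] scaled_bump_deriv) auto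
    then show ?thesis unfolding D_def differentiable_def by blast
  qed
  have D_out: "D z vs x = 0" if "length vs \<le> Suc l" "\<rho> \<le> \<bar>x $ i - z $ i\<bar>" for z vs x i
    unfolding D_def using that ml \<rho>
    by (intro prod_deriv_zero[where i=i]) (auto simp: scaled_bump_def intro!: bump_outside)
  have iter: "iter_deriv (speed m \<rho> A v S) vs
      = (\<lambda>x. (if vs = [] then v else 0) + A * (\<Sum>z\<in>S. D z vs x))" if "length vs \<le> Suc l" for vs
  proof -
    have "iter_deriv (speed m \<rho> A v S) vs
        = (\<lambda>x. (if vs = [] then v else 0) + A * (\<Sum>z\<in>S. iter_deriv (bump_at m \<rho> z) vs x))"
      unfolding speed_def[abs_def] using S diffD that
      by (intro iter_deriv_affine_sum[where n="Suc l"]) (auto simp: D)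
    then show ?thesis using that by (simp add: D)
  qed
  have scale: "A * (1 / \<rho>) ^ k \<le> a" if "k \<le> l" for k
  proof -
    have "A * (1 / \<rho>) ^ k = a * \<rho> powr (\<beta> - real k)"
      using \<rho> by (simp add: A_def powr_diff powr_realpow power_one_over field_simps)
    also have "\<dots> \<le> a * 1"
      using \<rho> a that l by (intro mult_left_mono powr_le1) auto
    finally show ?thesis by simp
  qed
  have bound: "A * \<bar>D z vs x\<bar> \<le> a * Bd"
    if "length vs \<le> l" "\<And>u. u \<in> set vs \<Longrightarrow> norm u \<le> 1" for z vs x
  proof -
    have "A * \<bar>D z vs x\<bar> \<le> A * (Bd * (1 / \<rho>) ^ length vs)"
      unfolding D_def Bd_def using that \<rho> A0 ml by (intro mult_left_mono abs_bump_at_deriv_le) auto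
    also have "\<dots> = (A * (1 / \<rho>) ^ length vs) * Bd" by simp
    also have "\<dots> \<le> a * Bd" using scale[OF that(1)] Bd by (intro mult_right_mono) auto
    finally show ?thesis .
  qed
  have sum_bound: "A * \<bar>\<Sum>z\<in>S. D z vs x\<bar> \<le> a * Bd"
    if "length vs \<le> l" "\<And>u. u \<in> set vs \<Longrightarrow> norm u \<le> 1" for vs x
  proof -
    have "(\<exists>z\<in>S. (\<Sum>z\<in>S. D z vs x) = D z vs x) \<or> (\<Sum>z\<in>S. D z vs x) = 0"
      using that by (intro separated_sum_eq[OF S, of x] D_out) auto
    then show ?thesis using bound[OF that] a Bd by auto
  qed
  have diff_bound: "A * \<bar>D z vs x - D z vs y\<bar> \<le> 2 * a * Bd * norm (x - y) powr (\<beta> - real l)"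
    if vs: "length vs = l" "\<And>u. u \<in> set vs \<Longrightarrow> norm u \<le> 1" for z vs x y
  proof -
    define E where "E = Bd * (1 / \<rho>) ^ l"
    have E: "0 < E" using Bd \<rho> by (simp add: E_def)
    have 1: "\<bar>D z vs w\<bar> \<le> E" for w
      unfolding D_def Bd_def E_def using that \<rho> ml abs_bump_at_deriv_le[of \<rho> vs m z w] by auto
    have 2: "\<bar>D z vs x - D z vs y\<bar> \<le> E * (norm (x - y) / \<rho>)"
      unfolding D_def Bd_def E_def using that \<rho> ml bump_at_deriv_lipschitz[of \<rho> vs m z x y] by (simp add: mult_ac)
    have "\<bar>D z vs x - D z vs y\<bar> \<le> 2 * E" using 1[of x] 1[of y] by linarith
    with 2 have "\<bar>D z vs x - D z vs y\<bar> / E \<le> 2 * (norm (x - y) / \<rho>) powr (\<beta> - real l)"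
      using E l \<rho> by (intro min_le_powr) (auto simp: divide_le_eq mult.commute)
    then have "\<bar>D z vs x - D z vs y\<bar> \<le> 2 * E * (norm (x - y) / \<rho>) powr (\<beta> - real l)"
      using E by (simp add: divide_le_eq mult_ac)
    then have "A * \<bar>D z vs x - D z vs y\<bar> \<le> A * (2 * E * (norm (x - y) / \<rho>) powr (\<beta> - real l))"
      using A0 by (rule mult_left_mono)
    also have "\<dots> = 2 * a * Bd * norm (x - y) powr (\<beta> - real l) * (\<rho> powr \<beta> * (1 / \<rho>) ^ l / \<rho> powr (\<beta> - real l))"
      using \<rho> by (simp add: A_def E_def powr_divide mult_ac)
    also have "\<rho> powr \<beta> * (1 / \<rho>) ^ l / \<rho> powr (\<beta> - real l) = 1"
      using \<rho> by (simp add: powr_diff powr_realpow power_one_over)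
    finally show ?thesis by simp
  qed
  have hoelder: "\<bar>A * (\<Sum>z\<in>S. D z vs x) - A * (\<Sum>z\<in>S. D z vs y)\<bar>
      \<le> 4 * a * Bd * norm (x - y) powr (\<beta> - real l)"
    if vs: "length vs = l" "\<And>u. u \<in> set vs \<Longrightarrow> norm u \<le> 1" for vs x y
  proof -
    \<comment> \<open>The centres whose bumps can be nonzero at \<open>w\<close>, at most one. Only
      the centres belonging to \<open>x\<close> or \<open>y\<close> contribute to the
      difference.\<close>
    define X where "X w = {z\<in>S. \<forall>i. \<bar>w $ i - z $ i\<bar> < \<rho>}" for w
    have X: "card (X w) \<le> 1" "finite (X w)" for w
      using S separated_unique[OF S(2), of _ _ w] by (auto simp: X_def card_le_Suc0_iff_eq)
    have X_out: "D z vs w = 0" if "z \<in> S" "z \<notin> X w" for z w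
      using that D_out vs by (force simp: X_def not_less)
    have cX: "card (X x \<union> X y) \<le> 2"
      using card_Un_le[of "X x" "X y"] X(1)[of x] X(1)[of y] by linarith
    have "A * (\<Sum>z\<in>S. D z vs x) - A * (\<Sum>z\<in>S. D z vs y) = (\<Sum>z\<in>S. A * (D z vs x - D z vs y))"
      by (simp add: sum_subtractf sum_distrib_left right_diff_distrib)
    also have "\<dots> = (\<Sum>z\<in>X x \<union> X y. A * (D z vs x - D z vs y))"
      using S X_out by (intro sum.mono_neutral_right) (auto simp: X_def)
    also have "\<bar>\<dots>\<bar> \<le> (\<Sum>z\<in>X x \<union> X y. \<bar>A * (D z vs x - D z vs y)\<bar>)"
      by (rule sum_abs)
    also have "\<dots> \<le> real (card (X x \<union> X y)) * (2 * a * Bd * norm (x - y) powr (\<beta> - real l))"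
      using diff_bound[OF vs] A0 by (intro sum_bounded_above) (auto simp: abs_mult)
    also have "\<dots> \<le> 2 * (2 * a * Bd * norm (x - y) powr (\<beta> - real l))"
      using cX a Bd by (intro mult_right_mono) auto
    finally show ?thesis by simp
  qed
  show ?thesis
    unfolding smooth_component_def Let_def A_def[symmetric] l_def[symmetric]
  proof (intro conjI allI impI)
    show "times_differentiable l (speed m \<rho> A v S)"
      unfolding times_differentiable_def
    proof (intro allI impI)
      fix vs :: "(real^'n) list" and x assume vs: "length vs < l"
      have "(\<lambda>x. (if vs = [] then v else 0) + A * (\<Sum>z\<in>S. D z vs x)) differentiable at x"
        using S diffD[of vs] vs
        by (intro differentiable_add differentiable_mult differentiable_const differentiable_sum) auto
      then show "iter_deriv (speed m \<rho> A v S) vs differentiable at x"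
        using iter[of vs] vs by simp
    qed
    show "(SUP x. form_op_norm k (\<lambda>vs. iter_deriv (speed m \<rho> A v S) vs x)) \<le> ereal (L k)" if "k \<le> l" for k
      unfolding form_op_norm_def
    proof (intro SUP_least, clarsimp)
      fix x :: "real^'n" and vs :: "(real^'n) list"
      assume vs: "k = length vs" "\<forall>u\<in>set vs. norm u = 1"
      have "\<bar>A * (\<Sum>z\<in>S. D z vs x)\<bar> \<le> a * Bd"
        using sum_bound[of vs x] vs that A0 by (simp add: abs_mult)
      moreover have "iter_deriv (speed m \<rho> A v S) vs x = (if vs = [] then v else 0) + A * (\<Sum>z\<in>S. D z vs x)"
        using fun_cong[OF iter[of vs], of x] vs that by simp
      ultimately have "\<bar>iter_deriv (speed m \<rho> A v S) vs x\<bar> \<le> (if vs = [] then v else 0) + a * Bd"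
        using v(1) by auto
      also have "\<dots> \<le> L (length vs)"
        using v L[of k] vs that by (auto simp: Bd_def l_def)
      finally show "\<bar>iter_deriv (speed m \<rho> A v S) vs x\<bar> \<le> L (length vs)" .
    qed
    show "form_op_norm l (\<lambda>vs. iter_deriv (speed m \<rho> A v S) vs x - iter_deriv (speed m \<rho> A v S) vs y)
        \<le> ereal (L\<beta> * norm (x - y) powr (\<beta> - real l))" for x y
      unfolding form_op_norm_def
    proof (intro SUP_least, clarsimp)
      fix vs :: "(real^'n) list" assume vs: "l = length vs" "\<forall>u\<in>set vs. norm u = 1"
      have "\<bar>A * (\<Sum>z\<in>S. D z vs x) - A * (\<Sum>z\<in>S. D z vs y)\<bar> \<le> 4 * a * Bd * norm (x - y) powr (\<beta> - real l)"
        using vs by (intro hoelder) auto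
      also have "\<dots> \<le> L\<beta> * norm (x - y) powr (\<beta> - real l)"
        using L\<beta> by (intro mult_right_mono) (auto simp: Bd_def)
      finally show "\<bar>iter_deriv (speed m \<rho> A v S) vs x - iter_deriv (speed m \<rho> A v S) vs y\<bar>
        \<le> L\<beta> * norm (x - y) powr (\<beta> - real (length vs))"
        using fun_cong[OF iter[of vs], of x] fun_cong[OF iter[of vs], of y] vs by simp
    qed
  qed
qed

section \<open>The flow of a unidirectional drift\<close>

text \<open>Time as a function of the position: an antiderivative of the reciprocal speed.\<close>

lemma travel_time:
  fixes \<phi> :: "real \<Rightarrow> real"
  assumes cont: "continuous_on UNIV \<phi>" and \<phi>: "\<And>s. v \<le> \<phi> s" "\<And>s. \<phi> s \<le> V" and "0 < v"
  obtains \<Theta> where "\<Theta> 0 = 0" "\<And>s. (\<Theta> has_real_derivative 1 / \<phi> s) (at s)"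
    "\<And>s s'. s \<le> s' \<Longrightarrow> (s' - s) / V \<le> \<Theta> s' - \<Theta> s"
proof -
  have pos: "0 < \<phi> s" for s using \<phi>(1)[of s] \<open>0 < v\<close> by linarith
  have "isCont (\<lambda>s. 1 / \<phi> s) s" for s
    using cont pos[of s] by (intro continuous_intros) (auto simp: continuous_on_eq_continuous_at)
  then obtain \<Theta>0 where "\<And>s. (\<Theta>0 has_vector_derivative 1 / \<phi> s) (at s)"
    using einterval_antiderivative[of "- \<infinity>" \<infinity> "\<lambda>s. 1 / \<phi> s"] by auto
  then have \<Theta>0: "(\<Theta>0 has_real_derivative 1 / \<phi> s) (at s)" for s
    by (simp add: has_real_derivative_iff_has_vector_derivative)
  show ?thesis
  proof
    show "((\<lambda>s. \<Theta>0 s - \<Theta>0 0) has_real_derivative 1 / \<phi> s) (at s)" for s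
      using DERIV_diff[OF \<Theta>0 DERIV_const] by simp
    show "(s' - s) / V \<le> (\<Theta>0 s' - \<Theta>0 0) - (\<Theta>0 s - \<Theta>0 0)" if "s \<le> s'" for s s'
    proof (cases "s = s'")
      case False
      then have "s < s'" using that by simp
      then obtain r where r: "\<Theta>0 s' - \<Theta>0 s = (s' - s) * (1 / \<phi> r)"
        using MVT2[of s s' \<Theta>0 "\<lambda>s. 1 / \<phi> s"] \<Theta>0 by blast
      have "1 / V \<le> 1 / \<phi> r" using pos[of r] \<phi>(2)[of r] by (simp add: frac_le)
      then have "(s' - s) * (1 / V) \<le> (s' - s) * (1 / \<phi> r)"
        using \<open>s < s'\<close> by (intro mult_left_mono) auto
      then show ?thesis using r by simp
    qed simp
  qed simp
qed

text \<open>Separation of variables: the solution is the inverse of the travel time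
  \<open>\<Theta>\<close>. Any solution \<open>z\<close> makes \<open>\<Theta> (z t) - t\<close>
  constant, which gives uniqueness. The solution has to live on the whole line, as in the definition
  of \<open>flow\<close>.\<close>

lemma scalar_flow:
  fixes \<phi> :: "real \<Rightarrow> real"
  assumes cont: "continuous_on UNIV \<phi>" and \<phi>: "\<And>s. v \<le> \<phi> s" "\<And>s. \<phi> s \<le> V" and "0 < v"
  shows "\<exists>!y. y 0 = 0 \<and> (\<forall>t. (y has_real_derivative \<phi> (y t)) (at t))"
proof -
  obtain \<Theta> where \<Theta>: "\<Theta> 0 = 0" "\<And>s. (\<Theta> has_real_derivative 1 / \<phi> s) (at s)"
    "\<And>s s'. s \<le> s' \<Longrightarrow> (s' - s) / V \<le> \<Theta> s' - \<Theta> s"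
    using travel_time[OF assms] by blast
  have pos: "0 < \<phi> s" for s using \<phi>(1)[of s] \<open>0 < v\<close> by linarith
  have V: "0 < V" using pos[of 0] \<phi>(2)[of 0] by linarith
  \<comment> \<open>Since the speed is at most \<open>V\<close>, travel times separate positions;
    this one inequality yields both injectivity of \<open>\<Theta>\<close> and continuity of its
    inverse.\<close>
  have expand_le: "s' - s \<le> V * \<bar>\<Theta> s' - \<Theta> s\<bar>" if "s \<le> s'" for s s'
  proof -
    have "s' - s \<le> V * (\<Theta> s' - \<Theta> s)"
      using \<Theta>(3)[OF that] V by (simp add: divide_le_eq mult.commute)
    also have "\<dots> \<le> V * \<bar>\<Theta> s' - \<Theta> s\<bar>" using V by (intro mult_left_mono) auto
    finally show ?thesis .
  qed
  have expand: "\<bar>s' - s\<bar> \<le> V * \<bar>\<Theta> s' - \<Theta> s\<bar>" for s s'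
    using expand_le[of s s'] expand_le[of s' s] by (cases "s \<le> s'") (simp_all add: abs_minus_commute)
  have inj: "s = s'" if "\<Theta> s = \<Theta> s'" for s s'
  proof -
    have "\<bar>s' - s\<bar> \<le> 0" using expand[of s' s] unfolding that by simp
    then show ?thesis by simp
  qed
  have "\<exists>s. \<Theta> s = t" for t
  proof -
    have "\<Theta> (- V * \<bar>t\<bar>) \<le> t" using \<Theta>(3)[of "- V * \<bar>t\<bar>" 0] \<Theta>(1) V by simp
    moreover have "t \<le> \<Theta> (V * \<bar>t\<bar>)" using \<Theta>(3)[of 0 "V * \<bar>t\<bar>"] \<Theta>(1) V by simp
    moreover have "- V * \<bar>t\<bar> \<le> V * \<bar>t\<bar>" using V by simp
    moreover have "continuous_on {- V * \<bar>t\<bar>..V * \<bar>t\<bar>} \<Theta>"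
      using \<Theta>(2) by (intro continuous_at_imp_continuous_on ballI DERIV_isCont)
    ultimately show ?thesis using IVT'[of \<Theta> "- V * \<bar>t\<bar>" t "V * \<bar>t\<bar>"] by blast
  qed
  then obtain y where y: "\<And>t. \<Theta> (y t) = t" by metis
  have y_cont: "isCont y t" for t
  proof (rule continuous_at_sequentiallyI)
    fix u assume "u \<longlonglongrightarrow> t"
    then have "(\<lambda>n. V * \<bar>u n - t\<bar>) \<longlonglongrightarrow> V * \<bar>t - t\<bar>" by (intro tendsto_intros)
    then have lim: "(\<lambda>n. V * \<bar>u n - t\<bar>) \<longlonglongrightarrow> 0" by simp
    have "norm (y (u n) - y t) \<le> V * \<bar>u n - t\<bar>" for n
      using expand[of "y (u n)" "y t"] by (simp add: y)
    then have "eventually (\<lambda>n. norm (y (u n) - y t) \<le> V * \<bar>u n - t\<bar>) sequentially"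
      by (intro always_eventually allI)
    from Lim_null_comparison[OF this lim] have "(\<lambda>n. y (u n) - y t) \<longlonglongrightarrow> 0" .
    then show "(\<lambda>n. y (u n)) \<longlonglongrightarrow> y t" by (simp add: LIM_zero_iff)
  qed
  have y_deriv: "(y has_real_derivative \<phi> (y t)) (at t)" for t
  proof -
    have "(y has_real_derivative inverse (1 / \<phi> (y t))) (at t)"
      using pos[of "y t"] y_cont[of t]
      by (intro DERIV_inverse_function[where f=\<Theta> and a="t - 1" and b="t + 1"] \<Theta>(2)) (auto simp: y)
    then show ?thesis by simp
  qed
  show ?thesis
  proof (rule ex1I[of _ y])
    show "y 0 = 0 \<and> (\<forall>t. (y has_real_derivative \<phi> (y t)) (at t))"
      using y_deriv inj[of "y 0" 0] y \<Theta>(1) by simp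
    fix z assume z: "z 0 = 0 \<and> (\<forall>t. (z has_real_derivative \<phi> (z t)) (at t))"
    have "((\<lambda>t. \<Theta> (z t) - t) has_real_derivative 0) (at t)" for t
    proof -
      have "((\<lambda>t. \<Theta> (z t)) has_real_derivative 1 / \<phi> (z t) * \<phi> (z t)) (at t)"
        using z by (intro DERIV_chain2[OF \<Theta>(2)]) auto
      from DERIV_diff[OF this DERIV_ident] show ?thesis
        using pos[of "z t"] by simp
    qed
    then have "\<Theta> (z t) - t = \<Theta> (z 0) - 0" for t
      using DERIV_isconst_all[of "\<lambda>t. \<Theta> (z t) - t" t 0] by blast
    then have "\<Theta> (z t) = t" for t using z \<Theta>(1) by simp
    then show "z = y" using inj y by (metis ext)
  qed
qed

definition good_speed :: "real \<Rightarrow> real \<Rightarrow> (real^'n \<Rightarrow> real) \<Rightarrow> bool" where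
  "good_speed v V F \<longleftrightarrow> 0 < v \<and> continuous_on UNIV F \<and> (\<forall>x. v \<le> F x \<and> F x \<le> V)"

definition unidirectional :: "'n \<Rightarrow> (real^'n \<Rightarrow> real) \<Rightarrow> real^'n \<Rightarrow> real^'n" where
  "unidirectional i F x = F x *\<^sub>R axis i 1"

lemma good_speed_line:
  assumes "good_speed v V F"
  shows "continuous_on UNIV (\<lambda>s. F (x + s *\<^sub>R w))" "\<And>s. v \<le> F (x + s *\<^sub>R w)" "\<And>s. F (x + s *\<^sub>R w) \<le> V" "0 < v"
proof -
  have "continuous_on UNIV F" using assms by (simp add: good_speed_def)
  then show "continuous_on UNIV (\<lambda>s. F (x + s *\<^sub>R w))"
    by (rule continuous_on_compose2) (auto intro!: continuous_intros)
qed (use assms in \<open>auto simp: good_speed_def\<close>)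

text \<open>The \<open>THE\<close> in \<open>flow\<close> asks for uniqueness among all curves in
  space. Coordinates other than \<open>i\<close> have derivative zero, so every solution stays on
  its line and the scalar result applies.\<close>

lemma flow_unidirectional:
  fixes F :: "real^'n::finite \<Rightarrow> real"
  assumes F: "good_speed v V F"
  obtains y where "flow (unidirectional i F) x = (\<lambda>t. x + y t *\<^sub>R axis i 1)" "y 0 = 0"
    "\<And>t. (y has_real_derivative F (x + y t *\<^sub>R axis i 1)) (at t)"
proof -
  let ?e = "axis i 1 :: real^'n"
  from scalar_flow[OF good_speed_line[OF F]]
  obtain y where y: "y 0 = 0" "\<And>t. (y has_real_derivative F (x + y t *\<^sub>R ?e)) (at t)"
    and uniq: "\<And>z. z 0 = 0 \<Longrightarrow> (\<And>t. (z has_real_derivative F (x + z t *\<^sub>R ?e)) (at t)) \<Longrightarrow> z = y"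
    by (metis (lifting))
  have "flow (unidirectional i F) x = (\<lambda>t. x + y t *\<^sub>R ?e)"
    unfolding flow_def
  proof (rule the_equality, intro conjI allI)
    show "x + y 0 *\<^sub>R ?e = x" by (simp add: y)
    show "((\<lambda>t. x + y t *\<^sub>R ?e) has_vector_derivative unidirectional i F (x + y t *\<^sub>R ?e)) (at t)" for t
      using y(2)[of t] unfolding unidirectional_def
      by (auto intro!: derivative_eq_intros simp: has_real_derivative_iff_has_vector_derivative)
  next
    fix u assume u: "u 0 = x \<and> (\<forall>t. (u has_vector_derivative unidirectional i F (u t)) (at t))"
    have comp: "((\<lambda>t. u t $ j) has_real_derivative unidirectional i F (u t) $ j) (at t)" for j t
      using bounded_linear.has_vector_derivative[OF bounded_linear_vec_nth, of u _ "at t" j] u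
      by (simp add: has_real_derivative_iff_has_vector_derivative)
    have "u t $ j = x $ j" if "j \<noteq> i" for j t
    proof -
      have "((\<lambda>t. u t $ j) has_real_derivative 0) (at t)" for t
        using comp[of j t] that by (simp add: unidirectional_def axis_def)
      then have "u t $ j = u 0 $ j" using DERIV_isconst_all[of "\<lambda>t. u t $ j" t 0] by blast
      then show ?thesis using u by simp
    qed
    then have ueq: "u t = x + (u t $ i - x $ i) *\<^sub>R ?e" for t
      by (simp add: vec_eq_iff axis_def)
    have "(\<lambda>t. u t $ i - x $ i) = y"
    proof (rule uniq)
      show "((\<lambda>t. u t $ i - x $ i) has_real_derivative F (x + (u t $ i - x $ i) *\<^sub>R ?e)) (at t)" for t
        using DERIV_diff[OF comp[of i t] DERIV_const[of "x $ i"]] ueq[of t]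
        by (simp add: unidirectional_def)
    qed (use u in simp)
    then show "u = (\<lambda>t. x + y t *\<^sub>R ?e)" using ueq by (metis ext)
  qed
  then show ?thesis using that y by blast
qed

lemma progress_bounds:
  fixes y :: "real \<Rightarrow> real"
  assumes F: "good_speed v V F" and y: "y 0 = 0" "\<And>t. (y has_real_derivative F (x + y t *\<^sub>R w)) (at t)"
    and "0 \<le> t"
  shows "v * t \<le> y t" "y t \<le> V * t"
proof -
  have "v * t \<le> y t \<and> y t \<le> V * t"
  proof (cases "t = 0")
    case False
    then obtain r where "y t - y 0 = (t - 0) * F (x + y r *\<^sub>R w)"
      using MVT2[of 0 t y "\<lambda>t. F (x + y t *\<^sub>R w)"] y(2) \<open>0 \<le> t\<close> by auto
    then have "y t = F (x + y r *\<^sub>R w) * t" using y(1) by simp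
    moreover have "v \<le> F (x + y r *\<^sub>R w)" "F (x + y r *\<^sub>R w) \<le> V"
      using F by (auto simp: good_speed_def)
    ultimately show ?thesis using \<open>0 \<le> t\<close> by (auto intro!: mult_right_mono)
  qed (use y in simp)
  then show "v * t \<le> y t" "y t \<le> V * t" by auto
qed

text \<open>Both positions lie between v t and V t along the same line. For times of order
  \<open>h\<close> this crude bound is good enough, and no exponential factor as in Gronwall's
  inequality appears.\<close>

lemma flow_diff_le:
  fixes F G :: "real^'n::finite \<Rightarrow> real"
  assumes F: "good_speed v V F" and G: "good_speed v V G" and "0 \<le> t"
  shows "norm (flow (unidirectional i F) x t - flow (unidirectional i G) x t) \<le> (V - v) * t"
proof -
  obtain y where y: "flow (unidirectional i F) x = (\<lambda>t. x + y t *\<^sub>R axis i 1)" "y 0 = 0"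
    "\<And>t. (y has_real_derivative F (x + y t *\<^sub>R axis i 1)) (at t)"
    using flow_unidirectional[OF F] by blast
  obtain z where z: "flow (unidirectional i G) x = (\<lambda>t. x + z t *\<^sub>R axis i 1)" "z 0 = 0"
    "\<And>t. (z has_real_derivative G (x + z t *\<^sub>R axis i 1)) (at t)"
    using flow_unidirectional[OF G] by blast
  have "flow (unidirectional i F) x t - flow (unidirectional i G) x t = (y t - z t) *\<^sub>R axis i 1"
    by (simp add: y(1) z(1) scaleR_diff_left)
  then have "norm (flow (unidirectional i F) x t - flow (unidirectional i G) x t) = \<bar>y t - z t\<bar>"
    by simp
  also have "\<dots> \<le> (V - v) * t"
    using progress_bounds[OF F y(2,3) \<open>0 \<le> t\<close>] progress_bounds[OF G z(2,3) \<open>0 \<le> t\<close>]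
    by (simp add: left_diff_distrib)
  finally show ?thesis .
qed

text \<open>Up to time \<open>T\<close> the trajectory of \<open>G\<close> stays within reach
  \<open>V * T\<close>, where the speeds agree, so there it also solves the equation of
  \<open>F\<close>. Agreement is only local, hence the comparison goes through the travel time of
  \<open>F\<close>, which takes the value \<open>t\<close> at both positions.\<close>

lemma flow_eq_of_agree:
  fixes F G :: "real^'n::finite \<Rightarrow> real"
  assumes F: "good_speed v V F" and G: "good_speed v V G" and t: "0 \<le> t" "t \<le> T"
    and agree: "\<And>s. 0 \<le> s \<Longrightarrow> s \<le> V * T \<Longrightarrow> F (x + s *\<^sub>R axis i 1) = G (x + s *\<^sub>R axis i 1)"
  shows "flow (unidirectional i F) x t = flow (unidirectional i G) x t"
proof -
  let ?e = "axis i 1 :: real^'n"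
  obtain y where y: "flow (unidirectional i F) x = (\<lambda>t. x + y t *\<^sub>R ?e)" "y 0 = 0"
    "\<And>t. (y has_real_derivative F (x + y t *\<^sub>R ?e)) (at t)"
    using flow_unidirectional[OF F] by blast
  obtain z where z: "flow (unidirectional i G) x = (\<lambda>t. x + z t *\<^sub>R ?e)" "z 0 = 0"
    "\<And>t. (z has_real_derivative G (x + z t *\<^sub>R ?e)) (at t)"
    using flow_unidirectional[OF G] by blast
  have v: "0 < v" "v \<le> F x" "F x \<le> V" for x using F by (auto simp: good_speed_def)
  have V: "0 < V" using v(1) v(2)[of 0] v(3)[of 0] by linarith
  obtain \<Theta> where \<Theta>: "\<Theta> 0 = 0" "\<And>s. (\<Theta> has_real_derivative 1 / F (x + s *\<^sub>R ?e)) (at s)"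
    "\<And>s s'. s \<le> s' \<Longrightarrow> (s' - s) / V \<le> \<Theta> s' - \<Theta> s"
    using travel_time[OF good_speed_line[OF F]] by blast
  have pos: "0 < F w" for w using v(1) v(2)[of w] by linarith
  have le: "s' \<le> s" if "s \<le> s'" "\<Theta> s = \<Theta> s'" for s s'
  proof -
    have "(s' - s) / V \<le> 0" using \<Theta>(3)[OF that(1)] unfolding that(2) by simp
    then show ?thesis using V by (simp add: divide_le_eq)
  qed
  have inj: "s = s'" if "\<Theta> s = \<Theta> s'" for s s'
    using le[OF _ that] le[OF _ that[symmetric]] by linarith
  have time: "\<Theta> (q t) = t"
    if q: "q 0 = 0" "\<And>r. 0 \<le> r \<Longrightarrow> r \<le> T \<Longrightarrow> (q has_real_derivative F (x + q r *\<^sub>R ?e)) (at r)" for q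
  proof (cases "t = 0")
    case False
    have "((\<lambda>t. \<Theta> (q t) - t) has_real_derivative 0) (at r)" if "0 \<le> r" "r \<le> T" for r
    proof -
      have "((\<lambda>t. \<Theta> (q t)) has_real_derivative 1 / F (x + q r *\<^sub>R ?e) * F (x + q r *\<^sub>R ?e)) (at r)"
        using q that by (intro DERIV_chain2[OF \<Theta>(2)]) auto
      from DERIV_diff[OF this DERIV_ident] show ?thesis
        using pos[of "x + q r *\<^sub>R ?e"] by simp
    qed
    then have "\<Theta> (q t) - t = \<Theta> (q 0) - 0"
      using t False MVT2[of 0 t "\<lambda>t. \<Theta> (q t) - t" "\<lambda>_. 0"] by force
    then show ?thesis using q(1) \<Theta>(1) by simp
  qed (use q \<Theta> in simp)
  have zF: "(z has_real_derivative F (x + z r *\<^sub>R ?e)) (at r)" if r: "0 \<le> r" "r \<le> T" for r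
  proof -
    have "0 \<le> v * r" using v(1) r(1) by simp
    then have "0 \<le> z r" "z r \<le> V * r"
      using progress_bounds[OF G z(2,3) r(1)] by linarith+
    moreover have "V * r \<le> V * T" using V r by simp
    ultimately show ?thesis using z(3)[of r] agree[of "z r"] by simp
  qed
  have "\<Theta> (y t) = t" by (rule time[OF y(2,3)])
  moreover have "\<Theta> (z t) = t" by (rule time[OF z(2) zF])
  ultimately have "y t = z t" using inj[of "y t" "z t"] by simp
  then show ?thesis by (simp add: y(1) z(1))
qed

text \<open>By the intermediate value theorem the trajectory passes the hyperplane through
  \<open>z\<close> orthogonal to the axis \<open>i\<close>. The remaining offset is orthogonal to
  the velocity, and its Euclidean norm is at most its l1 norm.\<close>

lemma tube_covers:
  fixes F :: "real^'n::finite \<Rightarrow> real"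
  assumes F: "good_speed v V F" and "0 < T"
    and z: "0 \<le> z $ i - x $ i" "z $ i - x $ i \<le> v * T" "(\<Sum>j\<in>UNIV - {i}. \<bar>z $ j - x $ j\<bar>) \<le> \<delta>"
  shows "z \<in> tube (flow (unidirectional i F) x) T \<delta>"
proof -
  let ?e = "axis i 1 :: real^'n"
  obtain y where y: "flow (unidirectional i F) x = (\<lambda>t. x + y t *\<^sub>R ?e)" "y 0 = 0"
    "\<And>t. (y has_real_derivative F (x + y t *\<^sub>R ?e)) (at t)"
    using flow_unidirectional[OF F] by blast
  have "v * T \<le> y T" using progress_bounds[OF F y(2,3), of T] \<open>0 < T\<close> by simp
  moreover have "continuous_on {0..T} y"
    using y(3) by (intro continuous_at_imp_continuous_on ballI DERIV_isCont)
  ultimately obtain t where t: "0 \<le> t" "t \<le> T" "y t = z $ i - x $ i"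
    using IVT'[of y 0 "z $ i - x $ i" T] z(1,2) y(2) \<open>0 < T\<close> by auto
  define w where "w = z - (x + y t *\<^sub>R ?e)"
  have w_i: "w $ i = 0" by (simp add: w_def t)
  have w_j: "w $ j = z $ j - x $ j" if "j \<noteq> i" for j using that by (simp add: w_def axis_def)
  have "norm w \<le> (\<Sum>j\<in>UNIV. \<bar>w $ j\<bar>)" by (rule norm_le_l1_cart)
  also have "\<dots> = (\<Sum>j\<in>UNIV - {i}. \<bar>w $ j\<bar>)"
    using w_i by (subst sum.remove[of _ i]) auto
  also have "\<dots> = (\<Sum>j\<in>UNIV - {i}. \<bar>z $ j - x $ j\<bar>)"
    by (intro sum.cong) (auto simp: w_j)
  also note z(3)
  finally have "norm w \<le> \<delta>" .
  have "((\<lambda>t. x + y t *\<^sub>R ?e) has_vector_derivative F (x + y t *\<^sub>R ?e) *\<^sub>R ?e) (at t within {0..T})"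
    using y(3)[of t]
    by (auto intro!: derivative_eq_intros simp: has_real_derivative_iff_has_vector_derivative
      intro: has_vector_derivative_at_within)
  then have vd: "vector_derivative (\<lambda>t. x + y t *\<^sub>R ?e) (at t within {0..T}) = F (x + y t *\<^sub>R ?e) *\<^sub>R ?e"
    using t \<open>0 < T\<close> vector_derivative_within_cbox[of 0 T] by (auto simp: cbox_interval)
  have "F (x + y t *\<^sub>R ?e) \<noteq> 0"
    using F unfolding good_speed_def by (metis less_le_not_le order_trans)
  moreover have "w \<bullet> ?e = 0" using w_i by (simp add: inner_axis)
  ultimately show ?thesis
    unfolding tube_def y(1)
    using t \<open>norm w \<le> \<delta>\<close>
    by (auto simp: vd w_def axis_eq_0_iff intro!: bexI[of _ t] exI[of _ w])
qed

section \<open>A family of snakes\<close>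

lemma continuous_bump_at: "continuous_on UNIV (bump_at m \<rho> z)"
  unfolding bump_at_eq[abs_def] bump_def
  by (cases "\<rho> = 0") (auto intro!: continuous_intros)

text \<open>\<open>cover_time\<close> with a = 0 and b = T_j counts all the observations of one
  trajectory.\<close>

lemma length_times_le:
  assumes "valid_times n Ts tss" "cover_time C n T Ts tss" "j < length Ts" "0 < Ts ! j"
  shows "real (length (tss ! j)) \<le> max 1 (C * Ts ! j * (real n / T))"
proof -
  let ?ts = "tss ! j"
  have ts: "?ts \<noteq> []" "sorted ?ts" "0 \<le> hd ?ts" "last ?ts = Ts ! j"
    using assms by (auto simp: valid_times_def)
  have "0 \<le> ?ts ! i \<and> ?ts ! i \<le> Ts ! j" if "i < length ?ts" for i
    using ts that sorted_nth_mono[OF ts(2), of 0 i] sorted_nth_mono[OF ts(2), of i "length ?ts - 1"]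
    by (auto simp: hd_conv_nth last_conv_nth)
  then have "{i. i < length ?ts \<and> ?ts ! i \<in> {0..Ts ! j}} = {..<length ?ts}"
    by auto
  moreover have "real (card {i. i < length ?ts \<and> ?ts ! i \<in> {0..Ts ! j}})
      \<le> max 1 (C * (Ts ! j - 0) * (real n / T))"
    using assms(2-4) unfolding cover_time_def
    by (elim allE[of _ j] impE ballE[of _ _ 0] ballE[of _ _ "Ts ! j"]) auto
  ultimately show ?thesis by simp
qed

lemma times_in_range:
  assumes "valid_times n Ts tss" "j < length Ts" "i < length (tss ! j)"
  shows "0 \<le> tss ! j ! i" "tss ! j ! i \<le> Ts ! j"
proof -
  let ?ts = "tss ! j"
  have ts: "?ts \<noteq> []" "sorted ?ts" "0 \<le> hd ?ts" "last ?ts = Ts ! j"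
    using assms by (auto simp: valid_times_def)
  then show "0 \<le> ?ts ! i" "?ts ! i \<le> Ts ! j"
    using assms(3) sorted_nth_mono[OF ts(2), of 0 i] sorted_nth_mono[OF ts(2), of i "length ?ts - 1"]
    by (auto simp: hd_conv_nth last_conv_nth)
qed

lemma ennreal_le_of_double_le: "ennreal (2 * y) \<le> R + R \<Longrightarrow> ennreal y \<le> R"
  by (cases R) (auto simp: ennreal_le_iff2 simp flip: ennreal_plus)

lemma power2_norm_triangle: "(norm (a - b))\<^sup>2 / 2 \<le> (norm (g - a))\<^sup>2 + (norm (g - b))\<^sup>2"
  for a b g :: "'a::real_normed_vector"
proof -
  have "norm (a - b) \<le> norm (g - a) + norm (g - b)"
    using norm_triangle_ineq4[of "g - b" "g - a"] by (simp add: norm_minus_commute algebra_simps)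
  then have "(norm (a - b))\<^sup>2 \<le> (norm (g - a) + norm (g - b))\<^sup>2"
    by (intro power_mono) auto
  also have "\<dots> \<le> 2 * ((norm (g - a))\<^sup>2 + (norm (g - b))\<^sup>2)"
    using sum_squares_bound[of "norm (g - a)" "norm (g - b)"] by (simp add: power2_sum)
  finally show ?thesis by simp
qed

text \<open>Snakes whose trajectories start at the points of \<open>X\<close>, move in direction \<open>i\<close> with speed about
  \<open>v\<close> and last for the time \<open>h / v\<close>; a last trajectory, started beyond all bumps, uses up the
  remaining time. The drift is perturbed by bumps of height \<open>a \<rho>\<^sup>\<beta>\<close> and width \<open>\<rho>\<close> at points of \<open>K\<close>,
  and \<open>\<kappa>\<close> bounds the information about a single bump.\<close>

locale snake_family =
  fixes \<beta> :: real and L :: "nat \<Rightarrow> real" and L\<beta> Cnoise Ccvrtm :: real and n :: nat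
    and \<delta> Tsum :: real and P :: "(real^'n::finite) measure" and D :: design
    and i :: 'n and m :: nat and \<rho> a v h \<kappa> :: real and X K :: "(real^'n) set"
  assumes \<beta>: "1 \<le> \<beta>" and m_def: "m = smoothness_order \<beta> + 2"
    and L_pos: "\<And>k. k \<le> smoothness_order \<beta> \<Longrightarrow> 0 < L k" and L\<beta>_pos: "0 < L\<beta>"
    and L_0: "v + a * bump_bound CARD('n) m \<le> L 0"
    and L_k: "\<And>k. 0 < k \<Longrightarrow> k \<le> smoothness_order \<beta> \<Longrightarrow> a * bump_bound CARD('n) m \<le> L k"
    and L_\<beta>: "4 * a * bump_bound CARD('n) m \<le> L\<beta>"
    and a: "0 < a" "a \<le> v" and \<rho>: "0 < \<rho>" "\<rho> \<le> 1" and h: "0 < h" and \<delta>: "0 < \<delta>"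
    and noise: "centered_noise P" "noise_condition Cnoise P" "0 < Cnoise"
    and design: "\<And>f xs Ts. (f :: real^'n \<Rightarrow> real^'n, xs, Ts) \<in> snake_model \<beta> L L\<beta> \<delta> Tsum n \<Longrightarrow>
       valid_times n Ts (D Ts) \<and> cover_time Ccvrtm n Tsum Ts (D Ts)"
    and X_finite: "finite X" and X_card: "card X + 1 \<le> n" and X_time: "real (card X) * (h / v) < Tsum"
    and X_covers: "\<And>z. z \<in> unit_cube \<Longrightarrow>
      \<exists>x\<in>X. 0 \<le> z $ i - x $ i \<and> z $ i - x $ i \<le> h \<and> (\<Sum>j\<in>UNIV - {i}. \<bar>z $ j - x $ j\<bar>) \<le> \<delta>"
    and K_finite: "finite K" and K_separated: "separated \<rho> K" and K_below: "\<And>z. z \<in> K \<Longrightarrow> z $ i + \<rho> \<le> 10"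
    and \<kappa>: "\<And>z. z \<in> K \<Longrightarrow>
      real (card {x\<in>X. \<exists>s\<in>{0..2 * h}. \<forall>j. \<bar>(x + s *\<^sub>R axis i 1) $ j - z $ j\<bar> < \<rho>})
        * (max 1 (Ccvrtm * (h / v) * (real n / Tsum)) * (Cnoise * (a * \<rho> powr \<beta> * (h / v))\<^sup>2)) \<le> \<kappa>"
begin

definition A :: real where "A = a * \<rho> powr \<beta>"

definition drift :: "(real^'n) set \<Rightarrow> real^'n \<Rightarrow> real^'n" where
  "drift S = unidirectional i (speed m \<rho> A v S)"

text \<open>Any fixed enumeration of \<open>X\<close> serves. The level 10 is generous: later the
  centres have coordinate at most 1 and the bumps half-width at most 1.\<close>

definition starts :: "(real^'n) list" where
  "starts = (SOME xs. set xs = X \<and> distinct xs) @ [axis i 10]"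

definition durations :: "real list" where
  "durations = replicate (card X) (h / v) @ [Tsum - real (card X) * (h / v)]"

abbreviation "obs_times \<equiv> D durations"
abbreviation "obs \<equiv> obs_index obs_times"

definition obs_mean :: "(real^'n) set \<Rightarrow> nat \<times> nat \<Rightarrow> real^'n" where
  "obs_mean S = (\<lambda>(j, k). flow (drift S) (starts ! j) (obs_times ! j ! k))"

text \<open>Speeds are at most v + A \<le> 2 v, so in time h / v a trajectory travels at most 2 h.
  The set is thus the same for every configuration of the other bumps.\<close>

definition affected :: "real^'n \<Rightarrow> (real^'n) set" where
  "affected z = {x\<in>X. \<exists>s\<in>{0..2 * h}. \<forall>j. \<bar>(x + s *\<^sub>R axis i 1) $ j - z $ j\<bar> < \<rho>}"

abbreviation "law S \<equiv> obs_law obs P (obs_mean S)"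

lemma v_pos: "0 < v"
  using a by simp

lemma m_pos: "0 < m"
  by (simp add: m_def)

lemma A_pos: "0 < A"
  using a \<rho> by (simp add: A_def)

lemma A_le_v: "A \<le> v"
proof -
  have "A \<le> a * 1" unfolding A_def using a \<rho> \<beta> by (intro mult_left_mono powr_le1) auto
  then show ?thesis using a by simp
qed

lemma starts_eq: obtains xs where "starts = xs @ [axis i 10]" "set xs = X" "distinct xs" "length xs = card X"
proof -
  have "\<exists>xs. set xs = X \<and> distinct xs" using finite_distinct_list[OF X_finite] .
  from someI_ex[OF this] show ?thesis
    using that[of "SOME xs. set xs = X \<and> distinct xs"]
      distinct_card[of "SOME xs. set xs = X \<and> distinct xs"] by (simp add: starts_def)
qed

lemma separated_subset: "S \<subseteq> K \<Longrightarrow> separated \<rho> S"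
  using K_separated by (auto simp: separated_def subset_eq)

lemma finite_subset_K: "S \<subseteq> K \<Longrightarrow> finite S"
  using K_finite finite_subset by blast

lemma good_speed_speed:
  assumes "S \<subseteq> K"
  shows "good_speed v (v + A) (speed m \<rho> A v S)"
  unfolding good_speed_def
  using separated_speed_bounds[OF finite_subset_K separated_subset, OF assms assms, of A m v] assms
    A_pos \<rho> m_pos v_pos
  unfolding speed_def[abs_def]
  by (auto intro!: continuous_intros continuous_bump_at)

lemma drift_smooth:
  assumes "S \<subseteq> K"
  shows "drift S \<in> smooth_class \<beta> L L\<beta>"
  unfolding smooth_class_def
proof (intro CollectI allI)
  fix j
  show "smooth_component \<beta> L L\<beta> (\<lambda>x. drift S x $ j)"
  proof (cases "j = i")
    case True
    have "smooth_component \<beta> L L\<beta> (speed m \<rho> (a * \<rho> powr \<beta>) v S)"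
      using assms a \<rho> L_0 L_k L_\<beta> v_pos
      by (intro smooth_component_speed \<beta> m_def finite_subset_K separated_subset) auto
    moreover have "(\<lambda>x. drift S x $ j) = speed m \<rho> (a * \<rho> powr \<beta>) v S"
      by (simp add: fun_eq_iff drift_def unidirectional_def True A_def)
    ultimately show ?thesis by simp
  next
    case False
    then have "(\<lambda>x. drift S x $ j) = (\<lambda>_. 0)"
      by (simp add: fun_eq_iff drift_def unidirectional_def axis_def)
    then show ?thesis using smooth_component_zero[OF L_pos L\<beta>_pos] by simp
  qed
qed

lemma drift_in_model:
  assumes "S \<subseteq> K"
  shows "(drift S, starts, durations) \<in> snake_model \<beta> L L\<beta> \<delta> Tsum n"
proof -
  obtain xs where xs: "starts = xs @ [axis i 10]" "set xs = X" "distinct xs" "length xs = card X"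
    by (rule starts_eq)
  have "unit_cube \<subseteq> (\<Union>j<length durations. tube (flow (drift S) (starts ! j)) (durations ! j) \<delta>)"
  proof
    fix z :: "real^'n" assume "z \<in> unit_cube"
    then obtain x where x: "x \<in> X" "0 \<le> z $ i - x $ i" "z $ i - x $ i \<le> h"
      "(\<Sum>j\<in>UNIV - {i}. \<bar>z $ j - x $ j\<bar>) \<le> \<delta>"
      using X_covers by blast
    then obtain j where j: "j < card X" "xs ! j = x"
      using xs by (metis in_set_conv_nth)
    have "z \<in> tube (flow (drift S) x) (h / v) \<delta>"
      unfolding drift_def using x v_pos h
      by (intro tube_covers[OF good_speed_speed[OF assms]]) auto
    then show "z \<in> (\<Union>j<length durations. tube (flow (drift S) (starts ! j)) (durations ! j) \<delta>)"
      using j xs by (intro UN_I[of j]) (auto simp: durations_def nth_append)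
  qed
  then have "tube_dist unit_cube (drift S, starts, durations) \<le> ereal \<delta>"
    unfolding tube_dist_def using \<delta> by (auto intro!: INF_lower)
  then show ?thesis
    using drift_smooth[OF assms] xs X_card X_time h v_pos
    by (auto simp: snake_model_def snake_class_def durations_def sum_list_replicate)
qed

text \<open>A design sees the durations but not the drift, so the hypothesis without bumps already
  yields these facts for all hypotheses.\<close>

lemma valid_obs_times: "valid_times n durations obs_times"
  and cover_obs_times: "cover_time Ccvrtm n Tsum durations obs_times"
  using design[OF drift_in_model[of "{}"]] by auto

lemma finite_obs: "finite obs"
  by (simp add: obs_index_def)

section \<open>Displacement and information caused by one bump\<close>

lemma speed_insert:
  assumes "insert z S \<subseteq> K" "z \<notin> S"
  shows "speed m \<rho> A v (insert z S) x = speed m \<rho> A v S x + A * bump_at m \<rho> z x"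
  using assms finite_subset_K[of S] by (simp add: speed_def distrib_left)

lemma flow_insert_eq:
  assumes S: "insert z S \<subseteq> K" "z \<notin> S" and t: "0 \<le> t" "t \<le> T"
    and out: "\<And>s. 0 \<le> s \<Longrightarrow> s \<le> (v + A) * T \<Longrightarrow> \<exists>j. \<rho> \<le> \<bar>(x + s *\<^sub>R axis i 1) $ j - z $ j\<bar>"
  shows "flow (drift S) x t = flow (drift (insert z S)) x t"
  unfolding drift_def
proof (rule flow_eq_of_agree[OF good_speed_speed good_speed_speed t])
  fix s assume "0 \<le> s" "s \<le> (v + A) * T"
  then obtain j where "\<rho> \<le> \<bar>(x + s *\<^sub>R axis i 1) $ j - z $ j\<bar>" using out by blast
  then have "bump_at m \<rho> z (x + s *\<^sub>R axis i 1) = 0"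
    using \<rho> m_pos by (intro bump_at_outside)
  then show "speed m \<rho> A v S (x + s *\<^sub>R axis i 1) = speed m \<rho> A v (insert z S) (x + s *\<^sub>R axis i 1)"
    using S by (simp add: speed_insert)
qed (use S in auto)

text \<open>Affected trajectories are displaced by at most the extra speed \<open>A\<close> times
  their duration. The others do not meet the support of the new bump: either their whole reach 2 h
  misses it, or they are the last trajectory, which starts beyond it and moves away.\<close>

lemma obs_mean_diff:
  assumes S: "insert z S \<subseteq> K" "z \<notin> S" and jk: "j < length durations" "k < length (obs_times ! j)"
  shows "norm (obs_mean S (j, k) - obs_mean (insert z S) (j, k))
    \<le> (if j < card X \<and> starts ! j \<in> affected z then A * (h / v) else 0)"
proof -
  obtain xs where xs: "starts = xs @ [axis i 10]" "set xs = X" "distinct xs" "length xs = card X"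
    by (rule starts_eq)
  define t where "t = obs_times ! j ! k"
  have t: "0 \<le> t" "t \<le> durations ! j"
    using times_in_range[OF valid_obs_times jk] by (auto simp: t_def)
  have eq: "obs_mean U (j, k) = flow (drift U) (starts ! j) t" for U
    by (simp add: obs_mean_def t_def)
  consider "j < card X" "starts ! j \<in> affected z" | "j < card X" "starts ! j \<notin> affected z" | "j = card X"
    using jk(1) by (auto simp: durations_def less_Suc_eq)
  then show ?thesis
  proof cases
    case 1
    have "norm (obs_mean S (j, k) - obs_mean (insert z S) (j, k)) \<le> (v + A - v) * t"
      unfolding eq drift_def using S
      by (intro flow_diff_le[OF good_speed_speed good_speed_speed t(1)]) auto
    also have "\<dots> \<le> A * (h / v)"
      using t 1 A_pos mult_left_mono[of t "h / v" A] by (simp add: durations_def nth_append)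
    finally show ?thesis using 1 by simp
  next
    case 2
    have "starts ! j \<in> X" using 2 xs by (auto simp: nth_append)
    have "flow (drift S) (starts ! j) t = flow (drift (insert z S)) (starts ! j) t"
    proof (rule flow_insert_eq[OF S t])
      fix s assume s: "0 \<le> s" "s \<le> (v + A) * durations ! j"
      have "durations ! j = h / v" using 2 by (simp add: durations_def nth_append)
      then have "(v + A) * durations ! j \<le> (v + v) * (h / v)"
        using A_le_v h v_pos by (simp only:) (intro mult_right_mono, auto)
      also have "\<dots> = 2 * h" using v_pos by (simp add: field_simps)
      finally show "\<exists>j'. \<rho> \<le> \<bar>(starts ! j + s *\<^sub>R axis i 1) $ j' - z $ j'\<bar>"
        using 2 s \<open>starts ! j \<in> X\<close> by (force simp: affected_def not_less)
    qed
    then show ?thesis using A_pos h v_pos by (simp add: eq)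
  next
    case 3
    have "flow (drift S) (starts ! j) t = flow (drift (insert z S)) (starts ! j) t"
    proof (rule flow_insert_eq[OF S t])
      fix s :: real assume s: "0 \<le> s"
      have "z $ i + \<rho> \<le> 10" using K_below S by auto
      then show "\<exists>j'. \<rho> \<le> \<bar>(starts ! j + s *\<^sub>R axis i 1) $ j' - z $ j'\<bar>"
        using 3 xs s by (intro exI[of _ i]) (auto simp: nth_append)
    qed
    then show ?thesis using A_pos h v_pos by (simp add: eq)
  qed
qed

text \<open>The bound is a product: number of affected trajectories, observations on each of them,
  squared displacement. It is uniform in the bumps already present, as the pairs in the integrated
  loss require.\<close>

lemma information_le:
  assumes S: "insert z S \<subseteq> K" "z \<notin> S"
  shows "(\<Sum>p\<in>obs. Cnoise * (norm (obs_mean S p - obs_mean (insert z S) p))\<^sup>2) \<le> \<kappa>"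
proof -
  obtain xs where xs: "starts = xs @ [axis i 10]" "set xs = X" "distinct xs" "length xs = card X"
    by (rule starts_eq)
  define q where "q = Cnoise * (A * (h / v))\<^sup>2"
  define c where "c = max 1 (Ccvrtm * (h / v) * (real n / Tsum))"
  have q: "0 \<le> q" using noise(3) by (simp add: q_def)
  have len: "length obs_times = length durations"
    using valid_obs_times by (simp add: valid_times_def)
  have "(\<Sum>p\<in>obs. Cnoise * (norm (obs_mean S p - obs_mean (insert z S) p))\<^sup>2)
      = (\<Sum>j<length durations. \<Sum>k<length (obs_times ! j).
          Cnoise * (norm (obs_mean S (j, k) - obs_mean (insert z S) (j, k)))\<^sup>2)"
    unfolding obs_index_def len by (subst sum.Sigma) auto
  also have "\<dots> \<le> (\<Sum>j<length durations. if j < card X \<and> starts ! j \<in> affected z then c * q else 0)"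
  proof (rule sum_mono)
    fix j assume "j \<in> {..<length durations}"
    then have j: "j < length durations" by simp
    show "(\<Sum>k<length (obs_times ! j). Cnoise * (norm (obs_mean S (j, k) - obs_mean (insert z S) (j, k)))\<^sup>2)
      \<le> (if j < card X \<and> starts ! j \<in> affected z then c * q else 0)"
    proof (cases "j < card X \<and> starts ! j \<in> affected z")
      case True
      have "(\<Sum>k<length (obs_times ! j). Cnoise * (norm (obs_mean S (j, k) - obs_mean (insert z S) (j, k)))\<^sup>2)
          \<le> real (card {..<length (obs_times ! j)}) * q"
        unfolding q_def using obs_mean_diff[OF S j] True noise(3)
        by (intro sum_bounded_above mult_left_mono power_mono) auto
      also have "\<dots> \<le> c * q"
      proof (rule mult_right_mono[OF _ q])
        have "durations ! j = h / v" using True by (simp add: durations_def nth_append)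
        then show "real (card {..<length (obs_times ! j)}) \<le> c"
          using length_times_le[OF valid_obs_times cover_obs_times j] h v_pos by (simp add: c_def)
      qed
      finally show ?thesis using True by simp
    next
      case False
      have "norm (obs_mean S (j, k) - obs_mean (insert z S) (j, k)) \<le> 0" if "k < length (obs_times ! j)" for k
        using obs_mean_diff[OF S j that] False by (simp only: if_False)
      then have "(\<Sum>k<length (obs_times ! j). Cnoise * (norm (obs_mean S (j, k) - obs_mean (insert z S) (j, k)))\<^sup>2) = 0"
        by (intro sum.neutral) auto
      then show ?thesis unfolding if_not_P[OF False] by simp
    qed
  qed
  \<comment> \<open>The index \<open>card X\<close> belongs to the last trajectory. However many
    observations it carries, its term is zero.\<close>
  also have "\<dots> = (\<Sum>j<card X. if xs ! j \<in> affected z then c * q else 0)"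
    by (rule sum.mono_neutral_cong_right) (auto simp: durations_def xs nth_append)
  also have "\<dots> = (\<Sum>x\<in>X. if x \<in> affected z then c * q else 0)"
    using sum.reindex_bij_betw[OF bij_betw_nth[OF xs(3) refl refl], of "\<lambda>x. if x \<in> affected z then c * q else 0"]
    by (simp add: xs(2,4))
  also have "\<dots> = real (card (affected z)) * (c * q)"
    using X_finite by (simp add: affected_def flip: sum.inter_filter)
  also have "\<dots> \<le> \<kappa>"
    using \<kappa>[of z] S by (simp add: affected_def c_def q_def A_def)
  finally show ?thesis .
qed

section \<open>Lower bounds for the three losses within one family\<close>

lemma risk_eq:
  assumes "(\<lambda>Y. loss (fhat starts durations Y) (drift S)) \<in> borel_measurable (\<Pi>\<^sub>M p\<in>obs. borel)"
  shows "risk P D loss fhat (drift S, starts, durations)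
    = (\<integral>\<^sup>+ Y. loss (fhat starts durations Y) (drift S) \<partial>law S)"
proof -
  have "observe (drift S) starts obs_times \<epsilon> = (\<lambda>p\<in>obs. obs_mean S p + \<epsilon> p)" for \<epsilon>
    by (auto simp: observe_def obs_mean_def restrict_def fun_eq_iff)
  then show ?thesis
    using nn_integral_obs_law[OF finite_obs noise(1) assms, of "obs_mean S"] by (simp add: risk_def)
qed

lemma risk_le_SUP:
  assumes "S \<subseteq> K"
  shows "risk P D loss fhat (drift S, starts, durations)
    \<le> (SUP \<theta>\<in>snake_model \<beta> L L\<beta> \<delta> Tsum n. risk P D loss fhat \<theta>)"
  using drift_in_model[OF assms] by (rule SUP_upper)

lemma estimator_measurable:
  assumes "fhat \<in> estimators D"
  shows "(\<lambda>(Y, x). fhat starts durations Y x) \<in> (\<Pi>\<^sub>M p\<in>obs. borel) \<Otimes>\<^sub>M borel \<rightarrow>\<^sub>M borel"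
    and "(\<lambda>Y. fhat starts durations Y x) \<in> borel_measurable (\<Pi>\<^sub>M p\<in>obs. borel)"
proof -
  show m: "(\<lambda>(Y, x). fhat starts durations Y x) \<in> (\<Pi>\<^sub>M p\<in>obs. borel) \<Otimes>\<^sub>M borel \<rightarrow>\<^sub>M borel"
    using assms by (simp add: estimators_def)
  have "(\<lambda>Y. (Y, x)) \<in> (\<Pi>\<^sub>M p\<in>obs. borel) \<rightarrow>\<^sub>M (\<Pi>\<^sub>M p\<in>obs. borel) \<Otimes>\<^sub>M borel"
    by measurable
  from measurable_compose[OF this m]
  show "(\<lambda>Y. fhat starts durations Y x) \<in> borel_measurable (\<Pi>\<^sub>M p\<in>obs. borel)" by simp
qed

lemma norm_drift_insert:
  assumes "insert z S \<subseteq> K" "z \<notin> S"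
  shows "norm (drift S x - drift (insert z S) x) = A * bump_at m \<rho> z x"
proof -
  have "drift S x - drift (insert z S) x = (- (A * bump_at m \<rho> z x)) *\<^sub>R axis i 1"
    using speed_insert[OF assms] by (simp add: drift_def unidirectional_def algebra_simps)
  then show ?thesis using A_pos bump_at_bounds(1)[of m \<rho> z x] by (simp add: abs_mult)
qed

text \<open>The drifts for \<open>{}\<close> and \<open>{z}\<close> differ by exactly
  \<open>A\<close> at \<open>z\<close>, so the two losses add up to at least A^2 / 2 and
  \<open>two_point_bound\<close> applies with c = A^2 / 4. Passing from the sum of two risks to
  their supremum costs the last factor 2.\<close>

lemma minimax_point_loss:
  assumes "z \<in> K" "\<kappa> \<le> 1"
  shows "ennreal (A\<^sup>2 / (16 * exp 4)) \<le> minimax_risk (snake_model \<beta> L L\<beta> \<delta> Tsum n) P D (point_loss z)"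
  unfolding minimax_risk_def
proof (rule INF_greatest)
  fix fhat :: "'n estimator" assume fhat: "fhat \<in> estimators D"
  let ?R = "SUP \<theta>\<in>snake_model \<beta> L L\<beta> \<delta> Tsum n. risk P D (point_loss z) fhat \<theta>"
  have m: "(\<lambda>Y. point_loss z (fhat starts durations Y) (drift S)) \<in> borel_measurable (\<Pi>\<^sub>M p\<in>obs. borel)" for S
    using estimator_measurable(2)[OF fhat] unfolding point_loss_def by measurable
  have "ennreal (A\<^sup>2 / 4 / (2 * exp 4))
      \<le> (\<integral>\<^sup>+ Y. point_loss z (fhat starts durations Y) (drift {}) \<partial>law {})
        + (\<integral>\<^sup>+ Y. point_loss z (fhat starts durations Y) (drift {z}) \<partial>law {z})"
  proof (rule two_point_bound[OF finite_obs noise(1,2) _ _ m m])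
    show "(\<Sum>p\<in>obs. Cnoise * (norm (obs_mean {} p - obs_mean {z} p))\<^sup>2) \<le> 1"
      using information_le[of z "{}"] assms by simp
    fix Y
    have "2 * (A\<^sup>2 / 4) = (norm (drift {} z - drift {z} z))\<^sup>2 / 2"
      using norm_drift_insert[of z "{}" z] assms by (simp add: bump_at_center)
    also have "\<dots> \<le> (norm (fhat starts durations Y z - drift {} z))\<^sup>2 + (norm (fhat starts durations Y z - drift {z} z))\<^sup>2"
      by (rule power2_norm_triangle)
    finally show "ennreal (2 * (A\<^sup>2 / 4)) \<le> point_loss z (fhat starts durations Y) (drift {})
        + point_loss z (fhat starts durations Y) (drift {z})"
      by (simp add: point_loss_def ennreal_leI flip: ennreal_plus)
  qed (use noise(3) in simp_all)
  also have "\<dots> \<le> ?R + ?R"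
    unfolding risk_eq[of "point_loss z" fhat, OF m, symmetric] using assms by (intro add_mono risk_le_SUP) auto
  finally have "ennreal (2 * (A\<^sup>2 / (16 * exp 4))) \<le> ?R + ?R" by simp
  then show "ennreal (A\<^sup>2 / (16 * exp 4)) \<le> ?R" by (rule ennreal_le_of_double_le)
qed

text \<open>\<open>B z\<close> is the event that the estimate is within A / 2 of
  \<open>drift {z}\<close> at all centres. These events are disjoint, so for some \<open>z\<close>
  the event fails with probability at least 1 / 4, and the loss is then at least A^2 / 4. Looking
  only at the finitely many centres keeps \<open>B z\<close> measurable.\<close>

lemma minimax_sup_loss:
  assumes K: "K \<subseteq> unit_cube" "8 \<le> ln (real (card K))" and "\<kappa> \<le> ln (real (card K)) / 8"
  shows "ennreal (A\<^sup>2 / 16) \<le> minimax_risk (snake_model \<beta> L L\<beta> \<delta> Tsum n) P D sup_loss"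
  unfolding minimax_risk_def
proof (rule INF_greatest)
  fix fhat :: "'n estimator" assume fhat: "fhat \<in> estimators D"
  let ?R = "SUP \<theta>\<in>snake_model \<beta> L L\<beta> \<delta> Tsum n. risk P D sup_loss fhat \<theta>"
  let ?E = "\<Pi>\<^sub>M p\<in>obs. borel :: (real^'n) measure"
  note [measurable] = estimator_measurable(2)[OF fhat]
  have drift_at: "drift {z} w = (if w = z then drift {z} w else drift {} w)" if zw: "z \<in> K" "w \<in> K" for z w
  proof (cases "w = z")
    case False
    then obtain j where "2 * \<rho> \<le> \<bar>w $ j - z $ j\<bar>"
      using K_separated zw unfolding separated_def by blast
    then have "bump_at m \<rho> z w = 0" using \<rho> m_pos by (intro bump_at_outside[where i=j]) auto
    then show ?thesis using norm_drift_insert[of z "{}" w] zw False by simp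
  qed simp
  define B where "B z = {Y\<in>space ?E. \<forall>w\<in>K. norm (fhat starts durations Y w - drift {z} w) < A / 2}" for z
  have B[measurable]: "B z \<in> sets ?E" for z
    unfolding B_def using K_finite by measurable
  have "disjoint_family_on B K"
    unfolding disjoint_family_on_def
  proof (intro ballI impI)
    fix z w assume zw: "z \<in> K" "w \<in> K" "z \<noteq> w"
    have "False" if "Y \<in> B z" "Y \<in> B w" for Y
    proof -
      have "norm (drift {} z - drift {z} z) = A"
        using norm_drift_insert[of z "{}" z] zw by (simp add: bump_at_center)
      moreover have "norm (fhat starts durations Y z - drift {z} z) < A / 2"
        "norm (fhat starts durations Y z - drift {} z) < A / 2"
        using that zw drift_at[of w z] by (auto simp: B_def)
      ultimately show False
        using norm_triangle_ineq4[of "fhat starts durations Y z - drift {z} z" "fhat starts durations Y z - drift {} z"]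
        by simp
    qed
    then show "B z \<inter> B w = {}" by blast
  qed
  then have "\<exists>z\<in>K. measure (law {z}) (B z) \<le> 3 / 4"
  proof (intro many_hypotheses_bound[OF finite_obs noise(1,2) _ K_finite K(2) _ B])
    fix z assume "z \<in> K"
    then show "(\<Sum>p\<in>obs. Cnoise * (norm (obs_mean {z} p - obs_mean {} p))\<^sup>2) \<le> ln (real (card K)) / 8"
      using information_le[of z "{}"] assms(3) by (simp add: norm_minus_commute)
  qed (use noise(3) in simp_all)
  then obtain z where z: "z \<in> K" "measure (law {z}) (B z) \<le> 3 / 4" by blast
  interpret law: prob_space "law {z}" by (intro prob_space_obs_law noise)
  \<comment> \<open>The supremum over the uncountable cube comes without Borel measurability, so
    \<open>risk_eq\<close> is not applied to it. A measurable minorant is carried to the noise space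
    instead and compared with the loss there.\<close>
  define \<phi> where "\<phi> Y = ennreal (A\<^sup>2 / 4) * indicator (space ?E - B z) Y" for Y
  have \<phi>m[measurable]: "\<phi> \<in> borel_measurable ?E" unfolding \<phi>_def by measurable
  have "1 / 4 \<le> measure (law {z}) (space ?E - B z)"
    using law.prob_compl[of "B z"] z(2) by simp
  then have "ennreal (A\<^sup>2 / 4 * (1 / 4)) \<le> ennreal (A\<^sup>2 / 4 * measure (law {z}) (space ?E - B z))"
    by (intro ennreal_leI mult_left_mono) auto
  also have "\<dots> = ennreal (A\<^sup>2 / 4) * ennreal (measure (law {z}) (space ?E - B z))"
    by (rule ennreal_mult) auto
  also have "\<dots> = (\<integral>\<^sup>+ Y. \<phi> Y \<partial>law {z})"
    by (simp add: \<phi>_def nn_integral_cmult_indicator law.emeasure_eq_measure)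
  also have "\<dots> = (\<integral>\<^sup>+ \<epsilon>. \<phi> (\<lambda>p\<in>obs. obs_mean {z} p + \<epsilon> p) \<partial>(\<Pi>\<^sub>M p\<in>obs. P))"
    by (rule nn_integral_obs_law[OF finite_obs noise(1) \<phi>m, symmetric])
  also have "\<dots> \<le> risk P D sup_loss fhat (drift {z}, starts, durations)"
    unfolding risk_def prod.case
  proof (rule nn_integral_mono)
    fix \<epsilon> :: "nat \<times> nat \<Rightarrow> real^'n"
    define Y where "Y = (\<lambda>p\<in>obs. obs_mean {z} p + \<epsilon> p)"
    have eq: "observe (drift {z}) starts obs_times \<epsilon> = Y"
      by (auto simp: observe_def obs_mean_def restrict_def fun_eq_iff Y_def)
    have "\<phi> Y \<le> sup_loss (fhat starts durations Y) (drift {z})"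
    proof (cases "Y \<in> space ?E - B z")
      case True
      then obtain w where w: "w \<in> K" "A / 2 \<le> norm (fhat starts durations Y w - drift {z} w)"
        by (auto simp: B_def not_less)
      have "(A / 2)\<^sup>2 \<le> (norm (fhat starts durations Y w - drift {z} w))\<^sup>2"
        using w A_pos by (intro power_mono) auto
      then have "ennreal (A\<^sup>2 / 4) \<le> ennreal ((norm (fhat starts durations Y w - drift {z} w))\<^sup>2)"
        by (intro ennreal_leI) (simp add: power_divide)
      also have "\<dots> \<le> sup_loss (fhat starts durations Y) (drift {z})"
        unfolding sup_loss_def using w K by (intro SUP_upper) auto
      finally show ?thesis by (simp add: \<phi>_def mult_le_one order_trans[OF mult_left_mono[of _ 1]] indicator_def)
    qed (simp add: \<phi>_def)
    then show "\<phi> (\<lambda>p\<in>obs. obs_mean {z} p + \<epsilon> p)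
        \<le> sup_loss (fhat starts durations (observe (drift {z}) starts obs_times \<epsilon>)) (drift {z})"
      unfolding eq Y_def .
  qed
  also have "\<dots> \<le> ?R" using z by (intro risk_le_SUP) auto
  finally show "ennreal (A\<^sup>2 / 16) \<le> ?R" by simp
qed

lemma borel_measurable_drift:
  assumes "S \<subseteq> K"
  shows "drift S \<in> borel_measurable borel"
proof -
  have "continuous_on UNIV (speed m \<rho> A v S)"
    using good_speed_speed[OF assms] by (simp add: good_speed_def)
  then show ?thesis
    unfolding drift_def unidirectional_def[abs_def]
    by (intro borel_measurable_continuous_onI continuous_intros)
qed

section \<open>The integrated loss: local losses on disjoint cubes and averaging over
  subsets\<close>

definition core :: "real^'n \<Rightarrow> (real^'n) set" where
  "core z = cbox (\<chi> j. z $ j - \<rho> / 2) (\<chi> j. z $ j + \<rho> / 2)"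

lemma mem_core: "x \<in> core z \<longleftrightarrow> (\<forall>j. \<bar>x $ j - z $ j\<bar> \<le> \<rho> / 2)"
proof -
  have "z $ j - \<rho> / 2 \<le> x $ j \<and> x $ j \<le> z $ j + \<rho> / 2 \<longleftrightarrow> \<bar>x $ j - z $ j\<bar> \<le> \<rho> / 2" for j
    by arith
  then show ?thesis unfolding core_def mem_box_cart by simp
qed

lemma emeasure_core: "emeasure lborel (core z) = ennreal (\<rho> ^ CARD('n))"
proof -
  have "core z \<noteq> {}"
    using \<rho> mem_core[of z z] by auto
  then have "measure lborel (core z) = \<rho> ^ CARD('n)"
    unfolding core_def by (simp add: content_cbox_cart)
  then show ?thesis
    unfolding core_def by (metis emeasure_eq_ennreal_measure emeasure_lborel_cbox_finite less_irrefl infinity_ennreal_def)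
qed

lemma sets_core [measurable]: "core z \<in> sets borel"
  by (simp add: core_def)

definition core_loss :: "real^'n \<Rightarrow> (real^'n \<Rightarrow> real^'n) \<Rightarrow> (real^'n \<Rightarrow> real^'n) \<Rightarrow> ennreal" where
  "core_loss z g f = (\<integral>\<^sup>+ x\<in>core z. ennreal ((norm (g x - f x))\<^sup>2) \<partial>lborel)"

lemma sum_core_loss_le:
  assumes "\<And>z. z \<in> K \<Longrightarrow> core z \<subseteq> unit_cube"
    and [measurable]: "g \<in> borel_measurable borel" "f \<in> borel_measurable borel"
  shows "(\<Sum>z\<in>K. core_loss z g f) \<le> L2_loss g f"
proof -
  have disj: "disjoint_family_on core K"
    unfolding disjoint_family_on_def
  proof (intro ballI impI)
    fix z w assume zw: "z \<in> K" "w \<in> K" "z \<noteq> w"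
    have "False" if "x \<in> core z" "x \<in> core w" for x
    proof -
      have "\<bar>x $ j - z $ j\<bar> < \<rho>" "\<bar>x $ j - w $ j\<bar> < \<rho>" for j
        using that \<rho> unfolding mem_core by (auto elim!: allE[of _ j])
      then show False using separated_unique[OF K_separated zw(1,2)] zw(3) by blast
    qed
    then show "core z \<inter> core w = {}" by blast
  qed
  have "(\<Sum>z\<in>K. core_loss z g f)
      = (\<integral>\<^sup>+ x. (\<Sum>z\<in>K. ennreal ((norm (g x - f x))\<^sup>2) * indicator (core z) x) \<partial>lborel)"
    unfolding core_loss_def by (intro nn_integral_sum[symmetric]) measurable
  also have "\<dots> = (\<integral>\<^sup>+ x. ennreal ((norm (g x - f x))\<^sup>2) * indicator (\<Union>z\<in>K. core z) x \<partial>lborel)"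
    by (simp add: indicator_UN_disjoint[OF K_finite disj] flip: sum_distrib_left)
  also have "\<dots> \<le> L2_loss g f"
    unfolding L2_loss_def using assms(1)
    by (intro nn_integral_mono mult_left_mono) (auto simp: indicator_def)
  finally show ?thesis .
qed

lemma unit_cube_eq: "unit_cube = cbox 0 (1 :: real^'n)"
  by (auto simp: unit_cube_def mem_box_cart)

text \<open>Tonelli's theorem; this is where joint measurability of an estimator in observations and
  point enters. The set \<open>C\<close> is a core in one use and the unit cube in the
  other.\<close>

lemma core_loss_measurable:
  assumes fhat: "fhat \<in> estimators D" and S: "S \<subseteq> K" and C: "C \<in> sets borel"
  shows "(\<lambda>Y. \<integral>\<^sup>+ x\<in>C. ennreal ((norm (fhat starts durations Y x - drift S x))\<^sup>2) \<partial>lborel)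
    \<in> borel_measurable (\<Pi>\<^sub>M p\<in>obs. borel)"
proof -
  note [measurable] = borel_measurable_drift[OF S] C
  have [measurable]: "(\<lambda>p. fhat starts durations (fst p) (snd p))
      \<in> (\<Pi>\<^sub>M p\<in>obs. borel) \<Otimes>\<^sub>M borel \<rightarrow>\<^sub>M borel"
    using estimator_measurable(1)[OF fhat] by (simp add: case_prod_beta')
  have "(\<lambda>p. ennreal ((norm (fhat starts durations (fst p) (snd p) - drift S (snd p)))\<^sup>2) * indicator C (snd p))
      \<in> borel_measurable ((\<Pi>\<^sub>M p\<in>obs. borel) \<Otimes>\<^sub>M borel)"
    by measurable
  then have "(\<lambda>(Y, x). ennreal ((norm (fhat starts durations Y x - drift S x))\<^sup>2) * indicator C x)
      \<in> borel_measurable ((\<Pi>\<^sub>M p\<in>obs. borel) \<Otimes>\<^sub>M lborel)"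
    by (simp add: case_prod_beta' cong: measurable_cong_sets sets_pair_measure_cong)
  then show ?thesis by (rule lborel.borel_measurable_nn_integral)
qed

text \<open>On each core the bump is at least a fixed fraction of its height, so the presence of
  \<open>z\<close> matters there by at least \<open>b\<close>. Local risks over disjoint cores add
  up to at most the global risk, while adding one bump to any \<open>S\<close> is hard to detect;
  averaging over all \<open>S\<close> turns \<open>card K\<close> local two-point bounds into one
  global bound.\<close>

lemma minimax_L2_loss:
  assumes core: "\<And>z. z \<in> K \<Longrightarrow> core z \<subseteq> unit_cube" and "\<kappa> \<le> 1"
  shows "ennreal (real (card K) * \<rho> ^ CARD('n) * (A * ((3 / 4) ^ m) ^ CARD('n))\<^sup>2 / (16 * exp 4))
    \<le> minimax_risk (snake_model \<beta> L L\<beta> \<delta> Tsum n) P D L2_loss"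
  unfolding minimax_risk_def
proof (rule INF_greatest)
  fix fhat :: "'n estimator" assume fhat: "fhat \<in> estimators D"
  let ?R = "SUP \<theta>\<in>snake_model \<beta> L L\<beta> \<delta> Tsum n. risk P D L2_loss fhat \<theta>"
  let ?E = "\<Pi>\<^sub>M p\<in>obs. borel :: (real^'n) measure"
  define b where "b = A * ((3 / 4) ^ m) ^ CARD('n)"
  define Q where "Q = \<rho> ^ CARD('n) * b\<^sup>2 / (8 * exp 4)"
  have Q: "0 \<le> Q" using \<rho> by (simp add: Q_def)
  have b: "0 \<le> b" using A_pos by (simp add: b_def)
  have fhat_x: "fhat starts durations Y \<in> borel_measurable borel" if "Y \<in> space ?E" for Y
    using measurable_compose[OF measurable_Pair1'[OF that] estimator_measurable(1)[OF fhat]] by simp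
  have m: "(\<lambda>Y. core_loss z (fhat starts durations Y) (drift S)) \<in> borel_measurable ?E" if "S \<subseteq> K" for z S
    unfolding core_loss_def by (rule core_loss_measurable[OF fhat that sets_core])
  have m2: "(\<lambda>Y. L2_loss (fhat starts durations Y) (drift S)) \<in> borel_measurable ?E" if "S \<subseteq> K" for S
    unfolding L2_loss_def by (rule core_loss_measurable[OF fhat that]) (simp add: unit_cube_eq)
  define r where "r z S = (\<integral>\<^sup>+ Y. core_loss z (fhat starts durations Y) (drift S) \<partial>law S)" for z S
  have r_sum: "(\<Sum>z\<in>K. r z S) \<le> ?R" if S: "S \<subseteq> K" for S
  proof -
    have "(\<Sum>z\<in>K. r z S) = (\<integral>\<^sup>+ Y. (\<Sum>z\<in>K. core_loss z (fhat starts durations Y) (drift S)) \<partial>law S)"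
      unfolding r_def using m[OF S] by (intro nn_integral_sum[symmetric]) simp
    also have "\<dots> \<le> (\<integral>\<^sup>+ Y. L2_loss (fhat starts durations Y) (drift S) \<partial>law S)"
      using core fhat_x borel_measurable_drift[OF S] by (intro nn_integral_mono sum_core_loss_le) auto
    also have "\<dots> = risk P D L2_loss fhat (drift S, starts, durations)"
      by (rule risk_eq[of L2_loss fhat, OF m2[OF S], symmetric])
    also have "\<dots> \<le> ?R" by (rule risk_le_SUP[OF S])
    finally show ?thesis .
  qed
  have pair: "ennreal Q \<le> r z S + r z (insert z S)" if S: "insert z S \<subseteq> K" "z \<notin> S" for z S
  proof -
    have "ennreal (\<rho> ^ CARD('n) * b\<^sup>2 / 4 / (2 * exp 4)) \<le> r z S + r z (insert z S)"
      unfolding r_def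
    proof (rule two_point_bound[OF finite_obs noise(1,2) _ _ m m])
      show "(\<Sum>p\<in>obs. Cnoise * (norm (obs_mean S p - obs_mean (insert z S) p))\<^sup>2) \<le> 1"
        using information_le[OF S] assms(2) by simp
      fix Y assume Y: "Y \<in> space ?E"
      let ?g = "fhat starts durations Y"
      have [measurable]: "drift S \<in> borel_measurable borel" "drift (insert z S) \<in> borel_measurable borel"
        "?g \<in> borel_measurable borel"
        using S borel_measurable_drift fhat_x[OF Y] by auto
      have "ennreal (2 * (\<rho> ^ CARD('n) * b\<^sup>2 / 4)) = ennreal (b\<^sup>2 / 2) * emeasure lborel (core z)"
        using \<rho> by (simp add: emeasure_core mult.commute flip: ennreal_mult)
      also have "\<dots> = (\<integral>\<^sup>+ x. ennreal (b\<^sup>2 / 2) * indicator (core z) x \<partial>lborel)"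
        by (simp add: nn_integral_cmult_indicator)
      also have "\<dots> \<le> (\<integral>\<^sup>+ x. ennreal ((norm (?g x - drift S x))\<^sup>2) * indicator (core z) x
          + ennreal ((norm (?g x - drift (insert z S) x))\<^sup>2) * indicator (core z) x \<partial>lborel)"
      proof (rule nn_integral_mono)
        fix x
        show "ennreal (b\<^sup>2 / 2) * indicator (core z) x
          \<le> ennreal ((norm (?g x - drift S x))\<^sup>2) * indicator (core z) x
            + ennreal ((norm (?g x - drift (insert z S) x))\<^sup>2) * indicator (core z) x"
        proof (cases "x \<in> core z")
          case True
          then have "b \<le> norm (drift S x - drift (insert z S) x)"
            unfolding norm_drift_insert[OF S] b_def using A_pos \<rho>
            by (intro mult_left_mono bump_at_lower) (auto simp: mem_core)
          then have "b\<^sup>2 / 2 \<le> (norm (drift S x - drift (insert z S) x))\<^sup>2 / 2"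
            using b by (intro divide_right_mono power_mono) auto
          also have "\<dots> \<le> (norm (?g x - drift S x))\<^sup>2 + (norm (?g x - drift (insert z S) x))\<^sup>2"
            by (rule power2_norm_triangle)
          finally show ?thesis using True by (simp add: ennreal_leI flip: ennreal_plus)
        qed simp
      qed
      also have "\<dots> = core_loss z ?g (drift S) + core_loss z ?g (drift (insert z S))"
        unfolding core_loss_def by (rule nn_integral_add) measurable
      finally show "ennreal (2 * (\<rho> ^ CARD('n) * b\<^sup>2 / 4))
        \<le> core_loss z ?g (drift S) + core_loss z ?g (drift (insert z S))" .
    qed (use S noise(3) \<rho> in auto)
    then show ?thesis by (simp add: Q_def)
  qed
  text \<open>Assouad: group the subsets of \<open>K\<close> into pairs that differ only in the membership of \<open>z\<close>.\<close>
  have "ennreal (2 ^ (card K - 1) * Q) \<le> (\<Sum>S\<in>Pow K. r z S)" if z: "z \<in> K" for z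
  proof -
    let ?K = "K - {z}"
    have fin: "finite ?K" using K_finite by simp
    have "ennreal (2 ^ (card K - 1) * Q) = (\<Sum>S\<in>Pow ?K. ennreal Q)"
      using z K_finite Q by (simp add: card_Pow ennreal_mult ennreal_power flip: ennreal_numeral)
    also have "\<dots> \<le> (\<Sum>S\<in>Pow ?K. r z S + r z (insert z S))"
      using z by (intro sum_mono pair) auto
    also have "\<dots> = (\<Sum>S\<in>Pow ?K. r z S) + (\<Sum>S\<in>insert z ` Pow ?K. r z S)"
    proof -
      have "inj_on (insert z) (Pow ?K)" by (auto simp: inj_on_def)
      then show ?thesis by (simp add: sum.distrib sum.reindex)
    qed
    also have "\<dots> = (\<Sum>S\<in>Pow ?K \<union> insert z ` Pow ?K. r z S)"
      using fin by (intro sum.union_disjoint[symmetric]) auto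
    also have "Pow ?K \<union> insert z ` Pow ?K = Pow K"
      using z by (simp add: insert_absorb flip: Pow_insert)
    finally show ?thesis .
  qed
  then have "(\<Sum>z\<in>K. ennreal (2 ^ (card K - 1) * Q)) \<le> (\<Sum>z\<in>K. \<Sum>S\<in>Pow K. r z S)"
    by (rule sum_mono)
  also have "\<dots> = (\<Sum>S\<in>Pow K. \<Sum>z\<in>K. r z S)" by (rule sum.swap)
  also have "\<dots> \<le> (\<Sum>S\<in>Pow K. ?R)" using r_sum by (intro sum_mono) auto
  finally have main: "of_nat (card K) * ennreal (2 ^ (card K - 1) * Q) \<le> of_nat (2 ^ card K) * ?R"
    using K_finite by (simp add: card_Pow)
  have "ennreal (real (card K) * Q / 2) \<le> ?R"
  \<comment> \<open>For empty \<open>K\<close> the truncated exponent \<open>card K - 1\<close>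
    would break the doubling identity \<open>pow\<close>, but then the bound is zero.\<close>
  proof (cases "card K = 0")
    case False
    have pow: "(2::real) ^ card K = 2 * 2 ^ (card K - 1)"
      using False by (metis power_eq_if)
    show ?thesis
    proof (cases ?R)
      case (real t)
      have "ennreal (real (card K) * (2 ^ (card K - 1) * Q)) \<le> ennreal (2 ^ card K * t)"
        using main Q real by (simp add: ennreal_of_nat_eq_real_of_nat ennreal_mult)
      then have "real (card K) * (2 ^ (card K - 1) * Q) \<le> 2 ^ card K * t"
        using real by (simp add: ennreal_le_iff)
      then have "2 ^ (card K - 1) * (real (card K) * Q) \<le> 2 ^ (card K - 1) * (2 * t)"
        unfolding pow by (simp add: mult_ac)
      then have "real (card K) * Q \<le> 2 * t"
        by (rule mult_left_le_imp_le) simp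
      then show ?thesis unfolding real(2) by (intro ennreal_leI) simp
    next
      case top
      then show ?thesis by (simp only: top_greatest)
    qed
  qed simp
  then show "ennreal (real (card K) * \<rho> ^ CARD('n) * (A * ((3 / 4) ^ m) ^ CARD('n))\<^sup>2 / (16 * exp 4)) \<le> ?R"
    by (simp add: Q_def b_def mult_ac)
qed

end

section \<open>Grids of starting points\<close>

text \<open>The index range reaches every point within distance 2 of \<open>c\<close> in each
  coordinate. The offset \<open>c\<close> allows the grid to be moved relative to a prescribed
  point.\<close>

definition grid :: "('n::finite \<Rightarrow> real) \<Rightarrow> ('n \<Rightarrow> real) \<Rightarrow> (real^'n) set" where
  "grid s c = (\<lambda>k. \<chi> j. c j + s j * real_of_int (k j)) ` (\<Pi>\<^sub>E j\<in>UNIV. {- \<lceil>2 / s j\<rceil>..\<lceil>2 / s j\<rceil>})"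

lemma finite_grid: "finite (grid s c)"
  unfolding grid_def by (intro finite_imageI finite_PiE) auto

lemma card_grid_le:
  fixes s :: "'n::finite \<Rightarrow> real"
  assumes "\<And>j. 0 < s j" "\<And>j. s j \<le> 1"
  shows "real (card (grid s c)) \<le> (\<Prod>j\<in>UNIV. 7 / s j)"
proof -
  have "card (grid s c) \<le> card (\<Pi>\<^sub>E j\<in>UNIV. {- \<lceil>2 / s j\<rceil>..\<lceil>2 / s j\<rceil>})"
    unfolding grid_def by (intro card_image_le finite_PiE) auto
  also have "\<dots> = (\<Prod>j\<in>UNIV. card {- \<lceil>2 / s j\<rceil>..\<lceil>2 / s j\<rceil>})"
    by (simp add: card_PiE)
  finally have "real (card (grid s c)) \<le> (\<Prod>j\<in>UNIV. real (card {- \<lceil>2 / s j\<rceil>..\<lceil>2 / s j\<rceil>}))"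
    by (metis of_nat_le_iff of_nat_prod)
  also have "\<dots> \<le> (\<Prod>j\<in>UNIV. 7 / s j)"
  proof (intro prod_mono conjI)
    fix j
    \<comment> \<open>The count is at most 2 (2 y + 1) + 1 = 4 y + 3, whence the 7.\<close>
    have "real (card {- \<lceil>2 * y\<rceil>..\<lceil>2 * y\<rceil>}) \<le> 7 * y" if "1 \<le> y" for y :: real
    proof -
      have "0 \<le> \<lceil>2 * y\<rceil>" "real_of_int \<lceil>2 * y\<rceil> \<le> 2 * y + 1" using that by linarith+
      moreover from this have "real (card {- \<lceil>2 * y\<rceil>..\<lceil>2 * y\<rceil>}) = 2 * real_of_int \<lceil>2 * y\<rceil> + 1" by simp
      ultimately show ?thesis using that by linarith
    qed
    from this[of "1 / s j"] show "real (card {- \<lceil>2 / s j\<rceil>..\<lceil>2 / s j\<rceil>}) \<le> 7 / s j"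
      using assms[of j] by simp
  qed simp
  finally show ?thesis .
qed

lemma grid_covers:
  fixes s :: "'n::finite \<Rightarrow> real"
  assumes s: "\<And>j. 0 < s j" and z: "\<And>j. \<bar>z $ j - c j\<bar> \<le> 2"
  obtains x where "x \<in> grid s c" "\<And>j. 0 \<le> z $ j - x $ j" "\<And>j. z $ j - x $ j \<le> s j"
proof
  define k where "k j = \<lfloor>(z $ j - c j) / s j\<rfloor>" for j
  have k: "real_of_int (k j) \<le> (z $ j - c j) / s j" "(z $ j - c j) / s j < real_of_int (k j) + 1" for j
    unfolding k_def by linarith+
  have k': "s j * real_of_int (k j) \<le> z $ j - c j" "z $ j - c j < s j * real_of_int (k j) + s j" for j
    using k[of j] s[of j] by (simp_all add: field_simps)
  have "\<bar>k j\<bar> \<le> \<lceil>2 / s j\<rceil>" for j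
  proof -
    have "\<bar>(z $ j - c j) / s j\<bar> \<le> 2 / s j"
      using z[of j] s[of j] by (simp add: abs_divide divide_right_mono)
    then have "real_of_int \<bar>k j\<bar> < 2 / s j + 1"
      using k[of j] by linarith
    then show ?thesis by linarith
  qed
  then have "k \<in> (\<Pi>\<^sub>E j\<in>UNIV. {- \<lceil>2 / s j\<rceil>..\<lceil>2 / s j\<rceil>})"
    by (auto simp: abs_le_iff PiE_def minus_le_iff)
  then show "(\<chi> j. c j + s j * real_of_int (k j)) \<in> grid s c"
    unfolding grid_def by blast
  show "0 \<le> z $ j - (\<chi> j. c j + s j * real_of_int (k j)) $ j"
    "z $ j - (\<chi> j. c j + s j * real_of_int (k j)) $ j \<le> s j" for j
    using k'[of j] by auto
qed

lemma card_int_between: 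
  fixes l u :: real
  assumes "l \<le> u"
  shows "finite {k::int. l < k \<and> k < u}" "real (card {k::int. l < k \<and> k < u}) \<le> u - l + 1"
proof -
  have sub: "{k::int. l < k \<and> k < u} \<subseteq> {\<lfloor>l\<rfloor> + 1..\<lceil>u\<rceil> - 1}" by (auto; linarith)
  then show "finite {k::int. l < k \<and> k < u}" by (rule finite_subset) simp
  have "real (card {k::int. l < k \<and> k < u}) \<le> real (card {\<lfloor>l\<rfloor> + 1..\<lceil>u\<rceil> - 1})"
    using card_mono[OF _ sub] by simp
  also have "\<dots> = max 0 (real_of_int \<lceil>u\<rceil> - 1 - real_of_int \<lfloor>l\<rfloor>)" by simp
  also have "\<dots> \<le> u - l + 1"
  proof -
    have "real_of_int \<lceil>u\<rceil> \<le> u + 1" "l - 1 \<le> real_of_int \<lfloor>l\<rfloor>" by linarith+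
    then show ?thesis using assms by (intro max.boundedI) linarith+
  qed
  finally show "real (card {k::int. l < k \<and> k < u}) \<le> u - l + 1" .
qed

lemma card_grid_box_le:
  fixes s :: "'n::finite \<Rightarrow> real"
  assumes s: "\<And>j. 0 < s j" and lu: "\<And>j. l j \<le> u j"
  shows "real (card {x\<in>grid s c. \<forall>j. l j < x $ j \<and> x $ j < u j}) \<le> (\<Prod>j\<in>UNIV. (u j - l j) / s j + 1)"
proof -
  let ?I = "\<lambda>j. {k::int. (l j - c j) / s j < k \<and> k < (u j - c j) / s j}"
  have le: "(l j - c j) / s j \<le> (u j - c j) / s j" for j
    using s[of j] lu[of j] by (simp add: divide_right_mono)
  have fin: "finite (\<Pi>\<^sub>E j\<in>UNIV. ?I j)"
    using card_int_between(1)[OF le] by (intro finite_PiE) auto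
  have "{x\<in>grid s c. \<forall>j. l j < x $ j \<and> x $ j < u j}
      \<subseteq> (\<lambda>k. \<chi> j. c j + s j * real_of_int (k j)) ` (\<Pi>\<^sub>E j\<in>UNIV. ?I j)"
  proof
    fix x assume x: "x \<in> {x\<in>grid s c. \<forall>j. l j < x $ j \<and> x $ j < u j}"
    then obtain k where k: "x = (\<chi> j. c j + s j * real_of_int (k j))"
      by (auto simp: grid_def)
    have "l j < c j + s j * real_of_int (k j)" "c j + s j * real_of_int (k j) < u j" for j
      using x k by auto
    then have "l j - c j < real_of_int (k j) * s j" "real_of_int (k j) * s j < u j - c j" for j
      by (simp_all add: algebra_simps)
    then have "k j \<in> ?I j" for j
      using s[of j] by (simp add: pos_divide_less_eq pos_less_divide_eq)
    then show "x \<in> (\<lambda>k. \<chi> j. c j + s j * real_of_int (k j)) ` (\<Pi>\<^sub>E j\<in>UNIV. ?I j)"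
      unfolding k by (intro imageI) auto
  qed
  then have "card {x\<in>grid s c. \<forall>j. l j < x $ j \<and> x $ j < u j} \<le> card (\<Pi>\<^sub>E j\<in>UNIV. ?I j)"
    by (rule surj_card_le[OF fin])
  also have "\<dots> = (\<Prod>j\<in>UNIV. card (?I j))"
    by (simp add: card_PiE)
  finally have "real (card {x\<in>grid s c. \<forall>j. l j < x $ j \<and> x $ j < u j}) \<le> real (\<Prod>j\<in>UNIV. card (?I j))"
    by (rule of_nat_mono)
  also have "\<dots> = (\<Prod>j\<in>UNIV. real (card (?I j)))" by (rule of_nat_prod)
  also have "\<dots> \<le> (\<Prod>j\<in>UNIV. (u j - l j) / s j + 1)"
  proof (intro prod_mono conjI)
    fix j
    show "real (card (?I j)) \<le> (u j - l j) / s j + 1"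
      using card_int_between(2)[OF le[of j]] by (simp add: diff_divide_distrib)
  qed simp
  finally show ?thesis .
qed

lemma prod_if_eq:
  fixes i :: "'n::finite" and x y :: real
  shows "(\<Prod>j\<in>UNIV. if j = i then x else y) = x * y ^ (CARD('n) - 1)"
  by (subst prod.remove[of _ i]) (simp_all add: card_Diff_singleton)

section \<open>Lattices of bump centres\<close>

definition lattice :: "real \<Rightarrow> (real^'n::finite) set" where
  "lattice \<sigma> = (\<lambda>k. \<chi> j. \<sigma> * (real (k j) + 1 / 2)) ` (\<Pi>\<^sub>E j\<in>UNIV. {..<nat \<lfloor>1 / \<sigma>\<rfloor>})"

text \<open>A single row on an edge of the cube. For the supremum loss only the centres need to lie
  in the cube, and the logarithm of about 1 / \<sigma> hypotheses is already of order ln N.\<close>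

definition lattice_row :: "'n \<Rightarrow> real \<Rightarrow> (real^'n::finite) set" where
  "lattice_row i \<sigma> = (\<lambda>k. \<chi> j. if j = i then \<sigma> * (real k + 1 / 2) else 0) ` {..<nat \<lfloor>1 / \<sigma>\<rfloor>}"

lemma lattice_index_bounds:
  assumes "0 < \<sigma>" "k < nat \<lfloor>1 / \<sigma>\<rfloor>"
  shows "\<sigma> / 2 \<le> \<sigma> * (real k + 1 / 2)" "\<sigma> * (real k + 1 / 2) \<le> 1 - \<sigma> / 2"
proof -
  show "\<sigma> / 2 \<le> \<sigma> * (real k + 1 / 2)" using assms by (simp add: field_simps)
  have "real k + 1 \<le> 1 / \<sigma>" using assms(2) by linarith
  then have "\<sigma> * (real k + 1) \<le> 1" using assms(1) by (simp add: field_simps)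
  then show "\<sigma> * (real k + 1 / 2) \<le> 1 - \<sigma> / 2" by (simp add: algebra_simps)
qed

lemma lattice_index_gap:
  assumes "0 < \<sigma>" "k \<noteq> k'"
  shows "\<sigma> \<le> \<bar>\<sigma> * (real k + 1 / 2) - \<sigma> * (real k' + 1 / 2)\<bar>"
proof -
  have "1 \<le> \<bar>real k - real k'\<bar>" using assms(2) by linarith
  then have "\<sigma> * 1 \<le> \<sigma> * \<bar>real k - real k'\<bar>" using assms(1) by (intro mult_left_mono) auto
  also have "\<dots> = \<bar>\<sigma> * (real k - real k')\<bar>" using assms(1) by (simp add: abs_mult)
  finally show ?thesis by (simp add: algebra_simps)
qed

lemma lattice_size:
  assumes "0 < \<sigma>" "\<sigma> \<le> 1 / 2"
  shows "1 / (2 * \<sigma>) \<le> real (nat \<lfloor>1 / \<sigma>\<rfloor>)"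
proof -
  have "2 \<le> 1 / \<sigma>" using assms by (simp add: field_simps)
  moreover have "y / 2 \<le> real (nat \<lfloor>y\<rfloor>)" if "2 \<le> y" for y :: real
    using that by linarith
  ultimately have "1 / \<sigma> / 2 \<le> real (nat \<lfloor>1 / \<sigma>\<rfloor>)" by blast
  then show ?thesis by (simp add: mult.commute)
qed

lemma finite_lattice: "finite (lattice \<sigma>)"
  unfolding lattice_def by (intro finite_imageI finite_PiE) auto

lemma lattice_bounds:
  assumes "0 < \<sigma>" "z \<in> lattice \<sigma>"
  shows "\<sigma> / 2 \<le> z $ j" "z $ j \<le> 1 - \<sigma> / 2"
  using assms lattice_index_bounds[OF assms(1)] by (auto simp: lattice_def PiE_def Pi_def)

lemma separated_lattice:
  assumes "0 < \<sigma>"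
  shows "separated (\<sigma> / 2) (lattice \<sigma>)"
  unfolding separated_def
proof (intro ballI impI)
  fix z z' :: "real^'n" assume z: "z \<in> lattice \<sigma>" "z' \<in> lattice \<sigma>" "z \<noteq> z'"
  then obtain k k' where k: "z = (\<chi> j. \<sigma> * (real (k j) + 1 / 2))" "z' = (\<chi> j. \<sigma> * (real (k' j) + 1 / 2))"
    by (auto simp: lattice_def)
  then have "k \<noteq> k'" using z(3) by blast
  then obtain j where "k j \<noteq> k' j" by blast
  then show "\<exists>j. 2 * (\<sigma> / 2) \<le> \<bar>z $ j - z' $ j\<bar>"
    using lattice_index_gap[OF assms] by (intro exI[of _ j]) (simp add: k)
qed

lemma card_lattice:
  assumes "0 < \<sigma>"
  shows "card (lattice \<sigma> :: (real^'n::finite) set) = nat \<lfloor>1 / \<sigma>\<rfloor> ^ CARD('n)"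
proof -
  have "inj_on (\<lambda>k. \<chi> j. \<sigma> * (real (k j) + 1 / 2)) (\<Pi>\<^sub>E j\<in>(UNIV::'n set). {..<nat \<lfloor>1 / \<sigma>\<rfloor>})"
    using assms by (auto simp: inj_on_def vec_eq_iff fun_eq_iff)
  then show ?thesis unfolding lattice_def by (simp add: card_image card_PiE)
qed

lemma lattice_row_bounds:
  assumes "0 < \<sigma>" "z \<in> lattice_row i \<sigma>"
  shows "0 \<le> z $ j" "z $ j \<le> 1 - (if j = i then \<sigma> / 2 else 0)"
  using assms lattice_index_bounds[OF assms(1)] by (fastforce simp: lattice_row_def)+

lemma finite_lattice_row: "finite (lattice_row i \<sigma>)"
  by (simp add: lattice_row_def)

lemma separated_lattice_row:
  fixes i :: "'n::finite"
  assumes "0 < \<sigma>"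
  shows "separated (\<sigma> / 2) (lattice_row i \<sigma>)"
  unfolding separated_def
proof (intro ballI impI)
  fix z z' :: "real^'n" assume z: "z \<in> lattice_row i \<sigma>" "z' \<in> lattice_row i \<sigma>" "z \<noteq> z'"
  then obtain k k' where k: "z = (\<chi> j. if j = i then \<sigma> * (real k + 1 / 2) else 0)"
      "z' = (\<chi> j. if j = i then \<sigma> * (real k' + 1 / 2) else 0)"
    by (auto simp: lattice_row_def)
  then have "k \<noteq> k'" using z(3) by auto
  then show "\<exists>j. 2 * (\<sigma> / 2) \<le> \<bar>z $ j - z' $ j\<bar>"
    using lattice_index_gap[OF assms] by (intro exI[of _ i]) (simp add: k)
qed

lemma card_lattice_row:
  assumes "0 < \<sigma>"
  shows "card (lattice_row i \<sigma>) = nat \<lfloor>1 / \<sigma>\<rfloor>"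
proof -
  have "inj_on (\<lambda>k. \<chi> j. if j = i then \<sigma> * (real k + 1 / 2) else 0) {..<nat \<lfloor>1 / \<sigma>\<rfloor>}"
  proof (rule inj_onI)
    fix k k' assume "(\<chi> j. if j = i then \<sigma> * (real k + 1 / 2) else 0)
      = (\<chi> j. if j = i then \<sigma> * (real k' + 1 / 2) else 0)"
    then have "(\<chi> j. if j = i then \<sigma> * (real k + 1 / 2) else 0) $ i
      = (\<chi> j. if j = i then \<sigma> * (real k' + 1 / 2) else 0) $ i" by (rule arg_cong)
    then show "k = k'" using assms by simp
  qed
  then show ?thesis unfolding lattice_row_def by (simp add: card_image)
qed

lemma separated_antimono: "separated \<rho> S \<Longrightarrow> \<rho>' \<le> \<rho> \<Longrightarrow> separated \<rho>' S"
  unfolding separated_def by (meson dual_order.trans mult_left_mono zero_le_numeral)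

section \<open>Lower bounds at a given bump width\<close>

text \<open>The integral \<open>nn_integral\<close> is monotone for arbitrary integrands, so the
  supremum loss can be compared with a pointwise one.\<close>

lemma minimax_risk_mono:
  fixes loss loss' :: "(real^'n::finite \<Rightarrow> real^'n) \<Rightarrow> (real^'n \<Rightarrow> real^'n) \<Rightarrow> ennreal"
  assumes "\<And>g f. loss g f \<le> loss' g f"
  shows "minimax_risk \<Theta> P D loss \<le> minimax_risk \<Theta> P D loss'"
  unfolding minimax_risk_def
proof (rule INF_mono)
  fix fhat :: "'n estimator" assume "fhat \<in> estimators D"
  moreover have "risk P D loss fhat \<theta> \<le> risk P D loss' fhat \<theta>" for \<theta>
    unfolding risk_def by (cases \<theta>) (auto intro!: nn_integral_mono assms)
  ultimately show "\<exists>g\<in>estimators D. (SUP \<theta>\<in>\<Theta>. risk P D loss g \<theta>) \<le> (SUP \<theta>\<in>\<Theta>. risk P D loss' fhat \<theta>)"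
    by (intro bexI[of _ fhat] SUP_mono) auto
qed

text \<open>One constant for all three losses, dictated by the integrated one: (1/8)^d is the share
  of the cube filled by cores, the square comes from the bump's minimum on a core.\<close>

definition loss_const :: "nat \<Rightarrow> nat \<Rightarrow> real" where
  "loss_const d m = (1 / 8) ^ d * (((3 / 4) ^ m) ^ d)\<^sup>2 / (16 * exp 4)"

lemma loss_const_pos: "0 < loss_const d m"
  by (simp add: loss_const_def)

lemma loss_const_le: "loss_const d m \<le> 1 / (16 * exp 4)" "loss_const d m \<le> 1 / 16"
proof -
  have "(1 / 8 :: real) ^ d * (((3 / 4) ^ m) ^ d)\<^sup>2 \<le> 1 * 1"
    by (intro mult_mono power_le_one) auto
  then show 1: "loss_const d m \<le> 1 / (16 * exp 4)"
    unfolding loss_const_def by (intro divide_right_mono) auto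
  have "1 / (16 * exp 4) \<le> (1 / 16 :: real)" by (intro divide_left_mono) auto
  with 1 show "loss_const d m \<le> 1 / 16" by linarith
qed

text \<open>Everything that does not depend on the bump width. The second direction
  \<open>i'\<close> provides room between trajectories. \<open>time\<close> and \<open>count\<close>
  guarantee a cover by pieces of any length h \<le> 1 with T \<le> h n: the total time of such a
  cover does not depend on h.\<close>

locale snake_setting =
  fixes \<beta> :: real and L :: "nat \<Rightarrow> real" and L\<beta> Cnoise Ccvrtm :: real and n :: nat
    and \<delta> Tsum :: real and P :: "(real^'n::finite) measure" and D :: design
    and i i' :: 'n and m :: nat and a v :: real
  assumes \<beta>: "1 \<le> \<beta>" and m_def: "m = smoothness_order \<beta> + 2"
    and L_pos: "\<And>k. k \<le> smoothness_order \<beta> \<Longrightarrow> 0 < L k" and L\<beta>_pos: "0 < L\<beta>"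
    and L_0: "v + a * bump_bound CARD('n) m \<le> L 0"
    and L_k: "\<And>k. 0 < k \<Longrightarrow> k \<le> smoothness_order \<beta> \<Longrightarrow> a * bump_bound CARD('n) m \<le> L k"
    and L_\<beta>: "4 * a * bump_bound CARD('n) m \<le> L\<beta>"
    and a: "0 < a" "a \<le> v" and \<delta>: "0 < \<delta>" "\<delta> \<le> 1"
    and noise: "centered_noise P" "noise_condition Cnoise P" "0 < Cnoise" and Ccvrtm: "0 < Ccvrtm"
    and design: "\<And>f xs Ts. (f :: real^'n \<Rightarrow> real^'n, xs, Ts) \<in> snake_model \<beta> L L\<beta> \<delta> Tsum n \<Longrightarrow>
       valid_times n Ts (D Ts) \<and> cover_time Ccvrtm n Tsum Ts (D Ts)"
    and i': "i' \<noteq> i"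
    and T: "0 < Tsum" "Tsum \<le> real n"
    and time: "7 ^ CARD('n) * real CARD('n) ^ (CARD('n) - 1) / (v * \<delta> ^ (CARD('n) - 1)) < Tsum"
    and count: "7 ^ CARD('n) * real CARD('n) ^ (CARD('n) - 1) * (real n / (\<delta> ^ (CARD('n) - 1) * Tsum)) + 1 \<le> real n"
begin

abbreviation "model \<equiv> snake_model \<beta> L L\<beta> \<delta> Tsum n :: 'n snake set"

text \<open>Across the direction of motion the mesh is \<delta> / d, so that the coordinate gaps add
  up to at most \<delta> in l1 norm, as \<open>tube_covers\<close> expects.\<close>

definition spacing :: "real \<Rightarrow> 'n \<Rightarrow> real" where
  "spacing h j = (if j = i then h else \<delta> / real CARD('n))"

lemma v_pos: "0 < v"
  using a by simp

lemma d_ge_2: "2 \<le> CARD('n)"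
proof -
  have "card {i, i'} \<le> CARD('n)" by (intro card_mono) auto
  then show ?thesis using i' by simp
qed

lemma spacing_bounds:
  assumes "0 < h" "h \<le> 1"
  shows "0 < spacing h j" "spacing h j \<le> 1"
proof -
  have "\<delta> / real CARD('n) \<le> 1 / 1" using \<delta> d_ge_2 by (intro frac_le) auto
  then show "0 < spacing h j" "spacing h j \<le> 1"
    using assms \<delta> d_ge_2 by (auto simp: spacing_def)
qed

lemma card_starts_le:
  assumes "0 < h" "h \<le> 1"
  shows "real (card (grid (spacing h) c)) \<le> 7 ^ CARD('n) * real CARD('n) ^ (CARD('n) - 1) / (h * \<delta> ^ (CARD('n) - 1))"
proof -
  have "real (card (grid (spacing h) c)) \<le> (\<Prod>j\<in>UNIV. 7 / spacing h j)"
    using spacing_bounds[OF assms] by (intro card_grid_le) auto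
  also have "\<dots> = (\<Prod>j\<in>UNIV. if j = i then 7 / h else 7 / (\<delta> / real CARD('n)))"
    by (intro prod.cong) (auto simp: spacing_def)
  also have "\<dots> = 7 / h * (7 / (\<delta> / real CARD('n))) ^ (CARD('n) - 1)"
    by (rule prod_if_eq)
  also have "\<dots> = (7 * 7 ^ (CARD('n) - 1)) * real CARD('n) ^ (CARD('n) - 1) / (h * \<delta> ^ (CARD('n) - 1))"
    by (simp add: power_mult_distrib power_divide)
  also have "(7::real) * 7 ^ (CARD('n) - 1) = 7 ^ CARD('n)"
    using d_ge_2 by (simp flip: power_Suc)
  finally show ?thesis .
qed

lemma family:
  assumes h: "0 < h" "h \<le> 1" "Tsum \<le> h * real n" and c: "\<And>j. \<bar>c j\<bar> \<le> 1" and \<rho>: "0 < \<rho>" "\<rho> \<le> 1"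
    and K: "finite K" "separated \<rho> K" "\<And>z. z \<in> K \<Longrightarrow> z $ i \<le> 1"
    and \<kappa>: "\<And>z. z \<in> K \<Longrightarrow>
      real (card {x\<in>grid (spacing h) c. \<exists>s\<in>{0..2 * h}. \<forall>j. \<bar>(x + s *\<^sub>R axis i 1) $ j - z $ j\<bar> < \<rho>})
        * ((1 + Ccvrtm / v) * (h * (real n / Tsum)) * (Cnoise * (a * \<rho> powr \<beta> * (h / v))\<^sup>2)) \<le> \<kappa>"
  shows "snake_family \<beta> L L\<beta> Cnoise Ccvrtm n \<delta> Tsum P D i m \<rho> a v h \<kappa> (grid (spacing h) c) K"
proof
  let ?X = "grid (spacing h) c"
  let ?Z = "7 ^ CARD('n) * real CARD('n) ^ (CARD('n) - 1) :: real"
  have Z: "0 < ?Z" using d_ge_2 by simp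
  have dp: "0 < \<delta> ^ (CARD('n) - 1)" using \<delta> by simp
  have card: "real (card ?X) \<le> ?Z / (h * \<delta> ^ (CARD('n) - 1))" by (rule card_starts_le[OF h(1,2)])
  show "card ?X + 1 \<le> n"
  proof -
    have "1 / h \<le> real n / Tsum" using h T by (simp add: field_simps)
    then have "?Z / \<delta> ^ (CARD('n) - 1) * (1 / h) \<le> ?Z / \<delta> ^ (CARD('n) - 1) * (real n / Tsum)"
      using Z dp by (intro mult_left_mono) auto
    then have "?Z / (h * \<delta> ^ (CARD('n) - 1)) \<le> ?Z * (real n / (\<delta> ^ (CARD('n) - 1) * Tsum))"
      by (simp add: mult.commute)
    then have "real (card ?X) + 1 \<le> real n" using card count by linarith
    then show ?thesis by linarith
  qed
  show "real (card ?X) * (h / v) < Tsum"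
  proof -
    have "real (card ?X) * (h / v) \<le> ?Z / (h * \<delta> ^ (CARD('n) - 1)) * (h / v)"
      using card h v_pos by (intro mult_right_mono) auto
    also have "\<dots> = ?Z / (v * \<delta> ^ (CARD('n) - 1))" using h by simp
    finally show ?thesis using time by linarith
  qed
  show "\<exists>x\<in>?X. 0 \<le> z $ i - x $ i \<and> z $ i - x $ i \<le> h \<and> (\<Sum>j\<in>UNIV - {i}. \<bar>z $ j - x $ j\<bar>) \<le> \<delta>"
    if z: "z \<in> unit_cube" for z
  proof -
    have "\<bar>z $ j - c j\<bar> \<le> 2" for j
    proof -
      have "0 \<le> z $ j" "z $ j \<le> 1" using z by (auto simp: unit_cube_def)
      then show ?thesis using c[of j] by linarith
    qed
    then obtain x where x: "x \<in> ?X" "\<And>j. 0 \<le> z $ j - x $ j" "\<And>j. z $ j - x $ j \<le> spacing h j"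
      using grid_covers[of "spacing h" z c] spacing_bounds[OF h(1,2)] by metis
    have "(\<Sum>j\<in>UNIV - {i}. \<bar>z $ j - x $ j\<bar>) \<le> (\<Sum>j\<in>UNIV - {i}. \<delta> / real CARD('n))"
    proof (rule sum_mono)
      fix j assume "j \<in> UNIV - {i}"
      then show "\<bar>z $ j - x $ j\<bar> \<le> \<delta> / real CARD('n)"
        using x(2,3)[of j] by (simp add: spacing_def)
    qed
    also have "\<dots> \<le> real CARD('n) * (\<delta> / real CARD('n))"
    proof -
      have "card (UNIV - {i}) \<le> CARD('n)" by (intro card_mono) auto
      then show ?thesis using \<delta> unfolding sum_constant by (intro mult_right_mono) auto
    qed
    also have "\<dots> = \<delta>" using d_ge_2 by simp
    finally show ?thesis using x(1,2) x(3)[of i] by (intro bexI[of _ x]) (auto simp: spacing_def)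
  qed
  show "z $ i + \<rho> \<le> 10" if "z \<in> K" for z
    using K(3)[OF that] \<rho> by simp
  show "real (card {x\<in>?X. \<exists>s\<in>{0..2 * h}. \<forall>j. \<bar>(x + s *\<^sub>R axis i 1) $ j - z $ j\<bar> < \<rho>})
        * (max 1 (Ccvrtm * (h / v) * (real n / Tsum)) * (Cnoise * (a * \<rho> powr \<beta> * (h / v))\<^sup>2)) \<le> \<kappa>"
    if "z \<in> K" for z
  proof -
    \<comment> \<open>Since T \<le> h n, this is at least 1 and absorbs the \<open>1\<close> of the
      maximum.\<close>
    define y where "y = h * (real n / Tsum)"
    have "1 \<le> y" using h T by (simp add: y_def field_simps)
    moreover have "0 < Ccvrtm / v" using Ccvrtm v_pos by simp
    moreover from this have "0 \<le> Ccvrtm / v * y" using \<open>1 \<le> y\<close> by (intro mult_nonneg_nonneg) auto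
    ultimately have "max 1 (Ccvrtm / v * y) \<le> y + Ccvrtm / v * y"
      by (intro max.boundedI) linarith+
    then have "max 1 (Ccvrtm * (h / v) * (real n / Tsum)) \<le> (1 + Ccvrtm / v) * y"
      unfolding distrib_right by (simp add: y_def)
    then show ?thesis
      using \<kappa>[OF that] noise(3) unfolding y_def
      by (elim order_trans[rotated]) (intro mult_left_mono mult_right_mono, auto)
  qed
qed (use \<beta> m_def L_pos L\<beta>_pos L_0 L_k L_\<beta> a \<delta> noise design h \<rho> K finite_grid in auto)

lemma point_of_family:
  assumes "snake_family \<beta> L L\<beta> Cnoise Ccvrtm n \<delta> Tsum P D i m \<rho> a v h \<kappa> X K" "z \<in> K" "\<kappa> \<le> 1"
  shows "ennreal (loss_const CARD('n) m * (a * \<rho> powr \<beta>)\<^sup>2) \<le> minimax_risk model P D (point_loss z)"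
proof -
  interpret snake_family \<beta> L L\<beta> Cnoise Ccvrtm n \<delta> Tsum P D i m \<rho> a v h \<kappa> X K by fact
  have "loss_const CARD('n) m * A\<^sup>2 \<le> 1 / (16 * exp 4) * A\<^sup>2"
    by (intro mult_right_mono loss_const_le) auto
  then have "ennreal (loss_const CARD('n) m * A\<^sup>2) \<le> ennreal (A\<^sup>2 / (16 * exp 4))"
    by (intro ennreal_leI) simp
  also have "\<dots> \<le> minimax_risk model P D (point_loss z)"
    by (rule minimax_point_loss[OF assms(2,3)])
  finally show ?thesis by (simp add: A_def)
qed

text \<open>The lattice step 4 \<rho> suits both mechanisms: for \<rho> = \<delta> / (4 d) it equals
  the gap between neighbouring trajectories, so every centre sits in the middle of a gap. At least 1
  / (8 \<rho>) centres per axis give the volume share (1/8)^d.\<close>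

lemma L2_of_family:
  assumes "snake_family \<beta> L L\<beta> Cnoise Ccvrtm n \<delta> Tsum P D i m \<rho> a v h \<kappa> X (lattice (4 * \<rho>))"
    and "\<rho> \<le> 1 / 8" "\<kappa> \<le> 1"
  shows "ennreal (loss_const CARD('n) m * (a * \<rho> powr \<beta>)\<^sup>2) \<le> minimax_risk model P D L2_loss"
proof -
  interpret snake_family \<beta> L L\<beta> Cnoise Ccvrtm n \<delta> Tsum P D i m \<rho> a v h \<kappa> X "lattice (4 * \<rho>)" by fact
  have \<rho>0: "0 < \<rho>" using \<rho> by simp
  have core: "core z \<subseteq> unit_cube" if z: "z \<in> lattice (4 * \<rho>)" for z
  proof
    fix x assume "x \<in> core z"
    then have "\<bar>x $ j - z $ j\<bar> \<le> \<rho> / 2" for j by (simp add: mem_core)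
    moreover have "4 * \<rho> / 2 \<le> z $ j" "z $ j \<le> 1 - 4 * \<rho> / 2" for j
      using lattice_bounds[OF _ z] \<rho>0 by auto
    ultimately have "0 \<le> x $ j \<and> x $ j \<le> 1" for j
      using \<rho>0 by (smt (verit) field_sum_of_halves)
    then show "x \<in> unit_cube" by (simp add: unit_cube_def)
  qed
  let ?q = "real (nat \<lfloor>1 / (4 * \<rho>)\<rfloor>)"
  have "1 / (2 * (4 * \<rho>)) \<le> ?q" using assms(2) \<rho>0 by (intro lattice_size) auto
  then have "1 / 8 \<le> ?q * \<rho>" using \<rho>0 by (simp add: field_simps)
  then have "(1 / 8) ^ CARD('n) \<le> (?q * \<rho>) ^ CARD('n)" by (intro power_mono) auto
  also have "\<dots> = real (card (lattice (4 * \<rho>) :: (real^'n) set)) * \<rho> ^ CARD('n)"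
    using \<rho>0 by (simp add: card_lattice power_mult_distrib)
  finally have vol: "(1 / 8) ^ CARD('n) \<le> real (card (lattice (4 * \<rho>) :: (real^'n) set)) * \<rho> ^ CARD('n)" .
  have "loss_const CARD('n) m * A\<^sup>2 = (1 / 8) ^ CARD('n) * (A * ((3 / 4) ^ m) ^ CARD('n))\<^sup>2 / (16 * exp 4)"
    by (simp add: loss_const_def power_mult_distrib)
  also have "\<dots> \<le> real (card (lattice (4 * \<rho>) :: (real^'n) set)) * \<rho> ^ CARD('n) * (A * ((3 / 4) ^ m) ^ CARD('n))\<^sup>2 / (16 * exp 4)"
    by (intro divide_right_mono mult_right_mono vol) auto
  finally have "ennreal (loss_const CARD('n) m * A\<^sup>2)
     \<le> ennreal (real (card (lattice (4 * \<rho>) :: (real^'n) set)) * \<rho> ^ CARD('n) * (A * ((3 / 4) ^ m) ^ CARD('n))\<^sup>2 / (16 * exp 4))"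
    by (rule ennreal_leI)
  also have "\<dots> \<le> minimax_risk model P D L2_loss"
    by (rule minimax_L2_loss[OF core assms(3)])
  finally show ?thesis by (simp add: A_def)
qed

lemma sup_of_family:
  assumes "snake_family \<beta> L L\<beta> Cnoise Ccvrtm n \<delta> Tsum P D i m \<rho> a v h \<kappa> X K"
    and "K \<subseteq> unit_cube" "8 \<le> ln (real (card K))" "\<kappa> \<le> ln (real (card K)) / 8"
  shows "ennreal (loss_const CARD('n) m * (a * \<rho> powr \<beta>)\<^sup>2) \<le> minimax_risk model P D sup_loss"
proof -
  interpret snake_family \<beta> L L\<beta> Cnoise Ccvrtm n \<delta> Tsum P D i m \<rho> a v h \<kappa> X K by fact
  have "loss_const CARD('n) m * A\<^sup>2 \<le> 1 / 16 * A\<^sup>2"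
    by (intro mult_right_mono loss_const_le) auto
  then have "ennreal (loss_const CARD('n) m * A\<^sup>2) \<le> ennreal (A\<^sup>2 / 16)"
    by (intro ennreal_leI) simp
  also have "\<dots> \<le> minimax_risk model P D sup_loss"
    by (rule minimax_sup_loss[OF assms(2-4)])
  finally show ?thesis by (simp add: A_def)
qed

text \<open>Bumps that fit between the trajectories are invisible in the observations.\<close>

lemma gap_family:
  assumes c: "\<And>j. \<bar>c j\<bar> \<le> 1"
    and K: "finite K" "separated (\<delta> / (4 * real CARD('n))) K" "\<And>z. z \<in> K \<Longrightarrow> z $ i \<le> 1"
    and gap: "\<And>z. z \<in> K \<Longrightarrow> \<exists>k::int. z $ i' = c i' + \<delta> / real CARD('n) * (of_int k + 1 / 2)"
  shows "snake_family \<beta> L L\<beta> Cnoise Ccvrtm n \<delta> Tsum P D i m (\<delta> / (4 * real CARD('n))) a v 1 0 (grid (spacing 1) c) K"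
proof (rule family[OF _ _ _ c _ _ K])
  let ?\<rho> = "\<delta> / (4 * real CARD('n))"
  show "0 < ?\<rho>" using \<delta> d_ge_2 by simp
  have "\<delta> / (4 * real CARD('n)) \<le> 1 / 1" using \<delta> d_ge_2 by (intro frac_le) auto
  then show "?\<rho> \<le> 1" by simp
  fix z assume "z \<in> K"
  then obtain k :: int where k: "z $ i' = c i' + \<delta> / real CARD('n) * (of_int k + 1 / 2)" using gap by blast
  have empty: "{x\<in>grid (spacing 1) c. \<exists>s\<in>{0..2 * 1}. \<forall>j. \<bar>(x + s *\<^sub>R axis i 1) $ j - z $ j\<bar> < ?\<rho>} = {}"
  proof -
    have False if x: "x \<in> grid (spacing 1) c" and s: "\<forall>j. \<bar>(x + s *\<^sub>R axis i 1) $ j - z $ j\<bar> < ?\<rho>" for x and s :: real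
    proof -
      obtain k' where "x = (\<chi> j. c j + spacing 1 j * of_int (k' j))"
        using x by (auto simp: grid_def)
      then have k': "x $ i' = c i' + \<delta> / real CARD('n) * of_int (k' i')"
        using i' by (simp add: spacing_def)
      have "(x + s *\<^sub>R axis i 1) $ i' = x $ i'" using i' by (simp add: axis_def)
      then have "\<bar>x $ i' - z $ i'\<bar> < ?\<rho>" using s by metis
      moreover have "x $ i' - z $ i' = \<delta> / real CARD('n) * (of_int (k' i') - (of_int k + 1 / 2))"
        by (simp add: k k' algebra_simps)
      \<comment> \<open>An integer is at least 1 / 2 away from a half-integer: in the coordinate
        \<open>i'\<close> trajectory and centre are \<delta> / (2 d) apart, twice the half-width of
        the bump.\<close>
      moreover have "1 / 2 \<le> \<bar>of_int (k' i') - (of_int k + 1 / 2) :: real\<bar>"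
      proof (cases "k' i' \<le> k")
        case True
        then have "of_int (k' i') \<le> (of_int k :: real)" by simp
        then show ?thesis by linarith
      next
        case False
        then have "of_int (k + 1) \<le> (of_int (k' i') :: real)" by (simp only: of_int_le_iff)
        then show ?thesis by simp
      qed
      then have "\<delta> / real CARD('n) * (1 / 2) \<le> \<delta> / real CARD('n) * \<bar>of_int (k' i') - (of_int k + 1 / 2) :: real\<bar>"
        using \<delta> by (intro mult_left_mono) auto
      ultimately have "\<delta> / real CARD('n) * (1 / 2) < \<delta> / (4 * real CARD('n))"
        using \<delta> by (simp add: abs_mult)
      then show False using \<delta> d_ge_2 by (simp add: field_simps)
    qed
    then show ?thesis by blast
  qed
  show "real (card {x\<in>grid (spacing 1) c. \<exists>s\<in>{0..2 * 1}. \<forall>j. \<bar>(x + s *\<^sub>R axis i 1) $ j - z $ j\<bar> < ?\<rho>})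
        * ((1 + Ccvrtm / v) * (1 * (real n / Tsum)) * (Cnoise * (a * ?\<rho> powr \<beta> * (1 / v))\<^sup>2)) \<le> 0"
    by (subst empty) simp
qed (use T in auto)

lemma half_spacing_le: "\<delta> / real CARD('n) / 2 \<le> 1"
proof -
  have "\<delta> / real CARD('n) \<le> 1 / 1" using \<delta> d_ge_2 by (intro frac_le) auto
  then show ?thesis by simp
qed

text \<open>The point is prescribed, so the grid is moved instead: shifted by half a cell, it leaves
  \<open>x0\<close> in the middle of a gap.\<close>

lemma point_gap:
  assumes "x0 \<in> unit_cube"
  shows "ennreal (loss_const CARD('n) m * (a * (\<delta> / (4 * real CARD('n))) powr \<beta>)\<^sup>2) \<le> minimax_risk model P D (point_loss x0)"
proof (rule point_of_family)
  have x0: "0 \<le> x0 $ j" "x0 $ j \<le> 1" for j using assms by (auto simp: unit_cube_def)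
  have "0 \<le> \<delta> / real CARD('n) / 2" using \<delta> by simp
  then have c: "\<bar>x0 $ j - \<delta> / real CARD('n) / 2\<bar> \<le> 1" for j
    using x0[of j] half_spacing_le by linarith
  show "snake_family \<beta> L L\<beta> Cnoise Ccvrtm n \<delta> Tsum P D i m (\<delta> / (4 * real CARD('n))) a v 1 0
      (grid (spacing 1) (\<lambda>j. x0 $ j - \<delta> / real CARD('n) / 2)) {x0}"
    using x0 by (intro gap_family c) (auto simp: separated_def intro!: exI[of _ 0])
qed auto

lemma L2_gap:
  "ennreal (loss_const CARD('n) m * (a * (\<delta> / (4 * real CARD('n))) powr \<beta>)\<^sup>2) \<le> minimax_risk model P D L2_loss"
proof (rule L2_of_family)
  have \<sigma>: "4 * (\<delta> / (4 * real CARD('n))) = \<delta> / real CARD('n)" by simp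
  have \<sigma>0: "0 < \<delta> / real CARD('n)" using \<delta> d_ge_2 by simp
  show "snake_family \<beta> L L\<beta> Cnoise Ccvrtm n \<delta> Tsum P D i m (\<delta> / (4 * real CARD('n))) a v 1 0
      (grid (spacing 1) (\<lambda>j. 0)) (lattice (4 * (\<delta> / (4 * real CARD('n)))))"
    unfolding \<sigma>
  proof (rule gap_family)
    show "separated (\<delta> / (4 * real CARD('n))) (lattice (\<delta> / real CARD('n)) :: (real^'n) set)"
      using \<delta> d_ge_2 by (intro separated_antimono[OF separated_lattice[OF \<sigma>0]]) (simp add: field_simps)
    fix z :: "real^'n" assume z: "z \<in> lattice (\<delta> / real CARD('n))"
    show "z $ i \<le> 1" proof -
      have "0 \<le> \<delta> / real CARD('n) / 2" using \<sigma>0 by simp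
      then show ?thesis using lattice_bounds(2)[OF \<sigma>0 z, of i] by linarith
    qed
    obtain k where "z = (\<chi> j. \<delta> / real CARD('n) * (real (k j) + 1 / 2))"
      using z by (auto simp: lattice_def)
    then have "z $ i' = 0 + \<delta> / real CARD('n) * (of_int (int (k i')) + 1 / 2)" by simp
    then show "\<exists>k::int. z $ i' = 0 + \<delta> / real CARD('n) * (of_int k + 1 / 2)" by blast
  qed (auto simp: finite_lattice)
  have "\<delta> / (4 * real CARD('n)) \<le> 1 / 8" using \<delta> d_ge_2 by (intro frac_le) auto
  then show "\<delta> / (4 * real CARD('n)) \<le> 1 / 8" .
qed auto

text \<open>An upper bound for the information about one bump of width \<open>\<rho> \<ge> \<delta>\<close>.\<close>

definition info :: "real \<Rightarrow> real" where
  "info \<rho> = 5 * (3 * real CARD('n) * \<rho> / \<delta>) ^ (CARD('n) - 1)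
    * ((1 + Ccvrtm / v) * (\<rho> * (real n / Tsum)) * (Cnoise * (a * \<rho> powr \<beta> * (\<rho> / v))\<^sup>2))"

text \<open>The powers of \<rho> are d - 1 for the trajectories hit, 1 for the observations on each,
  2\<beta> for the squared height and 2 for the squared duration.\<close>

lemma info_eq:
  assumes "0 < \<rho>"
  shows "info \<rho> = 5 * (3 * real CARD('n)) ^ (CARD('n) - 1) * (1 + Ccvrtm / v) * Cnoise / v\<^sup>2 * a\<^sup>2
    * (real n / (\<delta> ^ (CARD('n) - 1) * Tsum) * \<rho> powr (2 * (\<beta> + 1) + real CARD('n)))"
proof -
  have "\<rho> powr (2 * (\<beta> + 1) + real CARD('n)) = \<rho> powr (real (CARD('n) - 1) + 1 + (\<beta> + \<beta>) + 2)"
    using d_ge_2 by (simp add: of_nat_diff algebra_simps)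
  also have "\<dots> = \<rho> ^ (CARD('n) - 1) * \<rho> * (\<rho> powr \<beta>)\<^sup>2 * \<rho>\<^sup>2"
    using assms by (simp only: powr_add power2_eq_square powr_realpow powr_one powr_numeral)
  finally show ?thesis
    unfolding info_def by (simp add: power_mult_distrib power_divide mult_ac)
qed

lemma wide_family:
  assumes \<rho>: "0 < \<rho>" "\<rho> \<le> 1" "\<delta> \<le> \<rho>" "Tsum \<le> \<rho> * real n"
    and K: "finite K" "separated \<rho> K" "\<And>z. z \<in> K \<Longrightarrow> z $ i \<le> 1"
  shows "snake_family \<beta> L L\<beta> Cnoise Ccvrtm n \<delta> Tsum P D i m \<rho> a v \<rho> (info \<rho>) (grid (spacing \<rho>) (\<lambda>j. 0)) K"
proof (rule family[OF \<rho>(1,2,4) _ \<rho>(1,2) K])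
  fix z :: "real^'n"
  define l where "l j = z $ j - \<rho> - (if j = i then 2 * \<rho> else 0)" for j
  define u where "u j = z $ j + \<rho>" for j
  let ?X = "grid (spacing \<rho>) (\<lambda>j. 0)"
  let ?S = "{x\<in>?X. \<exists>s\<in>{0..2 * \<rho>}. \<forall>j. \<bar>(x + s *\<^sub>R axis i 1) $ j - z $ j\<bar> < \<rho>}"
  have "?S \<subseteq> {x\<in>?X. \<forall>j. l j < x $ j \<and> x $ j < u j}"
  proof clarify
    fix x :: "real^'n" and s :: real and j
    assume "s \<in> {0..2 * \<rho>}" "\<forall>j. \<bar>(x + s *\<^sub>R axis i 1) $ j - z $ j\<bar> < \<rho>"
    then have "\<bar>(x + s *\<^sub>R axis i 1) $ j - z $ j\<bar> < \<rho>" "0 \<le> s" "s \<le> 2 * \<rho>" by auto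
    then show "l j < x $ j \<and> x $ j < u j"
      by (cases "j = i") (auto simp: l_def u_def axis_def abs_less_iff)
  qed
  then have "card ?S \<le> card {x\<in>?X. \<forall>j. l j < x $ j \<and> x $ j < u j}"
    by (intro card_mono finite_subset[OF _ finite_grid]) auto
  also have "real \<dots> \<le> (\<Prod>j\<in>UNIV. (u j - l j) / spacing \<rho> j + 1)"
    using spacing_bounds[OF \<rho>(1,2)] \<rho> by (intro card_grid_box_le) (auto simp: u_def l_def)
  \<comment> \<open>Starting points of affected trajectories lie in a box of length 4 \<rho> along
    \<open>i\<close>, with step \<rho>, and 2 \<rho> across, with step \<delta> / d. The additional
    1 per coordinate is absorbed across because \<rho> \<ge> \<delta>.\<close>
  also have "\<dots> \<le> (\<Prod>j\<in>UNIV. if j = i then 5 else 3 * real CARD('n) * \<rho> / \<delta>)"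
  proof (intro prod_mono conjI)
    fix j
    show "0 \<le> (u j - l j) / spacing \<rho> j + 1"
      using spacing_bounds[OF \<rho>(1,2), of j] \<rho> by (auto simp: u_def l_def intro!: add_nonneg_nonneg divide_nonneg_nonneg)
    define y where "y = real CARD('n) * (\<rho> / \<delta>)"
    have eq: "3 * real CARD('n) * \<rho> / \<delta> = 3 * y" by (simp add: y_def)
    have "1 * 1 \<le> real CARD('n) * (\<rho> / \<delta>)" using \<rho> \<delta> d_ge_2 by (intro mult_mono) auto
    then have "1 \<le> y" by (simp add: y_def)
    moreover have "(u j - l j) / spacing \<rho> j = (if j = i then 4 else 2 * y)"
      using \<rho> by (auto simp: y_def u_def l_def spacing_def field_simps)
    ultimately show "(u j - l j) / spacing \<rho> j + 1 \<le> (if j = i then 5 else 3 * real CARD('n) * \<rho> / \<delta>)"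
      by (auto simp: eq)
  qed
  also have "\<dots> = 5 * (3 * real CARD('n) * \<rho> / \<delta>) ^ (CARD('n) - 1)" by (rule prod_if_eq)
  finally have "real (card ?S) \<le> 5 * (3 * real CARD('n) * \<rho> / \<delta>) ^ (CARD('n) - 1)" by simp
  then show "real (card ?S) * ((1 + Ccvrtm / v) * (\<rho> * (real n / Tsum)) * (Cnoise * (a * \<rho> powr \<beta> * (\<rho> / v))\<^sup>2)) \<le> info \<rho>"
    unfolding info_def using noise(3) Ccvrtm v_pos \<rho> T
    by (intro mult_right_mono mult_nonneg_nonneg add_nonneg_nonneg) auto
qed auto

lemma point_wide:
  assumes \<rho>: "0 < \<rho>" "\<rho> \<le> 1" "\<delta> \<le> \<rho>" "Tsum \<le> \<rho> * real n" "info \<rho> \<le> 1" and x0: "x0 \<in> unit_cube"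
  shows "ennreal (loss_const CARD('n) m * (a * \<rho> powr \<beta>)\<^sup>2) \<le> minimax_risk model P D (point_loss x0)"
proof (rule point_of_family[OF wide_family[OF \<rho>(1-4)]])
  show "x0 \<in> {x0}" by simp
qed (use x0 \<rho> in \<open>auto simp: unit_cube_def separated_def\<close>)

lemma L2_wide:
  assumes \<rho>: "0 < \<rho>" "\<rho> \<le> 1 / 8" "\<delta> \<le> \<rho>" "Tsum \<le> \<rho> * real n" "info \<rho> \<le> 1"
  shows "ennreal (loss_const CARD('n) m * (a * \<rho> powr \<beta>)\<^sup>2) \<le> minimax_risk model P D L2_loss"
proof (rule L2_of_family[OF wide_family[OF \<rho>(1) _ \<rho>(3,4)]])
  have \<sigma>: "0 < 4 * \<rho>" using \<rho> by simp
  show "separated \<rho> (lattice (4 * \<rho>) :: (real^'n) set)"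
    using \<rho> by (intro separated_antimono[OF separated_lattice[OF \<sigma>]]) auto
  show "z $ i \<le> 1" if "z \<in> lattice (4 * \<rho>)" for z :: "real^'n"
    using lattice_bounds(2)[OF \<sigma> that, of i] \<sigma> by linarith
qed (use \<rho> finite_lattice in auto)

lemma sup_wide:
  assumes \<rho>: "0 < \<rho>" "\<rho> \<le> 1" "\<delta> \<le> \<rho>" "Tsum \<le> \<rho> * real n"
    and ln: "8 \<le> ln (real (nat \<lfloor>1 / (4 * \<rho>)\<rfloor>))" "info \<rho> \<le> ln (real (nat \<lfloor>1 / (4 * \<rho>)\<rfloor>)) / 8"
  shows "ennreal (loss_const CARD('n) m * (a * \<rho> powr \<beta>)\<^sup>2) \<le> minimax_risk model P D sup_loss"
proof (rule sup_of_family[OF wide_family[OF \<rho>]])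
  have \<sigma>: "0 < 4 * \<rho>" using \<rho> by simp
  have b: "0 \<le> z $ j" "z $ j \<le> 1" if "z \<in> lattice_row i (4 * \<rho>)" for z :: "real^'n" and j
    using lattice_row_bounds[OF \<sigma> that, of j] \<sigma> by (auto split: if_splits)
  show "separated \<rho> (lattice_row i (4 * \<rho>))"
    using \<rho> by (intro separated_antimono[OF separated_lattice_row[OF \<sigma>]]) auto
  show "z $ i \<le> 1" if "z \<in> lattice_row i (4 * \<rho>)" for z by (rule b[OF that])
  show "lattice_row i (4 * \<rho>) \<subseteq> unit_cube" using b by (auto simp: unit_cube_def)
  show "8 \<le> ln (real (card (lattice_row i (4 * \<rho>))))" "info \<rho> \<le> ln (real (card (lattice_row i (4 * \<rho>)))) / 8"
    using ln by (simp_all add: card_lattice_row[OF \<sigma>])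
qed (rule finite_lattice_row)

end

section \<open>Choice of the constants\<close>

lemma powr_double: "((x::real) powr b)\<^sup>2 = x powr (2 * b)"
  by (simp add: power2_eq_square flip: powr_add)

lemma eight_le_exp_3: "(8::real) \<le> exp 3"
proof -
  have "(2::real) \<le> exp 1" using exp_ge_add_one_self[of 1] by simp
  then have "(2::real) ^ 3 \<le> exp 1 ^ 3" by (intro power_mono) auto
  then show ?thesis by (simp flip: exp_of_nat_mult)
qed

lemma exists_amplitude:
  fixes L :: "nat \<Rightarrow> real"
  assumes "\<And>k. k \<le> l \<Longrightarrow> 0 < L k" "0 < L\<beta>" "1 \<le> B" "0 < v" "0 \<le> K" "0 < \<epsilon>"
  obtains a where "0 < a" "a \<le> v" "a * B \<le> v" "\<And>k. k \<le> l \<Longrightarrow> a * B \<le> L k" "4 * a * B \<le> L\<beta>" "K * a\<^sup>2 \<le> \<epsilon>"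
proof
  define \<mu> where "\<mu> = Min (insert v (insert (L\<beta> / 4) (L ` {..l})))"
  \<comment> \<open>\<open>\<mu>\<close> collects the constraints that are linear in
    \<open>a\<close>; the bound a \<le> 1 reduces the quadratic one to a linear one through a^2
    \<le> a.\<close>
  define a where "a = min (\<mu> / B) (min 1 (\<epsilon> / (K + 1)))"
  have \<mu>: "0 < \<mu>" using assms by (auto simp: \<mu>_def)
  show a: "0 < a" using \<mu> assms by (simp add: a_def)
  have "a \<le> \<mu> / B" by (simp add: a_def)
  then have aB: "a * B \<le> \<mu>" using assms(3) by (simp add: field_simps)
  have \<mu>_le: "\<mu> \<le> x" if "x \<in> insert v (insert (L\<beta> / 4) (L ` {..l}))" for x
    unfolding \<mu>_def using that by (intro Min_le) auto
  show "a * B \<le> v" using aB \<mu>_le[of v] by simp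
  have "a * 1 \<le> a * B" using a assms(3) by (intro mult_left_mono) auto
  then show "a \<le> v" using \<open>a * B \<le> v\<close> by simp
  show "a * B \<le> L k" if "k \<le> l" for k using aB \<mu>_le[of "L k"] that by simp
  show "4 * a * B \<le> L\<beta>" using aB \<mu>_le[of "L\<beta> / 4"] by simp
  have "a\<^sup>2 \<le> a * 1" unfolding power2_eq_square using a by (intro mult_left_mono) (auto simp: a_def)
  also have "a * 1 \<le> \<epsilon> / (K + 1)" by (simp add: a_def)
  finally have "K * a\<^sup>2 \<le> K * (\<epsilon> / (K + 1))" using assms(5) by (rule mult_left_mono)
  also have "\<dots> \<le> \<epsilon>" using assms(5,6) by (simp add: field_simps)
  finally show "K * a\<^sup>2 \<le> \<epsilon>" .
qed

lemma exists_distinct_pair: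
  assumes "2 \<le> CARD('n::finite)"
  obtains i i' :: "'n::finite" where "i' \<noteq> i"
proof -
  have "\<not> CARD('n) \<le> Suc 0" using assms by simp
  then have "\<exists>i i' :: 'n. i \<noteq> i'" by (subst (asm) card_le_Suc0_iff_eq) auto
  then show ?thesis using that by blast
qed

text \<open>Here \<open>e\<close> stands for \<delta>^(d-1), \<open>p\<close> for 2\<beta> + d + 1
  and n / (e T) for N. For the last claim, x = T / n satisfies x^(p+1) \<le> e x = 1 / N.\<close>

lemma model_scale_bounds:
  fixes n T e \<beta> C Z v p :: real
  assumes C: "2 \<le> C" "2 * Z \<le> C" "Z / v < C" and Z: "0 < Z" and v: "0 < v"
    and n: "0 < n" and T: "0 < T" and e: "0 < e" and p: "0 < p"
    and lower: "C * max ((T / n) powr p) (1 / T) \<le> e"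
    and upper: "e \<le> 1 / C * min 1 (n / T)"
  shows "e < 1" "T \<le> n" "Z / (v * e) < T" "Z * (n / (e * T)) + 1 \<le> n" "C \<le> n / (e * T)"
    and "T / n \<le> (n / (e * T)) powr (- 1 / (p + 1))"
proof -
  have C0: "0 < C" using C by simp
  have "C * (T / n) powr p \<le> C * max ((T / n) powr p) (1 / T)" using C0 by (intro mult_left_mono) auto
  then have low1: "C * (T / n) powr p \<le> e" using lower by linarith
  have "C * (1 / T) \<le> C * max ((T / n) powr p) (1 / T)" using C0 by (intro mult_left_mono) auto
  then have "C * (1 / T) \<le> e" using lower by linarith
  then have low2: "C \<le> e * T" using T by (simp add: field_simps)
  have "1 / C * min 1 (n / T) \<le> 1 / C * 1" using C0 by (intro mult_left_mono) auto
  then have "e \<le> 1 / C" using upper by linarith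
  moreover have "1 / C \<le> 1 / 2" using C by (intro divide_left_mono) auto
  ultimately have e2: "e \<le> 1 / 2" by linarith
  then show e1: "e < 1" by simp
  have "1 / C * min 1 (n / T) \<le> 1 / C * (n / T)" using C0 by (intro mult_left_mono) auto
  then have "e \<le> 1 / C * (n / T)" using upper by linarith
  then show "C \<le> n / (e * T)" using C0 T e by (simp add: field_simps)
  have pw: "(T / n) powr p \<le> e"
  proof -
    have "1 * (T / n) powr p \<le> C * (T / n) powr p" using C by (intro mult_right_mono) auto
    then show ?thesis using low1 by linarith
  qed
  show Tn: "T \<le> n"
  proof (rule ccontr)
    assume "\<not> ?thesis"
    then have "1 \<le> (T / n) powr p" using n p by (intro ge_one_powr_ge_zero) auto
    then show False using pw e1 by linarith
  qed
  have "Z / v < e * T" using C low2 by linarith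
  then show "Z / (v * e) < T" using v e by (simp add: field_simps)
  have "e * T \<le> 1 * T" using e1 T by (intro mult_right_mono) auto
  then have "2 \<le> n" using C low2 Tn by linarith
  moreover have "Z * (n / (e * T)) \<le> n / 2"
  proof -
    have "2 * Z \<le> e * T" using C low2 by linarith
    then have "Z / (e * T) \<le> 1 / 2" using e T by (simp add: field_simps)
    then have "n * (Z / (e * T)) \<le> n * (1 / 2)" using n by (intro mult_left_mono) auto
    then show ?thesis by (simp add: mult.commute)
  qed
  ultimately show "Z * (n / (e * T)) + 1 \<le> n" by linarith
  define x where "x = T / n"
  have x: "0 < x" using T n by (simp add: x_def)
  have "x powr (p + 1) = x powr p * x" using x by (simp add: powr_add)
  also have "\<dots> \<le> e * x" using pw x by (intro mult_right_mono) (auto simp: x_def)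
  also have "\<dots> = 1 / (n / (e * T))" using e T n by (simp add: x_def)
  finally have "(x powr (p + 1)) powr (1 / (p + 1)) \<le> (1 / (n / (e * T))) powr (1 / (p + 1))"
    using p by (intro powr_mono2) auto
  moreover have "(x powr (p + 1)) powr (1 / (p + 1)) = x" using x p by (simp add: powr_powr)
  moreover have "(1 / (n / (e * T))) powr (1 / (p + 1)) = (n / (e * T)) powr (- 1 / (p + 1))"
    using e T n by (simp add: powr_divide powr_minus_divide)
  ultimately show "T / n \<le> (n / (e * T)) powr (- 1 / (p + 1))" by (simp add: x_def)
qed

text \<open>The bump widths \<open>N\<^bsup>-1/\<gamma>\<^esup>\<close> for the pointwise and the \<open>L\<^sup>2\<close> risk, and
  \<open>(N / ln N)\<^bsup>-1/\<gamma>\<^esup>\<close> for the uniform risk.\<close>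

lemma width_bounds:
  fixes N \<gamma> :: real
  assumes N: "exp (32 * \<gamma>) \<le> N" and \<gamma>: "1 \<le> \<gamma>"
  defines "w \<equiv> N powr (- 1 / \<gamma>)" and "u \<equiv> (N / ln N) powr (- 1 / \<gamma>)"
  shows "0 < w" "w \<le> 1 / 8" "N * w powr \<gamma> = 1" "0 < u" "u \<le> 1 / 8" "w \<le> u" "N * u powr \<gamma> = ln N"
    and "ln N / (4 * \<gamma>) \<le> ln (real (nat \<lfloor>1 / (4 * u)\<rfloor>))" "8 \<le> ln N / (4 * \<gamma>)"
proof -
  have N0: "0 < N" using N by (meson exp_gt_zero less_le_trans)
  have lnN: "32 * \<gamma> \<le> ln N" using N N0 by (simp add: ln_ge_iff)
  then have lnN1: "1 \<le> ln N" using \<gamma> by simp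
  then have N1: "1 < N" using ln_gt_zero_iff[OF N0] by simp
  have le8: "x \<le> 1 / 8" if "0 < x" "ln x \<le> - 3" for x :: real
  proof -
    have "x = exp (ln x)" using that by simp
    also have "\<dots> \<le> exp (- 3)" using that(2) by (simp only: exp_le_cancel_iff)
    also have "\<dots> \<le> 1 / 8" using eight_le_exp_3 by (simp add: exp_minus field_simps)
    finally show ?thesis .
  qed
  show w0: "0 < w" using N0 by (simp add: w_def)
  show u0: "0 < u" using N0 N1 by (simp add: u_def)
  \<comment> \<open>The 32 in the assumption is 4 times 8: about N^(1/(4\<gamma>)) bumps are
    available, and \<open>many_hypotheses_bound\<close> wants the logarithm of their number to be at
    least 8.\<close>
  define q where "q = ln N / \<gamma>"
  have "ln w = - q" using N0 by (simp add: w_def ln_powr q_def)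
  moreover have ratio: "32 \<le> q" using lnN \<gamma> by (simp add: q_def field_simps)
  ultimately show "w \<le> 1 / 8" by (intro le8 w0) simp
  show "8 \<le> ln N / (4 * \<gamma>)" using lnN \<gamma> by (simp add: field_simps)
  have e: "- 1 / \<gamma> * \<gamma> = - 1" using \<gamma> by simp
  show "N * w powr \<gamma> = 1"
    unfolding w_def powr_powr e using N0 by (simp add: powr_minus_divide)
  show "N * u powr \<gamma> = ln N"
    unfolding u_def powr_powr e using N0 N1 lnN1 by (simp add: powr_minus_divide)
  show "w \<le> u"
  proof -
    have "N / ln N \<le> N / 1" using N0 N1 lnN1 by (intro divide_left_mono) auto
    then show ?thesis unfolding w_def u_def using N0 N1 lnN1 \<gamma> by (intro powr_mono2') auto
  qed
  have lnln: "ln (ln N) \<le> ln N / 2"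
  proof -
    have "ln (ln N) = ln (ln N / 2) + ln 2" using lnN1 by (simp add: ln_div)
    also have "ln (ln N / 2) \<le> ln N / 2 - 1" using lnN1 by (intro ln_le_minus_one) auto
    also have "ln (2::real) \<le> 1" using ln_le_minus_one[of 2] by simp
    finally show ?thesis by simp
  qed
  have "ln u = - ((ln N - ln (ln N)) / \<gamma>)" using N0 N1 lnN1 by (simp add: u_def ln_powr ln_div)
  moreover have "ln N / 2 / \<gamma> \<le> (ln N - ln (ln N)) / \<gamma>"
    using lnln \<gamma> by (intro divide_right_mono) auto
  moreover have "ln N / 2 / \<gamma> = q / 2" by (simp add: q_def)
  ultimately have lnu: "ln u \<le> - (q / 2)" by linarith
  then show u8: "u \<le> 1 / 8" using ratio by (intro le8 u0) linarith
  \<comment> \<open>There are at least 1 / (8 u) lattice points; half of \<open>q\<close> minus ln 8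
    still exceeds a quarter of \<open>q\<close>, as q \<ge> 32.\<close>
  have "ln (8::real) \<le> ln (exp 3)" using eight_le_exp_3 by (subst ln_le_cancel_iff) auto
  then have "q / 4 \<le> - ln u - ln 8" unfolding ln_exp using lnu ratio by linarith
  also have "\<dots> = ln (1 / (2 * (4 * u)))" using u0 by (simp add: ln_div ln_mult)
  also have "\<dots> \<le> ln (real (nat \<lfloor>1 / (4 * u)\<rfloor>))"
  proof -
    have "1 / (2 * (4 * u)) \<le> real (nat \<lfloor>1 / (4 * u)\<rfloor>)" using u0 u8 by (intro lattice_size) auto
    then show ?thesis using u0 by (intro ln_mono) auto
  qed
  finally show "ln N / (4 * \<gamma>) \<le> ln (real (nat \<lfloor>1 / (4 * u)\<rfloor>))" by (simp add: q_def mult.commute)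
qed

lemma ennreal_rate_le:
  assumes "0 < C" "ennreal (c * (a * x powr b)\<^sup>2) \<le> R" "g \<le> C * (c * a\<^sup>2 * x powr (2 * b))"
  shows "ennreal g \<le> ennreal C * R"
proof -
  have "ennreal g \<le> ennreal (C * (c * (a * x powr b)\<^sup>2))"
    using assms(3) by (intro ennreal_leI) (simp add: power_mult_distrib powr_double mult_ac)
  also have "\<dots> = ennreal C * ennreal (c * (a * x powr b)\<^sup>2)"
    using assms(1) by (intro ennreal_mult') auto
  also have "\<dots> \<le> ennreal C * R" using assms(2) by (rule mult_left_mono) simp
  finally show ?thesis .
qed

theorem corollary4p11:
  fixes \<beta> :: real and L :: "nat \<Rightarrow> real" and L\<beta> Cnoise Ccvrtm :: real
  assumes "CARD('n::finite) \<ge> 2"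
    and "\<beta> \<ge> 1"
    and "\<And>k. k \<le> smoothness_order \<beta> \<Longrightarrow> L k > 0"
    and "L\<beta> > 0"
    and "Cnoise > 0" and "Ccvrtm > 0"
  shows "\<exists>C>0. \<forall>(n::nat) (\<delta>::real) (Tsum::real) (P :: (real^'n) measure) (D :: design).
    n > 0 \<and> \<delta> > 0 \<and> Tsum > 0 \<and>
    centered_noise P \<and> noise_condition Cnoise P \<and>
    (\<forall>(f :: real^'n \<Rightarrow> real^'n, xs, Ts) \<in> snake_model \<beta> L L\<beta> \<delta> Tsum n.
       valid_times n Ts (D Ts) \<and> cover_time Ccvrtm n Tsum Ts (D Ts)) \<and>
    C * max ((Tsum / real n) powr (2 * \<beta> + real CARD('n) + 1)) (1 / Tsum) \<le> \<delta> ^ (CARD('n) - 1) \<and>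
    \<delta> ^ (CARD('n) - 1) \<le> 1 / C * min 1 (real n / Tsum)
    \<longrightarrow>
    (let \<Theta> = snake_model \<beta> L L\<beta> \<delta> Tsum n;
         N = real n / (\<delta> ^ (CARD('n) - 1) * Tsum);
         r = 2 * \<beta> / (2 * (\<beta> + 1) + real CARD('n))
     in (\<forall>x0\<in>unit_cube. ennreal C * minimax_risk \<Theta> P D (point_loss x0)
           \<ge> ennreal (\<delta> powr (2 * \<beta>) + N powr (- r))) \<and>
        ennreal C * minimax_risk \<Theta> P D sup_loss
           \<ge> ennreal (\<delta> powr (2 * \<beta>) + (N / ln N) powr (- r)) \<and>
        ennreal C * minimax_risk \<Theta> P D L2_loss
           \<ge> ennreal (\<delta> powr (2 * \<beta>) + N powr (- r)))"
proof -
  \<comment> \<open>Half of the bound on the drift goes to the base speed, the other half is left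
    for the bumps.\<close>
  define v where "v = L 0 / 2"
  define m where "m = smoothness_order \<beta> + 2"
  define \<gamma> where "\<gamma> = 2 * (\<beta> + 1) + real CARD('n)"
  define K where "K = 5 * (3 * real CARD('n)) ^ (CARD('n) - 1) * (1 + Ccvrtm / v) * Cnoise / v\<^sup>2"
  define Z :: real where "Z = 7 ^ CARD('n) * real CARD('n) ^ (CARD('n) - 1)"
  have v: "0 < v" using assms(3)[of 0] by (simp add: v_def)
  have \<gamma>: "1 \<le> \<gamma>" using \<open>1 \<le> \<beta>\<close> by (simp add: \<gamma>_def)
  have Z: "0 < Z" by (simp add: Z_def)
  obtain i i' :: 'n where i': "i' \<noteq> i" by (rule exists_distinct_pair[OF assms(1)])
  have B: "1 \<le> bump_bound CARD('n) m" by (intro bump_bound_ge_1) (simp add: Suc_le_eq)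
  have "0 \<le> Ccvrtm / v" using v assms(6) by simp
  then have K: "0 \<le> K"
    unfolding K_def using assms(5) by (intro divide_nonneg_nonneg mult_nonneg_nonneg) auto
  \<comment> \<open>\<open>K\<close> is the prefactor in info \<rho> = K a^2 N \<rho>^\<gamma>. This
    bound on K a^2 gives at most ln N / (32 \<gamma>) at width u, an eighth of the guaranteed
    logarithm of the number of bumps, and at most 1 at width w.\<close>
  have \<epsilon>: "0 < 1 / (32 * \<gamma>)" using \<gamma> by simp
  obtain a where amp: "0 < a" "a \<le> v" "a * bump_bound CARD('n) m \<le> v"
    "\<And>k. k \<le> smoothness_order \<beta> \<Longrightarrow> a * bump_bound CARD('n) m \<le> L k"
    "4 * a * bump_bound CARD('n) m \<le> L\<beta>" "K * a\<^sup>2 \<le> 1 / (32 * \<gamma>)"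
    using exists_amplitude[where l="smoothness_order \<beta>" and L=L, OF assms(3,4) B v K \<epsilon>] by blast
  define c where "c = loss_const CARD('n) m"
  \<comment> \<open>The loss incurred because an invisible bump has half-width \<delta> / (4 d)
    instead of \<delta>.\<close>
  define b where "b = (4 * real CARD('n)) powr (2 * \<beta>)"
  have c: "0 < c * a\<^sup>2" using amp loss_const_pos by (simp add: c_def)
  have b: "1 \<le> b" unfolding b_def using assms(1,2) by (intro ge_one_powr_ge_zero) auto
  \<comment> \<open>One summand per requirement: the first three for a cover within the limits on
    time and observations, the fourth for N to be large, the last to convert the squared bump height
    into the sum of both rates.\<close>
  define C where "C = 2 + 2 * Z + Z / v + exp (32 * \<gamma>) + 2 * b / (c * a\<^sup>2)"
  have C_parts: "0 \<le> 2 * Z" "0 \<le> Z / v" "0 \<le> exp (32 * \<gamma>)" "0 \<le> 2 * b / (c * a\<^sup>2)"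
    using Z v b c by auto
  have C: "2 \<le> C" "2 * Z \<le> C" "Z / v < C" "exp (32 * \<gamma>) \<le> C" "2 * b / (c * a\<^sup>2) \<le> C"
    unfolding C_def using C_parts by linarith+
  have Cc: "2 * b \<le> C * (c * a\<^sup>2)" using C(5) c by (simp add: field_simps)
  then have Cc': "2 \<le> C * (c * a\<^sup>2)" using b by linarith
  show ?thesis
  proof (intro exI[of _ C] conjI allI impI)
    show C0: "0 < C" using C by simp
    fix n :: nat and \<delta> Tsum :: real and P :: "(real^'n) measure" and D :: design
    assume H: "n > 0 \<and> \<delta> > 0 \<and> Tsum > 0 \<and>
      centered_noise P \<and> noise_condition Cnoise P \<and>
      (\<forall>(f :: real^'n \<Rightarrow> real^'n, xs, Ts) \<in> snake_model \<beta> L L\<beta> \<delta> Tsum n.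
         valid_times n Ts (D Ts) \<and> cover_time Ccvrtm n Tsum Ts (D Ts)) \<and>
      C * max ((Tsum / real n) powr (2 * \<beta> + real CARD('n) + 1)) (1 / Tsum) \<le> \<delta> ^ (CARD('n) - 1) \<and>
      \<delta> ^ (CARD('n) - 1) \<le> 1 / C * min 1 (real n / Tsum)"
    define N where "N = real n / (\<delta> ^ (CARD('n) - 1) * Tsum)"
    define r where "r = 2 * \<beta> / (2 * (\<beta> + 1) + real CARD('n))"
    have pos: "0 < real n" "0 < Tsum" "0 < \<delta>" "0 < \<delta> ^ (CARD('n) - 1)" using H by auto
    have p: "2 * \<beta> + real CARD('n) + 1 + 1 = \<gamma>" by (simp add: \<gamma>_def)
    have p0: "0 < 2 * \<beta> + real CARD('n) + 1" using assms(2) by (intro add_nonneg_pos) auto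
    note scale = model_scale_bounds[OF C(1-3) Z v pos(1,2,4) p0, unfolded p, folded N_def]
    have sc: "\<delta> ^ (CARD('n) - 1) < 1" "Tsum \<le> real n" "Z / (v * \<delta> ^ (CARD('n) - 1)) < Tsum"
      "Z * N + 1 \<le> real n" "C \<le> N" "Tsum / real n \<le> N powr (- 1 / \<gamma>)"
      using scale H by blast+
    have \<delta>1: "\<delta> \<le> 1"
    proof (rule ccontr)
      assume "\<not> ?thesis"
      then have "1 \<le> \<delta> ^ (CARD('n) - 1)" by (intro one_le_power) simp
      then show False using sc(1) by linarith
    qed
    have N: "exp (32 * \<gamma>) \<le> N" using C sc(5) by linarith
    define w where "w = N powr (- 1 / \<gamma>)"
    define u where "u = (N / ln N) powr (- 1 / \<gamma>)"
    note wu = width_bounds[OF N \<gamma>, folded w_def u_def]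
    interpret snake_setting \<beta> L L\<beta> Cnoise Ccvrtm n \<delta> Tsum P D i i' m a v
    proof
      show "v + a * bump_bound CARD('n) m \<le> L 0" using amp(3) by (simp add: v_def)
      show "valid_times n Ts (D Ts) \<and> cover_time Ccvrtm n Tsum Ts (D Ts)"
        if "(f :: real^'n \<Rightarrow> real^'n, xs, Ts) \<in> snake_model \<beta> L L\<beta> \<delta> Tsum n" for f xs Ts
        using H that by fast
    qed (use assms m_def amp H \<delta>1 i' sc in \<open>auto simp: Z_def N_def\<close>)
    have info: "info \<rho> = K * a\<^sup>2 * (N * \<rho> powr \<gamma>)" if "0 < \<rho>" for \<rho>
      using info_eq[OF that] by (simp add: K_def N_def \<gamma>_def)
    have Tw: "Tsum \<le> w * real n" using sc(6) pos by (simp add: w_def field_simps)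
    then have Tu: "Tsum \<le> u * real n"
      using wu(6) pos by (meson mult_right_mono less_imp_le order_trans)
    have info_w: "info w \<le> 1"
    proof -
      have "1 / (32 * \<gamma>) \<le> 1" using \<gamma> by simp
      then show ?thesis using info[OF wu(1)] wu(3) amp(6) by simp
    qed
    have info_u: "info u \<le> ln (real (nat \<lfloor>1 / (4 * u)\<rfloor>)) / 8"
    proof -
      have "8 * (4 * \<gamma>) \<le> ln N" using wu(9) \<gamma> by (simp add: pos_le_divide_eq)
      then have "0 \<le> ln N" using \<gamma> by linarith
      then have "K * a\<^sup>2 * ln N \<le> 1 / (32 * \<gamma>) * ln N" by (intro mult_right_mono amp(6))
      then have "info u \<le> ln N / (4 * \<gamma>) / 8" using info[OF wu(4)] wu(7) by simp
      also have "\<dots> \<le> ln (real (nat \<lfloor>1 / (4 * u)\<rfloor>)) / 8"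
        by (rule divide_right_mono[OF wu(8)]) simp
      finally show ?thesis .
    qed
    have r_eq: "- r = - 1 / \<gamma> * (2 * \<beta>)" by (simp add: r_def \<gamma>_def)
    have rate_w: "N powr (- r) = w powr (2 * \<beta>)"
      unfolding w_def powr_powr r_eq ..
    have rate_u: "(N / ln N) powr (- r) = u powr (2 * \<beta>)"
      unfolding u_def powr_powr r_eq ..
    have wide: "ennreal (\<delta> powr (2 * \<beta>) + x powr (2 * \<beta>)) \<le> ennreal C * R"
      if R: "ennreal (loss_const CARD('n) m * (a * x powr \<beta>)\<^sup>2) \<le> R" and x: "\<delta> \<le> x" for x R
    proof (rule ennreal_rate_le[OF C0 R])
      have "\<delta> powr (2 * \<beta>) \<le> x powr (2 * \<beta>)" using x pos assms(2) by (intro powr_mono2) auto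
      then have "\<delta> powr (2 * \<beta>) + x powr (2 * \<beta>) \<le> 2 * x powr (2 * \<beta>)" by simp
      also have "\<dots> \<le> C * (c * a\<^sup>2) * x powr (2 * \<beta>)" using Cc' by (intro mult_right_mono) auto
      finally show "\<delta> powr (2 * \<beta>) + x powr (2 * \<beta>) \<le> C * (loss_const CARD('n) m * a\<^sup>2 * x powr (2 * \<beta>))"
        by (simp add: c_def mult_ac)
    qed
    have gap: "ennreal (\<delta> powr (2 * \<beta>) + x powr (2 * \<beta>)) \<le> ennreal C * R"
      if R: "ennreal (loss_const CARD('n) m * (a * (\<delta> / (4 * real CARD('n))) powr \<beta>)\<^sup>2) \<le> R"
        and x: "x \<le> \<delta>" "0 \<le> x" for x R
    proof (rule ennreal_rate_le[OF C0 R])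
      have "x powr (2 * \<beta>) \<le> \<delta> powr (2 * \<beta>)" using x assms(2) by (intro powr_mono2) auto
      then have "\<delta> powr (2 * \<beta>) + x powr (2 * \<beta>) \<le> 2 * \<delta> powr (2 * \<beta>)" by simp
      also have "\<dots> = 2 * b * (\<delta> / (4 * real CARD('n))) powr (2 * \<beta>)"
        using b pos by (simp add: b_def powr_divide)
      also have "\<dots> \<le> C * (c * a\<^sup>2) * (\<delta> / (4 * real CARD('n))) powr (2 * \<beta>)"
        using Cc by (intro mult_right_mono) auto
      finally show "\<delta> powr (2 * \<beta>) + x powr (2 * \<beta>)
          \<le> C * (loss_const CARD('n) m * a\<^sup>2 * (\<delta> / (4 * real CARD('n))) powr (2 * \<beta>))"
        by (simp add: c_def mult_ac)
    qed
    have point: "ennreal (\<delta> powr (2 * \<beta>) + N powr (- r)) \<le> ennreal C * minimax_risk model P D (point_loss x0)"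
      if x0: "x0 \<in> unit_cube" for x0
    proof (cases "\<delta> \<le> w")
      case True
      then show ?thesis unfolding rate_w
        using wu(1,2) Tw info_w x0 by (intro wide point_wide) auto
    next
      case False
      then show ?thesis unfolding rate_w
        using wu(1) x0 by (intro gap point_gap) auto
    qed
    have L2: "ennreal (\<delta> powr (2 * \<beta>) + N powr (- r)) \<le> ennreal C * minimax_risk model P D L2_loss"
    proof (cases "\<delta> \<le> w")
      case True
      then show ?thesis unfolding rate_w
        using wu(1,2) Tw info_w by (intro wide L2_wide) auto
    next
      case False
      then show ?thesis unfolding rate_w
        using wu(1) by (intro gap L2_gap) auto
    qed
    have sup: "ennreal (\<delta> powr (2 * \<beta>) + (N / ln N) powr (- r)) \<le> ennreal C * minimax_risk model P D sup_loss"
    proof (cases "\<delta> \<le> u")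
      case True
      have "8 \<le> ln (real (nat \<lfloor>1 / (4 * u)\<rfloor>))" by (rule order_trans[OF wu(9) wu(8)])
      then show ?thesis unfolding rate_u
        using True wu(4,5) Tu info_u by (intro wide sup_wide) auto
    next
      case False
      \<comment> \<open>For \<delta> above u the rate \<delta>^(2\<beta>) dominates and carries no
        logarithm, so one invisible bump at an arbitrary point of the cube is enough.\<close>
      have zero: "(0 :: real^'n) \<in> unit_cube" by (simp add: unit_cube_def)
      have "minimax_risk model P D (point_loss 0) \<le> minimax_risk model P D sup_loss"
        by (intro minimax_risk_mono) (auto simp: point_loss_def sup_loss_def intro!: SUP_upper2[OF zero])
      then show ?thesis unfolding rate_u
        using False wu(4) point_gap[OF zero] by (intro gap) (auto elim: order_trans)
    qed
    show "let \<Theta> = snake_model \<beta> L L\<beta> \<delta> Tsum n;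
         N = real n / (\<delta> ^ (CARD('n) - 1) * Tsum);
         r = 2 * \<beta> / (2 * (\<beta> + 1) + real CARD('n))
     in (\<forall>x0\<in>unit_cube. ennreal C * minimax_risk \<Theta> P D (point_loss x0)
           \<ge> ennreal (\<delta> powr (2 * \<beta>) + N powr (- r))) \<and>
        ennreal C * minimax_risk \<Theta> P D sup_loss
           \<ge> ennreal (\<delta> powr (2 * \<beta>) + (N / ln N) powr (- r)) \<and>
        ennreal C * minimax_risk \<Theta> P D L2_loss
           \<ge> ennreal (\<delta> powr (2 * \<beta>) + N powr (- r))"
      unfolding Let_def N_def[symmetric] r_def[symmetric]
      using point sup L2 by blast
  qed
qed

end
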